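(* Let $\alpha\in(0,1)$, let $\Omega\subset\mathbb{R}^n$ be a strictly convex, bounded domain of class $C^{2,\alpha}$, let $\phi\in C^{2,\alpha}(\bar\Omega)$, and let $f\in C^{0,\alpha}(\bar\Omega)$ be strictly positive on $\bar\Omega$. Let $B_0:\bar\Omega\to\mathcal{B}$ be a $\mathcal{B}$-valued function with entries $(B_0)_{ij}\in C^{0,\alpha}(\bar\Omega)$. Assume that there exists a sequence $\{u_k\}_{k\ge 0}\subset C^{2,\alpha}(\bar\Omega)$ such that, for every $k\ge 0$, $u_k$ is strongly convex and solves the linear Dirichlet problem $$\begin{cases}\operatorname{tr}\big(B_k(x)\,D^2u_k(x)\big)=n\,f(x)^{1/n}, & x\in\Omega,\\ u_k(x)=\phi(x), & x\in\partial\Omega,\end{cases}$$ where, for $k\ge 1$, $$B_k(x)=\big(\det D^2u_{k-1}(x)\big)^{1/n}\,\big(D^2u_{k-1}(x)\big)^{-1}.$$ Denote by $\lambda_{\min}^k(x)$ the smallest eigenvalue of $D^2u_k(x)$ and assume that there exists $\epsilon>0$ such that $\lambda_{\min}^k(x)\ge\epsilon$ for every $k\ge 0$ and every $x\in\bar\Omega$. Then the sequence $\{u_k\}_{k\ge 0}$ converges uniformly on $\bar\Omega$ to a convex function $\tilde u\in C^{1,1}(\bar\Omega)$ which solves the Dirichlet problem for the Monge--Ampère equation $$\begin{cases}\det\big(D^2\tilde u(x)\big)=f(x), & x\in\Omega,\\ \tilde u(x)=\phi(x), & x\in\partial\Omega.\end{cases}$$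
   Context: $\mathcal{B}$ denotes the set of real symmetric positive definite $n\times n$ matrices with determinant $1$. $D^2u$ denotes the Hessian matrix of $u$ and $\operatorname{tr}$ the trace. A function $u\in C^2(\bar\Omega)$ is strongly convex if there is $c>0$ such that all eigenvalues of $D^2u(x)$ are at least $c$ for all $x\in\bar\Omega$. For a convex function $u$ that is not $C^2$, the equation $\det(D^2u)=f$ is understood in the sense of Aleksandrov: the Monge--Ampère measure of $u$ is $\mu_u(E)=\operatorname{Leb}(\partial u(E))$ for Borel sets $E\subset\Omega$, where $\operatorname{Leb}$ is Lebesgue measure, $\partial u(E)=\bigcup_{x\in E}\partial u(x)$, and $\partial u(x)$ is the subdifferential of $u$ at $x$ (the set of slopes of supporting hyperplanes to the graph of $u$ at $x$). The equation means $\mu_u(E)=\int_E f\,dx$ for every Borel set $E\subset\Omega$. *)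

theory Defs
  imports "HOL-Analysis.Analysis"
begin

subsection \<open>Derivatives up to the boundary and Hoelder spaces\<close>

definition grad :: "(real^'n \<Rightarrow> real) \<Rightarrow> real^'n \<Rightarrow> real^'n" where
  "grad u x = (\<chi> i. frechet_derivative u (at x) (axis i 1))"

definition hess :: "(real^'n \<Rightarrow> real) \<Rightarrow> real^'n \<Rightarrow> real^'n^'n" where
  "hess u x = jacobian (grad u) (at x)"

text \<open>For \<open>u\<close> of class \<open>C\<^sup>2\<close> up to the boundary, \<open>D\<^sup>2u\<close> at a boundary point is the limit of the
  classical Hessian from inside \<open>\<Omega>\<close>. So \<open>D2 \<Omega> u\<close> depends only on the values of \<open>u\<close> in \<open>\<Omega>\<close> (which is
  always open below), although \<open>u\<close> is formally a total function.\<close>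

definition D2 :: "(real^'n) set \<Rightarrow> (real^'n \<Rightarrow> real) \<Rightarrow> real^'n \<Rightarrow> real^'n^'n" where
  "D2 \<Omega> u x = (if x \<in> \<Omega> then hess u x else Lim (at x within \<Omega>) (hess u))"

definition holder_on ::
    "real \<Rightarrow> 'a::real_normed_vector set \<Rightarrow> ('a \<Rightarrow> 'b::real_normed_vector) \<Rightarrow> bool" where
  "holder_on \<alpha> S f \<longleftrightarrow> (\<exists>C. \<forall>x\<in>S. \<forall>y\<in>S. norm (f x - f y) \<le> C * norm (x - y) powr \<alpha>)"

definition extends_to_closure ::
    "'a::topological_space set \<Rightarrow> ('a \<Rightarrow> 'b::topological_space) \<Rightarrow> bool" where
  "extends_to_closure \<Omega> g \<longleftrightarrow> (\<exists>G. continuous_on (closure \<Omega>) G \<and> (\<forall>x\<in>\<Omega>. G x = g x))"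

text \<open>The spaces \<open>C\<^sup>1\<close>, \<open>C\<^sup>2\<close>, \<open>C\<^sup>1\<^sup>,\<^sup>\<alpha>\<close>, \<open>C\<^sup>2\<^sup>,\<^sup>\<alpha>\<close> on the closure of an open set \<open>\<Omega>\<close>: all derivatives up to the given
  order exist in \<open>\<Omega>\<close> and extend continuously to the closure, those of top order being uniformly
  \<open>\<alpha>\<close>-Hoelder continuous in the case of \<open>C\<^sup>k\<^sup>,\<^sup>\<alpha>\<close>.\<close>

definition C1_closure :: "(real^'n) set \<Rightarrow> (real^'n \<Rightarrow> real) \<Rightarrow> bool" where
  "C1_closure \<Omega> u \<longleftrightarrow>
     continuous_on (closure \<Omega>) u \<and>
     (\<forall>x\<in>\<Omega>. u differentiable (at x)) \<and> extends_to_closure \<Omega> (grad u)"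

definition C2_closure :: "(real^'n) set \<Rightarrow> (real^'n \<Rightarrow> real) \<Rightarrow> bool" where
  "C2_closure \<Omega> u \<longleftrightarrow>
     C1_closure \<Omega> u \<and>
     (\<forall>x\<in>\<Omega>. grad u differentiable (at x)) \<and> extends_to_closure \<Omega> (hess u)"

definition C1_holder_closure :: "real \<Rightarrow> (real^'n) set \<Rightarrow> (real^'n \<Rightarrow> real) \<Rightarrow> bool" where
  "C1_holder_closure \<alpha> \<Omega> u \<longleftrightarrow> C1_closure \<Omega> u \<and> holder_on \<alpha> \<Omega> (grad u)"

definition C2_holder_closure :: "real \<Rightarrow> (real^'n) set \<Rightarrow> (real^'n \<Rightarrow> real) \<Rightarrow> bool" where
  "C2_holder_closure \<alpha> \<Omega> u \<longleftrightarrow> C2_closure \<Omega> u \<and> holder_on \<alpha> \<Omega> (hess u)"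

subsection \<open>Domains\<close>

text \<open>Local straightening of the boundary by \<open>C\<^sup>2\<^sup>,\<^sup>\<alpha>\<close> diffeomorphisms (Gilbarg and Trudinger). As the
  index type \<open>'n\<close> has no distinguished last coordinate, the half space is \<open>{y. y $ i > 0}\<close> for some
  \<open>i\<close>. Requiring the regularity of \<open>\<psi>\<close> and of its inverse up to the closure is no restriction, since
  the ball may be shrunk.\<close>

definition C2_holder_domain :: "real \<Rightarrow> (real^'n) set \<Rightarrow> bool" where
  "C2_holder_domain \<alpha> \<Omega> \<longleftrightarrow>
     (\<forall>x0\<in>frontier \<Omega>. \<exists>r>0. \<exists>(D::(real^'n) set) \<psi> \<psi>' i.
        open D \<and> homeomorphism (ball x0 r) D \<psi> \<psi>' \<and>
        \<psi> ` (ball x0 r \<inter> \<Omega>) \<subseteq> {y. y $ i > 0} \<and>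
        \<psi> ` (ball x0 r \<inter> frontier \<Omega>) \<subseteq> {y. y $ i = 0} \<and>
        (\<forall>j. C2_holder_closure \<alpha> (ball x0 r) (\<lambda>x. \<psi> x $ j)) \<and>
        (\<forall>j. C2_holder_closure \<alpha> D (\<lambda>y. \<psi>' y $ j)))"

definition strictly_convex :: "'a::euclidean_space set \<Rightarrow> bool" where
  "strictly_convex S \<longleftrightarrow>
     convex S \<and> (\<forall>x\<in>closure S. \<forall>y\<in>closure S. x \<noteq> y \<longrightarrow> open_segment x y \<subseteq> interior S)"

subsection \<open>Matrices and convexity\<close>

definition eigenvals :: "real^'n^'n \<Rightarrow> real set" where
  "eigenvals A = {l. \<exists>v. v \<noteq> 0 \<and> A *v v = l *\<^sub>R v}"

definition unimodular_spd :: "(real^'n^'n) set" where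
  "unimodular_spd =
     {A. transpose A = A \<and> (\<forall>v. v \<noteq> 0 \<longrightarrow> v \<bullet> (A *v v) > 0) \<and> det A = 1}"

definition strongly_convex :: "(real^'n) set \<Rightarrow> (real^'n \<Rightarrow> real) \<Rightarrow> bool" where
  "strongly_convex \<Omega> u \<longleftrightarrow>
     C2_closure \<Omega> u \<and> (\<exists>c>0. \<forall>x\<in>closure \<Omega>. \<forall>l\<in>eigenvals (D2 \<Omega> u x). l \<ge> c)"

subsection \<open>Aleksandrov solutions\<close>

definition subdifferential :: "(real^'n) set \<Rightarrow> (real^'n \<Rightarrow> real) \<Rightarrow> real^'n \<Rightarrow> (real^'n) set" where
  "subdifferential \<Omega> u x = {p. \<forall>y\<in>\<Omega>. u y \<ge> u x + p \<bullet> (y - x)}"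

definition monge_ampere :: "(real^'n) set \<Rightarrow> (real^'n \<Rightarrow> real) \<Rightarrow> (real^'n) set \<Rightarrow> ennreal" where
  "monge_ampere \<Omega> u E = emeasure lebesgue (\<Union>x\<in>E. subdifferential \<Omega> u x)"

text \<open>\<open>emeasure\<close> is \<open>0\<close> on non-measurable sets, hence the explicit measurability of \<open>\<partial>u(E)\<close>.\<close>

definition aleksandrov_solution ::
    "(real^'n) set \<Rightarrow> (real^'n \<Rightarrow> real) \<Rightarrow> (real^'n \<Rightarrow> real) \<Rightarrow> bool" where
  "aleksandrov_solution \<Omega> f u \<longleftrightarrow>
     (\<forall>E\<in>sets borel. E \<subseteq> \<Omega> \<longrightarrow>
        (\<Union>x\<in>E. subdifferential \<Omega> u x) \<in> sets lebesgue \<and>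
        monge_ampere \<Omega> u E = (\<integral>\<^sup>+x\<in>E. ennreal (f x) \<partial>lborel))"

end

theory Submission
  imports Defs
begin

text \<open>
  By AM--GM, \<open>det (D\<^sup>2 u\<^sub>k) \<le> f\<close> for \<open>k \<ge> 1\<close>. With the lower bound \<open>\<epsilon>\<close> on the eigenvalues this gives
  \<open>\<epsilon> \<le> D\<^sup>2 u\<^sub>k \<le> M\<close> uniformly in \<open>k\<close>. By AM--GM again, \<open>tr (B\<^sub>k\<^sub>+\<^sub>1 D\<^sup>2 (u\<^sub>k\<^sub>+\<^sub>1 - u\<^sub>k)) \<ge> 0\<close>, so by the maximum
  principle \<open>u\<^sub>k\<close> decreases for \<open>k \<ge> 1\<close>, and it converges uniformly to a strongly convex \<open>v\<close> whose gradient is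
  injective and Lipschitz.

  To identify the Monge--Ampere measure of \<open>v\<close>, put \<open>u\<^sub>k\<^sub>,\<^sub>t = (1 - t) u\<^sub>k + t u\<^sub>k\<^sub>+\<^sub>1\<close>. For every \<open>t\<close> these functions
  converge to \<open>v\<close>, hence \<open>\<integral>\<^sub>K det (D\<^sup>2 u\<^sub>k\<^sub>,\<^sub>t) \<longlonglongrightarrow> Leb (grad v ` K)\<close> for every box \<open>K\<close>, with a limit independent
  of \<open>t\<close>. Therefore the integral of the derivative at \<open>t = 0\<close>, which with \<open>g\<^sub>k = det (D\<^sup>2 u\<^sub>k)\<close> is
  \<open>n g\<^sub>k ((f / g\<^sub>k)\<^sup>1\<^sup>/\<^sup>n - 1) \<ge> 0\<close>, tends to \<open>0\<close>. So \<open>g\<^sub>k\<close> tends to \<open>f\<close> in \<open>L\<^sup>1(K)\<close>, and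
  \<open>Leb (grad v ` K) = \<integral>\<^sub>K f\<close>.
\<close>

subsection \<open>Simultaneous diagonalization\<close>

text \<open>The obstacle: each iterate may have its own Hoelder constant, so only functions and
  gradients are known to converge, and the determinant of the Hessian is not continuous under such
  convergence. Weak continuity of Monge-Ampere measures gives a limit for the integrals of the
  determinants, but does not identify it. What identifies it is that the linear equation prescribes
  a derivative. With P the Hessian of \<open>u k\<close> and Q that of \<open>u (Suc k)\<close>, it
  fixes tr(inverse(P) Q), and det P (tr(inverse(P) Q) - n) is the derivative of det at P in the
  direction Q - P. To pass from difference quotients in t to this derivative, the second-order
  remainder must be uniform in \<open>k\<close> and \<open>x\<close>; the two-sided Hessian bounds
  serve this purpose. Since no Hessian of the limit is available, its properties are expressed by
  inequalities between values and gradients.\<close>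

definition diag_matrix :: "('n \<Rightarrow> real) \<Rightarrow> real^'n^'n" where
  "diag_matrix d = (\<chi> i j. if i = j then d i else 0)"

lemma diag_matrix_mult_vec: "diag_matrix d *v x = (\<chi> i. d i * x $ i)"
  by (simp add: diag_matrix_def matrix_vector_mult_def vec_eq_iff if_distrib if_distribR cong: if_cong)

lemma transpose_diag_matrix [simp]: "transpose (diag_matrix d) = diag_matrix d"
  by (simp add: diag_matrix_def transpose_def vec_eq_iff)

lemma diag_matrix_mult: "diag_matrix c ** diag_matrix d = diag_matrix (\<lambda>i. c i * d i)"
proof -
  have "(diag_matrix c ** diag_matrix d) $ i $ j = (\<Sum>k\<in>UNIV. if k = i then c i * (if i = j then d i else 0) else 0)" for i j
    unfolding matrix_matrix_mult_def diag_matrix_def vec_lambda_beta by (intro sum.cong) auto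
  then show ?thesis by (simp add: vec_eq_iff diag_matrix_def)
qed

lemma det_diag_matrix: "det (diag_matrix d) = (\<Prod>i\<in>UNIV. d i)"
  by (subst det_diagonal) (auto simp: diag_matrix_def)

lemma trace_diag_matrix: "trace (diag_matrix d) = (\<Sum>i\<in>UNIV. d i)"
  by (simp add: trace_def diag_matrix_def)

lemma inner_matrix_left: "(A *v x) \<bullet> y = x \<bullet> (transpose A *v y)" for A :: "real^'n^'m"
  by (metis dot_lmul_matrix inner_commute matrix_transpose_mul transpose_matrix_vector)

lemma inner_congruence_matrix:
  "x \<bullet> ((transpose T ** diag_matrix d ** T) *v y) = (\<Sum>i\<in>UNIV. d i * (T *v x) $ i * (T *v y) $ i)"
proof -
  have "x \<bullet> ((transpose T ** diag_matrix d ** T) *v y) = (T *v x) \<bullet> (diag_matrix d *v (T *v y))"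
    by (simp add: inner_matrix_left matrix_vector_mul_assoc matrix_mul_assoc)
  then show ?thesis
    by (simp add: diag_matrix_mult_vec inner_vec_def mult_ac)
qed

text \<open>A minimizer \<open>x\<close> of the Rayleigh quotient on the unit sphere of
  \<open>S\<close> is an eigenvector: the residual \<open>r\<close> of \<open>A *v x\<close> against
  \<open>l *\<^sub>R x\<close> again lies in \<open>S\<close>, and moving from \<open>x\<close> by
  \<open>t *\<^sub>R r\<close> changes the form minus l |y|^2 to first order by 2 t |r|^2, which
  minimality forbids unless \<open>r = 0\<close>.\<close>

lemma min_eigenvector_on_subspace:
  fixes A :: "real^'n^'n"
  assumes sym: "transpose A = A" and S: "subspace S" "z \<in> S" "z \<noteq> 0"
    and inv: "\<And>x. x \<in> S \<Longrightarrow> A *v x \<in> S"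
  obtains x l where "x \<in> S" "norm x = 1" "A *v x = l *\<^sub>R x"
    "\<And>y. y \<in> S \<Longrightarrow> l * (y \<bullet> y) \<le> y \<bullet> (A *v y)"
proof -
  let ?q = "\<lambda>y. y \<bullet> (A *v y)"
  let ?K = "S \<inter> sphere 0 1"
  have "compact ?K"
    by (simp add: S closed_Int_compact closed_subspace)
  moreover have "z /\<^sub>R norm z \<in> ?K"
    using S by (simp add: subspace_scale)
  moreover have "continuous_on ?K ?q"
    by (intro continuous_intros linear_continuous_on bounded_linear_intros)
       (auto intro: linear_continuous_on simp: matrix_vector_mul_bounded_linear)
  ultimately obtain x where x: "x \<in> ?K" and min: "\<And>y. y \<in> ?K \<Longrightarrow> ?q x \<le> ?q y"
    using continuous_attains_inf[of ?K ?q] by blast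
  define l where "l = ?q x"
  have Rayleigh: "l * (y \<bullet> y) \<le> ?q y" if "y \<in> S" for y
  proof (cases "y = 0")
    case False
    then have "y /\<^sub>R norm y \<in> ?K"
      using S that by (simp add: subspace_scale)
    from min[OF this] have "l \<le> ?q y / (norm y)\<^sup>2"
      by (simp add: l_def scaleR_matrix_vector_assoc[symmetric] matrix_vector_mult_scaleR field_simps power2_eq_square)
    then show ?thesis
      using False by (simp add: power2_norm_eq_inner field_simps)
  qed auto
  define r where "r = A *v x - l *\<^sub>R x"
  have rS: "r \<in> S"
    using x S inv by (auto simp: r_def intro: subspace_diff subspace_scale)
  have xx: "x \<bullet> x = 1"
    using x by (simp add: power2_norm_eq_inner[symmetric])
  have "0 \<le> 2 * t * (r \<bullet> r) + t\<^sup>2 * (?q r - l * (r \<bullet> r))" for t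
  proof -
    have "x + t *\<^sub>R r \<in> S"
      using x rS S by (auto intro: subspace_add subspace_scale)
    from Rayleigh[OF this]
    have "l * ((x + t *\<^sub>R r) \<bullet> (x + t *\<^sub>R r)) \<le> (x + t *\<^sub>R r) \<bullet> (A *v (x + t *\<^sub>R r))" .
    moreover have "x \<bullet> (A *v r) = r \<bullet> (A *v x)"
      by (metis inner_commute inner_matrix_left sym)
    moreover have "r \<bullet> (A *v x) = r \<bullet> r + l * (r \<bullet> x)"
      by (simp add: r_def inner_diff_right)
    ultimately have "l * (1 + 2 * t * (r \<bullet> x) + t\<^sup>2 * (r \<bullet> r))
        \<le> l + 2 * t * (r \<bullet> r + l * (r \<bullet> x)) + t\<^sup>2 * (r \<bullet> (A *v r))"
      using xx by (simp add: inner_add_left inner_add_right l_def[symmetric] power2_eq_square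
          matrix_vector_mult_scaleR matrix_vector_right_distrib inner_commute[of x r] algebra_simps)
    then show ?thesis by (simp add: algebra_simps)
  qed
  note key = this
  have "r \<bullet> r = 0"
  proof (rule ccontr)
    assume "r \<bullet> r \<noteq> 0"
    then have pos: "r \<bullet> r > 0" by simp
    \<comment> \<open>\<open>c\<close> is positive and dominates the quadratic coefficient, so at
      \<open>t = - (r \<bullet> r / c)\<close> the linear term wins: the sum is at most
      \<open>- ((r \<bullet> r)\<^sup>2 / c)\<close>.\<close>
    define c where "c = \<bar>?q r - l * (r \<bullet> r)\<bar> + 1"
    have "c > 0" "?q r - l * (r \<bullet> r) \<le> c" by (auto simp: c_def)
    have "0 \<le> 2 * (- (r \<bullet> r / c)) * (r \<bullet> r) + (r \<bullet> r / c)\<^sup>2 * (?q r - l * (r \<bullet> r))"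
      using key[of "- (r \<bullet> r / c)"] by simp
    also have "\<dots> \<le> 2 * (- (r \<bullet> r / c)) * (r \<bullet> r) + (r \<bullet> r / c)\<^sup>2 * c"
      using \<open>?q r - l * (r \<bullet> r) \<le> c\<close> by (intro add_left_mono mult_left_mono) auto
    also have "\<dots> = - ((r \<bullet> r)\<^sup>2 / c)"
      using \<open>c > 0\<close> by (simp add: field_simps power2_eq_square)
    finally show False
      using pos \<open>c > 0\<close> by (smt (verit) divide_pos_pos zero_less_power)
  qed
  then have "A *v x = l *\<^sub>R x" by (simp add: r_def)
  with that x Rayleigh show ?thesis by auto
qed

text \<open>Stated for all invariant subspaces so that induction on the dimension applies: once an
  eigenvector \<open>x\<close> is split off, symmetry of \<open>A\<close> makes the orthogonal
  complement of \<open>x\<close> in \<open>S\<close> invariant again.\<close>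

lemma orthonormal_eigenbasis:
  fixes A :: "real^'n^'n"
  assumes sym: "transpose A = A"
  shows "subspace S \<Longrightarrow> (\<And>x. x \<in> S \<Longrightarrow> A *v x \<in> S) \<Longrightarrow>
    \<exists>B\<subseteq>S. pairwise orthogonal B \<and> (\<forall>x\<in>B. norm x = 1 \<and> (\<exists>l. A *v x = l *\<^sub>R x)) \<and> span B = S"
proof (induction "dim S" arbitrary: S rule: less_induct)
  case less
  show ?case
  proof (cases "S \<subseteq> {0}")
    case True
    then have "span {} = S"
      using less.prems(1) subspace_0 by fastforce
    then show ?thesis
      by (intro exI[of _ "{}"]) auto
  next
    case False
    then obtain z where "z \<in> S" "z \<noteq> 0" by auto
    then obtain x l where x: "x \<in> S" "norm x = 1" "A *v x = l *\<^sub>R x"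
      using min_eigenvector_on_subspace[OF sym less.prems(1)] less.prems(2) by metis
    define S' where "S' = S \<inter> {y. orthogonal x y}"
    have sub: "subspace S'"
      by (simp add: S'_def less.prems(1) subspace_inter subspace_orthogonal_to_vector)
    have "x \<notin> S'"
      using x by (auto simp: S'_def orthogonal_def)
    have "S' \<subset> S" using x \<open>x \<notin> S'\<close> by (auto simp: S'_def)
    then have dim: "dim S' < dim S"
      using sub less.prems(1) by (metis dim_psubset span_eq_iff)
    have inv: "A *v y \<in> S'" if "y \<in> S'" for y
    proof -
      have "x \<bullet> (A *v y) = 0"
        using that x by (metis (no_types, lifting) IntE S'_def inner_commute inner_matrix_left
            inner_scaleR_left mem_Collect_eq mult_zero_right orthogonal_def sym)
      then show ?thesis
        using that less.prems(2) by (auto simp: S'_def orthogonal_def)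
    qed
    obtain B where B: "B \<subseteq> S'" "pairwise orthogonal B"
      "\<forall>x\<in>B. norm x = 1 \<and> (\<exists>l. A *v x = l *\<^sub>R x)" "span B = S'"
      using less.hyps[OF dim sub inv] by blast
    have "S \<subseteq> span (insert x B)"
    proof
      fix y assume "y \<in> S"
      have "y - (x \<bullet> y) *\<^sub>R x \<in> S'"
        using x \<open>y \<in> S\<close> less.prems(1)
        by (auto simp: S'_def orthogonal_def inner_diff_right power2_norm_eq_inner[symmetric]
            intro: subspace_diff subspace_scale)
      then have "y - (x \<bullet> y) *\<^sub>R x \<in> span (insert x B)"
        using B(4) by (metis span_mono subset_insertI subsetD)
      moreover have "(x \<bullet> y) *\<^sub>R x \<in> span (insert x B)"
        by (simp add: span_base span_scale)
      ultimately show "y \<in> span (insert x B)"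
        by (metis diff_add_cancel span_add)
    qed
    moreover have "span (insert x B) \<subseteq> S"
      using x B(1) less.prems(1) by (intro span_minimal) (auto simp: S'_def)
    moreover have "pairwise orthogonal (insert x B)"
      using B(1,2) by (auto simp: pairwise_insert S'_def orthogonal_commute)
    ultimately show ?thesis
      using x B by (intro exI[of _ "insert x B"]) (auto simp: S'_def)
  qed
qed

lemma symmetric_matrix_diagonalization:
  fixes A :: "real^'n^'n"
  assumes sym: "transpose A = A"
  obtains V d where "orthogonal_matrix V" "A = transpose V ** diag_matrix d ** V"
proof -
  obtain B where B: "pairwise orthogonal B" "span B = UNIV"
    "\<And>x. x \<in> B \<Longrightarrow> norm x = 1" "\<And>x. x \<in> B \<Longrightarrow> \<exists>l. A *v x = l *\<^sub>R x"
    using orthonormal_eigenbasis[OF sym, of UNIV] by (metis UNIV_I subspace_UNIV)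
  have "0 \<notin> B" using B(3) by force
  then have "independent B"
    by (simp add: B(1) pairwise_orthogonal_independent)
  then have "card B = CARD('n)"
    using B(2) by (metis DIM_cart DIM_real dim_UNIV dim_eq_card_independent dim_span mult.right_neutral)
  then obtain f where f: "bij_betw f (UNIV::'n set) B"
    by (metis \<open>independent B\<close> finite_class.finite_UNIV finite_same_card_bij finiteI_independent)
  have fB: "f i \<in> B" for i using f bij_betwE by blast
  have "\<exists>d. \<forall>i. A *v f i = d i *\<^sub>R f i"
    using B(4)[OF fB] by (intro choice allI)
  then obtain d where d: "\<And>i. A *v f i = d i *\<^sub>R f i" by blast
  have orth: "f i \<bullet> f j = (if i = j then 1 else 0)" for i j
  proof (cases "i = j")
    case True
    then show ?thesis using B(3)[OF fB] by (simp add: power2_norm_eq_inner[symmetric])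
  next
    case False
    then have "f i \<noteq> f j" using f by (auto simp: bij_betw_def inj_on_def)
    then show ?thesis using B(1) fB False by (auto simp: pairwise_def orthogonal_def)
  qed
  \<comment> \<open>The eigenvectors are the rows of \<open>V\<close>, hence
    \<open>V ** A = diag_matrix d ** V\<close>.\<close>
  define V where "V = (\<chi> i j. f i $ j)"
  have VVt: "V ** transpose V = mat 1"
    using orth by (simp add: V_def matrix_matrix_mult_def transpose_def vec_eq_iff mat_def inner_vec_def)
  then have V: "orthogonal_matrix V"
    by (metis orthogonal_matrix orthogonal_matrix_transpose transpose_transpose)
  have "V ** A = diag_matrix d ** V"
  proof -
    have "(V ** A) $ i $ j = (A *v f i) $ j" for i j
    proof -
      have "A $ k $ j = A $ j $ k" for k
        using sym by (metis transpose_def vec_lambda_beta)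
      then show ?thesis
        by (simp add: V_def matrix_matrix_mult_def matrix_vector_mult_def mult.commute)
    qed
    then have "(V ** A) $ i $ j = d i * f i $ j" for i j by (simp add: d)
    then show ?thesis
      by (simp add: vec_eq_iff)
        (simp add: V_def diag_matrix_def matrix_matrix_mult_def if_distrib if_distribR cong: if_cong)
  qed
  then have "A = transpose V ** diag_matrix d ** V"
    using V by (metis matrix_mul_assoc matrix_mul_lid orthogonal_matrix)
  with V that show ?thesis by blast
qed

text \<open>The square roots of the eigenvalues of \<open>P\<close> give
  \<open>P = transpose S ** S\<close>. In the coordinates \<open>S *v x\<close> the form of
  \<open>P\<close> is the Euclidean one, so an orthogonal \<open>W\<close> can diagonalize
  \<open>Q\<close> without disturbing it. The \<open>\<mu> i\<close> are the eigenvalues of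
  inverse(P) Q.\<close>

lemma simultaneous_diagonalization:
  fixes P Q :: "real^'n^'n"
  assumes P: "transpose P = P" "\<And>x. x \<noteq> 0 \<Longrightarrow> x \<bullet> (P *v x) > 0"
    and Q: "transpose Q = Q"
  obtains T :: "real^'n^'n" and \<mu> where "invertible T" "P = transpose T ** T" "Q = transpose T ** diag_matrix \<mu> ** T"
proof -
  obtain V d where V: "orthogonal_matrix V" "P = transpose V ** diag_matrix d ** V"
    using symmetric_matrix_diagonalization[OF P(1)] .
  have VV: "V ** transpose V = mat 1" "transpose V ** V = mat 1"
    using V(1) by (auto simp: orthogonal_matrix_def)
  have d: "d i > 0" for i
  proof -
    define x where "x = transpose V *v axis i 1"
    have Vx: "V *v x = axis i 1"
      by (simp add: x_def matrix_vector_mul_assoc VV del: transpose_matrix_vector)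
    then have "x \<noteq> 0"
      by (metis axis_eq_0_iff matrix_vector_mult_0_right zero_neq_one)
    from P(2)[OF this] show ?thesis
      unfolding V(2) inner_congruence_matrix Vx by (simp add: axis_def if_distrib if_distribR cong: if_cong)
  qed
  define S where "S = diag_matrix (\<lambda>i. sqrt (d i)) ** V"
  have PS: "P = transpose S ** S"
  proof -
    have "transpose S ** S = transpose V ** (diag_matrix (\<lambda>i. sqrt (d i)) ** diag_matrix (\<lambda>i. sqrt (d i))) ** V"
      by (simp add: S_def matrix_transpose_mul matrix_mul_assoc)
    then show ?thesis
      using d V(2) by (simp add: diag_matrix_mult less_imp_le)
  qed
  have "det S \<noteq> 0"
  proof -
    have "(\<Prod>i\<in>UNIV. sqrt (d i)) > 0"
      using d by (intro prod_pos) auto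
    moreover have "det V \<noteq> 0"
      using VV(1) by (metis det_I det_mul mult_zero_left zero_neq_one)
    moreover have "det S = (\<Prod>i\<in>UNIV. sqrt (d i)) * det V"
      by (simp add: S_def det_mul det_diag_matrix)
    ultimately show "det S \<noteq> 0" by (metis less_irrefl mult_eq_0_iff)
  qed
  then have S: "invertible S" by (simp add: invertible_det_nz)
  then obtain R where R: "S ** R = mat 1" "R ** S = mat 1"
    by (auto simp: invertible_def)
  have tR: "transpose S ** transpose R = mat 1"
    by (metis R(2) matrix_transpose_mul transpose_mat)
  have "transpose (transpose R ** Q ** R) = transpose R ** Q ** R"
    by (simp add: matrix_transpose_mul Q matrix_mul_assoc)
  then obtain W \<mu> where W: "orthogonal_matrix W" "transpose R ** Q ** R = transpose W ** diag_matrix \<mu> ** W"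
    using symmetric_matrix_diagonalization by metis
  have WW: "W ** transpose W = mat 1" "transpose W ** W = mat 1"
    using W(1) by (auto simp: orthogonal_matrix_def)
  define T where "T = W ** S"
  have "invertible W" using WW by (auto simp: invertible_def)
  then have T: "invertible T" using S by (simp add: T_def invertible_mult)
  show thesis
  proof (rule that[OF T])
    show "P = transpose T ** T"
      by (metis PS T_def WW(2) matrix_mul_assoc matrix_mul_rid matrix_transpose_mul)
    have "transpose T ** diag_matrix \<mu> ** T = transpose S ** (transpose R ** Q ** R) ** S"
      by (simp add: T_def W(2) matrix_transpose_mul matrix_mul_assoc)
    also have "\<dots> = (transpose S ** transpose R) ** Q ** (R ** S)"
      by (simp add: matrix_mul_assoc)
    finally show "Q = transpose T ** diag_matrix \<mu> ** T"
      by (simp add: tR R)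
  qed
qed

subsection \<open>Positive definite matrices\<close>

text \<open>The constant depends only on \<open>I\<close> and \<open>A\<close>. This uniformity
  later lets one constant serve for all iterates and all points.\<close>

lemma prod_one_plus_expansion:
  fixes A :: real
  assumes "finite I" "A \<ge> 0"
  shows "\<exists>C\<ge>0. \<forall>a t. (\<forall>i\<in>I. \<bar>a i\<bar> \<le> A) \<longrightarrow> 0 \<le> t \<longrightarrow> t \<le> 1 \<longrightarrow>
    \<bar>(\<Prod>i\<in>I. 1 + t * a i) - 1 - t * (\<Sum>i\<in>I. a i)\<bar> \<le> C * t\<^sup>2"
  using assms(1)
proof (induction I rule: finite_induct)
  case empty
  show ?case by (intro exI[of _ 0]) auto
next
  case (insert j I)
  then obtain C where C: "C \<ge> 0" and bound: "\<And>a t. (\<forall>i\<in>I. \<bar>a i\<bar> \<le> A) \<Longrightarrow> 0 \<le> t \<Longrightarrow> t \<le> 1 \<Longrightarrow>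
    \<bar>(\<Prod>i\<in>I. 1 + t * a i) - 1 - t * (\<Sum>i\<in>I. a i)\<bar> \<le> C * t\<^sup>2"
    by blast
  show ?case
  \<comment> \<open>Multiplying the expansion 1 + t S + r of the old product by 1 + t a_j leaves the
    error r (1 + t a_j) + S a_j t^2, and |S| is at most \<open>card I * A\<close>.\<close>
  proof (intro exI[of _ "C * (1 + A) + card I * A * A"] conjI allI impI)
    show "0 \<le> C * (1 + A) + card I * A * A"
      using C \<open>A \<ge> 0\<close> by simp
    fix a and t :: real
    assume a: "\<forall>i\<in>insert j I. \<bar>a i\<bar> \<le> A" and t: "0 \<le> t" "t \<le> 1"
    define S where "S = (\<Sum>i\<in>I. a i)"
    define r where "r = (\<Prod>i\<in>I. 1 + t * a i) - 1 - t * S"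
    have r: "\<bar>r\<bar> \<le> C * t\<^sup>2"
      using bound[of a t] a t by (simp add: r_def S_def)
    have S: "\<bar>S\<bar> \<le> card I * A"
      unfolding S_def using a by (intro order_trans[OF sum_abs] sum_bounded_above) auto
    have aj: "\<bar>a j\<bar> \<le> A" using a by simp
    have "(\<Prod>i\<in>insert j I. 1 + t * a i) = (1 + t * a j) * (1 + t * S + r)"
      using insert.hyps by (simp add: r_def)
    moreover have "(\<Sum>i\<in>insert j I. a i) = a j + S"
      using insert.hyps by (simp add: S_def)
    ultimately have "(\<Prod>i\<in>insert j I. 1 + t * a i) - 1 - t * (\<Sum>i\<in>insert j I. a i) = r * (1 + t * a j) + S * a j * t\<^sup>2"
      by (simp add: algebra_simps power2_eq_square)
    moreover have "\<bar>r * (1 + t * a j)\<bar> \<le> (C * t\<^sup>2) * (1 + A)"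
      unfolding abs_mult
    proof (rule mult_mono)
      have "t * \<bar>a j\<bar> \<le> 1 * A" using t aj by (intro mult_mono) auto
      then show "\<bar>1 + t * a j\<bar> \<le> 1 + A" using t \<open>A \<ge> 0\<close> abs_triangle_ineq[of 1 "t * a j"] by (simp add: abs_mult)
    qed (use r C in auto)
    moreover have "\<bar>S * a j * t\<^sup>2\<bar> \<le> (card I * A * A) * t\<^sup>2"
      unfolding abs_mult using S aj \<open>A \<ge> 0\<close> by (intro mult_mono) auto
    ultimately show "\<bar>(\<Prod>i\<in>insert j I. 1 + t * a i) - 1 - t * (\<Sum>i\<in>insert j I. a i)\<bar>
        \<le> (C * (1 + A) + card I * A * A) * t\<^sup>2"
      by (simp add: algebra_simps)
  qed
qed

lemma matrix_inv_eqI: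
  fixes A :: "real^'n^'n"
  assumes "A ** B = mat 1" "B ** A = mat 1"
  shows "matrix_inv A = B"
proof -
  have "A ** matrix_inv A = mat 1"
    unfolding matrix_inv_def using someI[of "\<lambda>A'. A ** A' = mat 1 \<and> A' ** A = mat 1", OF conjI, OF assms] by simp
  then show ?thesis
    by (metis assms(2) matrix_mul_assoc matrix_mul_lid matrix_mul_rid)
qed

lemma matrix_add_rdistrib: "(A + B) ** C = A ** C + B ** C" for A B :: "real^'n^'m"
  by (vector matrix_matrix_mult_def sum.distrib[symmetric] field_simps)

definition spd :: "real^'n^'n \<Rightarrow> bool" where
  "spd A \<longleftrightarrow> transpose A = A \<and> (\<forall>x. x \<noteq> 0 \<longrightarrow> x \<bullet> (A *v x) > 0)"

text \<open>The \<open>\<mu> i\<close> are the eigenvalues of \<open>Q\<close> relative to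
  \<open>P\<close>. All matrix quantities of the proof become symmetric functions of them, and the
  last clause, which supplies a vector of \<open>P\<close>-length 1, turns bounds on quadratic forms
  into bounds on each \<open>\<mu> i\<close>.\<close>

lemma spd_pair_invariants:
  fixes P Q :: "real^'n^'n"
  assumes "spd P" "transpose Q = Q"
  obtains \<mu> :: "'n \<Rightarrow> real" where "det P > 0" "det Q = det P * (\<Prod>i\<in>UNIV. \<mu> i)"
    "trace (matrix_inv P ** Q) = (\<Sum>i\<in>UNIV. \<mu> i)"
    "\<And>t. det ((1 - t) *\<^sub>R P + t *\<^sub>R Q) = det P * (\<Prod>i\<in>UNIV. 1 + t * (\<mu> i - 1))"
    "\<And>i. \<exists>x. x \<noteq> 0 \<and> x \<bullet> (P *v x) = 1 \<and> x \<bullet> (Q *v x) = \<mu> i"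
proof -
  obtain T :: "real^'n^'n" and \<mu> where T: "invertible T" and P: "P = transpose T ** T" and Q: "Q = transpose T ** diag_matrix \<mu> ** T"
    using simultaneous_diagonalization[of P Q] assms unfolding spd_def by blast
  obtain R where R: "T ** R = mat 1" "R ** T = mat 1"
    using T by (auto simp: invertible_def)
  have tR: "transpose R ** transpose T = mat 1" "transpose T ** transpose R = mat 1"
    by (metis R matrix_transpose_mul transpose_mat)+
  have P1: "P = transpose T ** diag_matrix (\<lambda>i. 1) ** T"
  proof -
    have "diag_matrix (\<lambda>i. 1) = (mat 1 :: real^'n^'n)"
      by (simp add: diag_matrix_def mat_def)
    then show ?thesis using P by simp
  qed
  have "det T \<noteq> 0" using T by (simp add: invertible_det_nz)
  then have detP: "det P = det T * det T" "det P > 0"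
    by (auto simp: P det_mul zero_less_mult_iff)
  have inv: "matrix_inv P = R ** transpose R"
  proof (rule matrix_inv_eqI)
    have "P ** (R ** transpose R) = transpose T ** (T ** R) ** transpose R"
      by (simp add: P matrix_mul_assoc)
    then show "P ** (R ** transpose R) = mat 1" by (simp add: R tR)
    have "(R ** transpose R) ** P = R ** (transpose R ** transpose T) ** T"
      by (simp add: P matrix_mul_assoc)
    then show "(R ** transpose R) ** P = mat 1" by (simp add: R tR)
  qed
  show thesis
  proof (rule that[of \<mu>])
    show "det P > 0" by fact
    show "det Q = det P * (\<Prod>i\<in>UNIV. \<mu> i)"
      by (simp add: Q detP det_mul det_diag_matrix)
    have "trace (matrix_inv P ** Q) = trace (R ** (transpose R ** transpose T) ** (diag_matrix \<mu> ** T))"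
      by (simp add: inv Q matrix_mul_assoc)
    also have "\<dots> = trace (R ** (diag_matrix \<mu> ** T))"
      by (simp add: tR)
    also have "\<dots> = trace ((diag_matrix \<mu> ** T) ** R)"
      by (rule trace_mul_sym)
    also have "\<dots> = trace (diag_matrix \<mu> ** (T ** R))"
      by (simp add: matrix_mul_assoc)
    finally show "trace (matrix_inv P ** Q) = (\<Sum>i\<in>UNIV. \<mu> i)"
      by (simp add: R trace_diag_matrix)
    show "det ((1 - t) *\<^sub>R P + t *\<^sub>R Q) = det P * (\<Prod>i\<in>UNIV. 1 + t * (\<mu> i - 1))" for t
    proof -
      have "(1 - t) *\<^sub>R P + t *\<^sub>R Q = transpose T ** ((1 - t) *\<^sub>R diag_matrix (\<lambda>i. 1) + t *\<^sub>R diag_matrix \<mu>) ** T"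
        unfolding Q by (subst P1)
          (simp only: matrix_add_ldistrib matrix_add_rdistrib scalar_matrix_assoc matrix_scalar_ac)
      also have "(1 - t) *\<^sub>R diag_matrix (\<lambda>i. 1) + t *\<^sub>R diag_matrix \<mu> = diag_matrix (\<lambda>i. 1 + t * (\<mu> i - 1))"
        by (auto simp: diag_matrix_def vec_eq_iff algebra_simps)
      finally show ?thesis
        by (simp add: detP det_mul det_diag_matrix)
    qed
    show "\<exists>x. x \<noteq> 0 \<and> x \<bullet> (P *v x) = 1 \<and> x \<bullet> (Q *v x) = \<mu> i" for i
    proof -
      define x where "x = R *v axis i 1"
      have Tx: "T *v x = axis i 1"
        by (simp add: x_def matrix_vector_mul_assoc R)
      then have "x \<noteq> 0"
        by (metis axis_eq_0_iff matrix_vector_mult_0_right zero_neq_one)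
      moreover have "x \<bullet> (P *v x) = 1"
        by (subst P1, unfold inner_congruence_matrix Tx)
          (simp add: axis_def if_distrib if_distribR cong: if_cong)
      moreover have "x \<bullet> (Q *v x) = \<mu> i"
        unfolding Q inner_congruence_matrix Tx
        by (simp add: axis_def if_distrib if_distribR cong: if_cong)
      ultimately show ?thesis by blast
    qed
  qed
qed

text \<open>\<open>Min\<close> is informative only for finite sets. Eigenvectors for distinct
  eigenvalues are orthogonal, and a pairwise orthogonal family is finite.\<close>

lemma eigenvals_finite:
  fixes A :: "real^'n^'n"
  assumes sym: "transpose A = A"
  shows "finite (eigenvals A)"
proof -
  have "\<forall>l\<in>eigenvals A. \<exists>v. v \<noteq> 0 \<and> A *v v = l *\<^sub>R v"
    by (auto simp: eigenvals_def)
  from bchoice[OF this] obtain v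
    where v: "\<And>l. l \<in> eigenvals A \<Longrightarrow> v l \<noteq> 0 \<and> A *v v l = l *\<^sub>R v l"
    by blast
  have orth: "v l \<bullet> v m = 0" if "l \<in> eigenvals A" "m \<in> eigenvals A" "l \<noteq> m" for l m
  proof -
    have "l * (v l \<bullet> v m) = (A *v v l) \<bullet> v m" using v that by simp
    also have "\<dots> = v l \<bullet> (A *v v m)" by (simp add: inner_matrix_left sym del: transpose_matrix_vector)
    also have "\<dots> = m * (v l \<bullet> v m)" using v that by simp
    finally show ?thesis using that by simp
  qed
  then have "pairwise orthogonal (v ` eigenvals A)"
    by (auto simp: pairwise_def orthogonal_def)
  then have "finite (v ` eigenvals A)" by (rule pairwise_orthogonal_imp_finite)
  moreover have "inj_on v (eigenvals A)"
    using orth v by (intro inj_onI) (metis inner_eq_zero_iff)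
  ultimately show ?thesis by (rule finite_imageD)
qed

text \<open>The minimum \<open>l\<close> of the Rayleigh quotient over the whole space is itself an
  eigenvalue, hence at least \<open>Min (eigenvals A)\<close>.\<close>

lemma Min_eigenvals_le_quadratic_form:
  fixes A :: "real^'n^'n"
  assumes sym: "transpose A = A" and "\<epsilon> \<le> Min (eigenvals A)"
  shows "\<epsilon> * (x \<bullet> x) \<le> x \<bullet> (A *v x)"
proof -
  obtain i :: 'n where True by blast
  obtain z l where z: "norm z = 1" "A *v z = l *\<^sub>R z"
    "\<And>y. y \<in> UNIV \<Longrightarrow> l * (y \<bullet> y) \<le> y \<bullet> (A *v y)"
    using min_eigenvector_on_subspace[OF sym subspace_UNIV, of "axis i 1"]
    by (metis UNIV_I axis_eq_0_iff zero_neq_one)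
  then have "l \<in> eigenvals A"
    by (auto simp: eigenvals_def intro!: exI[of _ z])
  then have "\<epsilon> \<le> l" using assms eigenvals_finite[OF sym] by (meson Min_le order_trans)
  then show ?thesis using z(3)[of x] by (smt (verit) UNIV_I inner_ge_zero mult_right_mono)
qed

lemma quadratic_form_bound_imp_spd:
  assumes "transpose A = A" "\<epsilon> > 0" "\<And>x. \<epsilon> * (x \<bullet> x) \<le> x \<bullet> (A *v x)"
  shows "spd A"
  unfolding spd_def using assms
  by (metis inner_gt_zero_iff less_le_trans mult_pos_pos)

text \<open>This is AM--GM for the relative eigenvalues, whose product is det Q / det P and whose
  sum is tr(inverse(P) Q). For consecutive Hessians the trace on the right is the one prescribed by
  the linear equation.\<close>

lemma det_le_trace_powr:
  fixes P Q :: "real^'n^'n"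
  assumes "spd P" "spd Q"
  shows "real CARD('n) * det Q powr (1 / CARD('n)) \<le> trace (det P powr (1 / CARD('n)) *\<^sub>R matrix_inv P ** Q)"
proof -
  obtain \<mu> :: "'n \<Rightarrow> real" where \<mu>: "det P > 0" "det Q = det P * (\<Prod>i\<in>UNIV. \<mu> i)"
    "trace (matrix_inv P ** Q) = (\<Sum>i\<in>UNIV. \<mu> i)"
    "\<And>i. \<exists>x. x \<noteq> 0 \<and> x \<bullet> (P *v x) = 1 \<and> x \<bullet> (Q *v x) = \<mu> i"
    using spd_pair_invariants[of P Q] assms unfolding spd_def by metis
  have pos: "\<mu> i > 0" for i
    using \<mu>(4)[of i] assms(2) by (auto simp: spd_def)
  let ?n = "real CARD('n)"
  have "(\<Prod>i\<in>UNIV. \<mu> i) powr (1 / ?n) \<le> (\<Sum>i\<in>UNIV. \<mu> i / ?n)"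
    using arith_geom_mean[of "UNIV :: 'n set" \<mu>] pos by (simp add: less_imp_le)
  then have "?n * (\<Prod>i\<in>UNIV. \<mu> i) powr (1 / ?n) \<le> trace (matrix_inv P ** Q)"
    by (simp add: \<mu>(3) flip: sum_divide_distrib) (simp add: field_simps)
  then have "det P powr (1 / ?n) * (?n * (\<Prod>i\<in>UNIV. \<mu> i) powr (1 / ?n)) \<le> det P powr (1 / ?n) * trace (matrix_inv P ** Q)"
    by (rule mult_left_mono) simp
  moreover have "det Q powr (1 / ?n) = det P powr (1 / ?n) * (\<Prod>i\<in>UNIV. \<mu> i) powr (1 / ?n)"
    using \<mu>(1) pos by (simp add: \<mu>(2) powr_mult prod_nonneg less_imp_le)
  ultimately show ?thesis
    by (simp add: trace_def sum_distrib_left mult_ac flip: scalar_matrix_assoc)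
qed

text \<open>The relative eigenvalues of a negative definite form are negative. This yields the
  contradiction at an interior maximum in the maximum principle.\<close>

lemma trace_matrix_inv_mult_nonpos:
  fixes P N :: "real^'n^'n"
  assumes "spd P" "transpose N = N" "\<And>x. x \<noteq> 0 \<Longrightarrow> x \<bullet> (N *v x) < 0"
  shows "trace (matrix_inv P ** N) < 0"
proof -
  obtain \<mu> :: "'n \<Rightarrow> real" where \<mu>: "trace (matrix_inv P ** N) = (\<Sum>i\<in>UNIV. \<mu> i)"
    "\<And>i. \<exists>x. x \<noteq> 0 \<and> x \<bullet> (P *v x) = 1 \<and> x \<bullet> (N *v x) = \<mu> i"
    using spd_pair_invariants[of P N] assms by metis
  have "\<mu> i < 0" for i using \<mu>(2)[of i] assms(3) by metis
  then show ?thesis unfolding \<mu>(1) using sum_strict_mono[of UNIV \<mu> "\<lambda>_. 0"] by simp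
qed

text \<open>All eigenvalues are at least \<epsilon>, so any one of them times \<epsilon>^(n-1) is at
  most their product det Q, hence at most F. The bound on the form will pinch the iterates, the
  bound on the norm will make their gradients Lipschitz.\<close>

lemma spd_det_bound_imp_upper_bound:
  fixes Q :: "real^'n^'n"
  assumes sym: "transpose Q = Q" and \<epsilon>: "\<epsilon> > 0" "\<And>x. \<epsilon> * (x \<bullet> x) \<le> x \<bullet> (Q *v x)" and det: "det Q \<le> F"
  shows "x \<bullet> (Q *v x) \<le> F / \<epsilon> ^ (CARD('n) - 1) * (x \<bullet> x)"
    and "norm (Q *v x) \<le> F / \<epsilon> ^ (CARD('n) - 1) * norm x"
    and "\<epsilon> ^ CARD('n) \<le> det Q"
proof -
  obtain V d where V: "orthogonal_matrix V" "Q = transpose V ** diag_matrix d ** V"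
    using symmetric_matrix_diagonalization[OF sym] .
  have VV: "V ** transpose V = mat 1" "transpose V ** V = mat 1"
    using V(1) by (auto simp: orthogonal_matrix_def)
  have isom: "(V *v x) \<bullet> (V *v y) = x \<bullet> y" for x y
    by (simp add: inner_matrix_left matrix_vector_mul_assoc VV del: transpose_matrix_vector)
  have d: "d i \<ge> \<epsilon>" for i
  proof -
    define x where "x = transpose V *v axis i 1"
    have Vx: "V *v x = axis i 1"
      by (simp add: x_def matrix_vector_mul_assoc VV del: transpose_matrix_vector)
    have "x \<bullet> x = 1" using isom[of x x] Vx by (simp add: inner_axis_axis)
    moreover have "x \<bullet> (Q *v x) = d i"
      unfolding V(2) inner_congruence_matrix Vx by (simp add: axis_def if_distrib if_distribR cong: if_cong)
    ultimately show ?thesis using \<epsilon>(2)[of x] by simp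
  qed
  have "det V * det V = 1"
    using VV(2) by (metis det_I det_mul det_transpose)
  then have detQ: "det Q = (\<Prod>i\<in>UNIV. d i)"
    by (simp add: V(2) det_mul det_diag_matrix mult_ac)
  show "\<epsilon> ^ CARD('n) \<le> det Q"
    unfolding detQ using d \<epsilon>(1) prod_mono[of UNIV "\<lambda>_. \<epsilon>" d] by (simp add: less_imp_le)
  let ?M = "F / \<epsilon> ^ (CARD('n) - 1)"
  have dM: "d i \<le> ?M" for i
  proof -
    have "\<epsilon> ^ (CARD('n) - 1) \<le> (\<Prod>j\<in>UNIV-{i}. d j)"
      using d \<epsilon>(1) prod_mono[of "UNIV-{i}" "\<lambda>_. \<epsilon>" d] by (simp add: less_imp_le card_Diff_singleton)
    then have "d i * \<epsilon> ^ (CARD('n) - 1) \<le> d i * (\<Prod>j\<in>UNIV-{i}. d j)"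
      using d[of i] \<epsilon>(1) by (intro mult_left_mono) auto
    also have "\<dots> = det Q" unfolding detQ by (rule prod.remove[symmetric]) auto
    finally show ?thesis using det \<epsilon>(1) by (simp add: field_simps)
  qed
  have dpos: "0 \<le> d i" for i using d[of i] \<epsilon>(1) by simp
  \<comment> \<open>The index type is nonempty, and \<open>undefined\<close> serves as an arbitrary
    index.\<close>
  have M0: "0 \<le> ?M" using dM[of undefined] dpos[of undefined] by linarith
  have "x \<bullet> (Q *v x) = (\<Sum>i\<in>UNIV. d i * ((V *v x) $ i)\<^sup>2)"
    unfolding V(2) inner_congruence_matrix by (simp add: power2_eq_square mult_ac)
  also have "\<dots> \<le> (\<Sum>i\<in>UNIV. ?M * ((V *v x) $ i)\<^sup>2)"
    using dM by (intro sum_mono mult_right_mono) auto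
  also have "\<dots> = ?M * ((V *v x) \<bullet> (V *v x))"
    by (simp add: inner_vec_def power2_eq_square sum_distrib_left)
  finally show "x \<bullet> (Q *v x) \<le> ?M * (x \<bullet> x)" by (simp add: isom)
  have "V *v (Q *v x) = diag_matrix d *v (V *v x)"
    by (simp add: V(2) matrix_vector_mul_assoc matrix_mul_assoc VV del: transpose_matrix_vector)
  then have "(Q *v x) \<bullet> (Q *v x) = (diag_matrix d *v (V *v x)) \<bullet> (diag_matrix d *v (V *v x))"
    using isom[of "Q *v x" "Q *v x"] by simp
  also have "\<dots> = (\<Sum>i\<in>UNIV. (d i)\<^sup>2 * ((V *v x) $ i)\<^sup>2)"
    by (simp add: diag_matrix_mult_vec inner_vec_def power2_eq_square mult_ac)
  also have "\<dots> \<le> (\<Sum>i\<in>UNIV. ?M\<^sup>2 * ((V *v x) $ i)\<^sup>2)"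
    using dM dpos by (intro sum_mono mult_right_mono power_mono) auto
  also have "\<dots> = ?M\<^sup>2 * ((V *v x) \<bullet> (V *v x))"
    by (simp add: inner_vec_def power2_eq_square sum_distrib_left)
  finally have "(Q *v x) \<bullet> (Q *v x) \<le> ?M\<^sup>2 * (x \<bullet> x)"
    unfolding isom .
  then have "(norm (Q *v x))\<^sup>2 \<le> (?M * norm x)\<^sup>2"
    unfolding power_mult_distrib power2_norm_eq_inner .
  then show "norm (Q *v x) \<le> ?M * norm x"
    using M0 by (meson mult_nonneg_nonneg norm_ge_zero power2_le_imp_le)
qed

text \<open>Division by det P leaves the product of 1 + t (\<mu>_i - 1) over the relative
  eigenvalues, whose first-order coefficient is tr(inverse(P) Q) - n. The remainder constant depends
  only on \<epsilon>, M and the dimension.\<close>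

lemma det_segment_expansion:
  fixes \<epsilon> M :: real
  assumes "\<epsilon> > 0" "M \<ge> 0"
  shows "\<exists>C\<ge>0. \<forall>(P :: real^'n^'n) Q t. transpose P = P \<longrightarrow> transpose Q = Q \<longrightarrow>
    (\<forall>x. \<epsilon> * (x \<bullet> x) \<le> x \<bullet> (P *v x)) \<longrightarrow> (\<forall>x. 0 \<le> x \<bullet> (Q *v x)) \<longrightarrow>
    (\<forall>x. x \<bullet> (Q *v x) \<le> M * (x \<bullet> x)) \<longrightarrow> 0 \<le> t \<longrightarrow> t \<le> 1 \<longrightarrow>
    \<bar>det ((1 - t) *\<^sub>R P + t *\<^sub>R Q) - det P - t * (det P * (trace (matrix_inv P ** Q) - CARD('n)))\<bar>
      \<le> C * det P * t\<^sup>2"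
proof -
  \<comment> \<open>A vector with \<open>x \<bullet> (P *v x) = 1\<close> satisfies
    \<open>x \<bullet> x \<le> 1 / \<epsilon>\<close>, so every \<open>\<mu> i\<close> lies between
    0 and \<open>M / \<epsilon>\<close>.\<close>
  define A where "A = M / \<epsilon> + 1"
  have "A \<ge> 0" using assms by (simp add: A_def)
  then obtain C where C: "C \<ge> 0" and bound: "\<And>a t. (\<forall>i\<in>UNIV :: 'n set. \<bar>a i\<bar> \<le> A) \<Longrightarrow> 0 \<le> t \<Longrightarrow> t \<le> 1 \<Longrightarrow>
    \<bar>(\<Prod>i\<in>UNIV. 1 + t * a i) - 1 - t * (\<Sum>i\<in>UNIV. a i)\<bar> \<le> C * t\<^sup>2"
    using prod_one_plus_expansion[of "UNIV :: 'n set" A] by auto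
  show ?thesis
  proof (intro exI[of _ C] conjI allI impI)
    show "0 \<le> C" by fact
    fix P Q :: "real^'n^'n" and t :: real
    assume sym: "transpose P = P" "transpose Q = Q" and P: "\<forall>x. \<epsilon> * (x \<bullet> x) \<le> x \<bullet> (P *v x)"
      and Q0: "\<forall>x. 0 \<le> x \<bullet> (Q *v x)" and QM: "\<forall>x. x \<bullet> (Q *v x) \<le> M * (x \<bullet> x)" and t: "0 \<le> t" "t \<le> 1"
    have "spd P" using quadratic_form_bound_imp_spd sym assms P by blast
    then obtain \<mu> :: "'n \<Rightarrow> real" where \<mu>: "det P > 0" "trace (matrix_inv P ** Q) = (\<Sum>i\<in>UNIV. \<mu> i)"
      "\<And>t. det ((1 - t) *\<^sub>R P + t *\<^sub>R Q) = det P * (\<Prod>i\<in>UNIV. 1 + t * (\<mu> i - 1))"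
      "\<And>i. \<exists>x. x \<noteq> 0 \<and> x \<bullet> (P *v x) = 1 \<and> x \<bullet> (Q *v x) = \<mu> i"
      using spd_pair_invariants[of P Q] sym by metis
    have "\<bar>\<mu> i - 1\<bar> \<le> A" for i
    proof -
      obtain x where x: "x \<bullet> (P *v x) = 1" "x \<bullet> (Q *v x) = \<mu> i" using \<mu>(4) by blast
      then have "x \<bullet> x \<le> 1 / \<epsilon>"
        using P assms(1) by (metis mult.commute pos_le_divide_eq)
      then have "M * (x \<bullet> x) \<le> M / \<epsilon>"
        using assms(2) mult_left_mono by fastforce
      then show ?thesis using x Q0 QM by (smt (verit) A_def)
    qed
    then have "\<bar>(\<Prod>i\<in>UNIV. 1 + t * (\<mu> i - 1)) - 1 - t * (\<Sum>i\<in>UNIV. \<mu> i - 1)\<bar> \<le> C * t\<^sup>2"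
      using bound[of "\<lambda>i. \<mu> i - 1" t] t by blast
    then have "det P * \<bar>(\<Prod>i\<in>UNIV. 1 + t * (\<mu> i - 1)) - 1 - t * (\<Sum>i\<in>UNIV. \<mu> i - 1)\<bar> \<le> det P * (C * t\<^sup>2)"
      using \<mu>(1) by (intro mult_left_mono) auto
    moreover have "det P * \<bar>(\<Prod>i\<in>UNIV. 1 + t * (\<mu> i - 1)) - 1 - t * (\<Sum>i\<in>UNIV. \<mu> i - 1)\<bar>
       = \<bar>det P * ((\<Prod>i\<in>UNIV. 1 + t * (\<mu> i - 1)) - 1 - t * (\<Sum>i\<in>UNIV. \<mu> i - 1))\<bar>"
      using \<mu>(1) by (simp add: abs_mult)
    moreover have "(\<Sum>i\<in>UNIV. \<mu> i - 1) = trace (matrix_inv P ** Q) - CARD('n)"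
      by (simp add: \<mu>(2) sum_subtractf)
    ultimately show "\<bar>det ((1 - t) *\<^sub>R P + t *\<^sub>R Q) - det P - t * (det P * (trace (matrix_inv P ** Q) - CARD('n)))\<bar>
      \<le> C * det P * t\<^sup>2"
      unfolding \<mu>(3) by (simp add: right_diff_distrib mult_ac)
  qed
qed

subsection \<open>Change of variables over an arbitrary finite index type\<close>

text \<open>The change of variables theorem of the library needs a wellordered index type. \<open>'n wo\<close> is a copy of
  the finite type \<open>'n\<close> carrying an arbitrary wellorder, to which the theorem is transferred.\<close>

datatype 'a wo = Wo (unWo: 'a)

lemma bij_Wo: "bij Wo"
  by (metis bijI' wo.exhaust wo.inject)

instance wo :: (finite) finite
  by standard (metis bij_Wo bij_betw_finite finite)

instantiation wo :: (finite) wellorder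
begin

definition less_eq_wo :: "'a wo \<Rightarrow> 'a wo \<Rightarrow> bool" where
  "x \<le> y \<longleftrightarrow> to_nat (unWo x) \<le> to_nat (unWo y)"

definition less_wo :: "'a wo \<Rightarrow> 'a wo \<Rightarrow> bool" where
  "x < y \<longleftrightarrow> to_nat (unWo x) < to_nat (unWo y)"

instance
proof
  fix x y z :: "'a wo"
  show "x < y \<longleftrightarrow> x \<le> y \<and> \<not> y \<le> x" "x \<le> x" "x \<le> y \<or> y \<le> x"
    "x \<le> y \<Longrightarrow> y \<le> z \<Longrightarrow> x \<le> z"
    unfolding less_eq_wo_def less_wo_def by linarith+
  assume "x \<le> y" "y \<le> x"
  then have "to_nat (unWo x) = to_nat (unWo y)"
    unfolding less_eq_wo_def by linarith
  then have "unWo x = unWo y" by (rule injD[OF inj_to_nat])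
  then show "x = y" by (rule wo.expand)
next
  fix P :: "'a wo \<Rightarrow> bool" and a :: "'a wo"
  assume step: "\<And>x. (\<And>y. y < x \<Longrightarrow> P y) \<Longrightarrow> P x"
  show "P a"
  proof (induction a rule: measure_induct_rule[of "\<lambda>x. to_nat (unWo x)"])
    case (less x)
    show ?case by (rule step, rule less) (simp only: less_wo_def)
  qed
qed

end

section \<open>Lebesgue measure and determinants under relabelling of coordinates\<close>

definition to_wo :: "real^'n \<Rightarrow> real^'n wo" where
  "to_wo x = (\<chi> i. x $ unWo i)"

definition of_wo :: "real^'n wo \<Rightarrow> real^'n" where
  "of_wo y = (\<chi> i. y $ Wo i)"

lemma of_wo_to_wo [simp]: "of_wo (to_wo x) = x" and to_wo_of_wo [simp]: "to_wo (of_wo y) = y"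
  by (simp_all add: to_wo_def of_wo_def vec_eq_iff)

lemma bounded_linear_to_wo: "bounded_linear to_wo" and bounded_linear_of_wo: "bounded_linear of_wo"
  by (auto simp: linear_conv_bounded_linear[symmetric] linear_iff to_wo_def of_wo_def vec_eq_iff)

lemma all_wo: "(\<forall>i. P i) \<longleftrightarrow> (\<forall>i. P (Wo i))"
  by (metis wo.collapse)

lemma to_wo_image_cbox: "to_wo ` cbox a b = cbox (to_wo a) (to_wo b)"
proof -
  have "x \<in> cbox (to_wo a) (to_wo b) \<longleftrightarrow> of_wo x \<in> cbox a b" for x
    by (simp add: mem_box_cart to_wo_def of_wo_def all_wo)
  then show ?thesis
    by (smt (verit) Collect_cong image_def mem_Collect_eq of_wo_to_wo set_eqI to_wo_of_wo)
qed

lemma of_wo_image_cbox: "of_wo ` cbox a b = cbox (of_wo a) (of_wo b)"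
proof -
  have "cbox a b = to_wo ` cbox (of_wo a) (of_wo b)"
    by (simp add: to_wo_image_cbox)
  then show ?thesis by (simp add: image_image)
qed

lemma content_to_wo: "measure lborel (cbox (to_wo a) (to_wo b)) = measure lborel (cbox a b)"
proof -
  have "cbox (to_wo a) (to_wo b) = {} \<longleftrightarrow> cbox a b = {}"
    by (metis image_is_empty to_wo_image_cbox)
  moreover have "(\<Prod>i\<in>UNIV. to_wo b $ i - to_wo a $ i) = (\<Prod>i\<in>UNIV. b $ i - a $ i)"
    by (rule prod.reindex_bij_betw[OF bij_Wo, symmetric, THEN trans]) (simp add: to_wo_def)
  ultimately show ?thesis by (simp add: content_cbox_if_cart)
qed

text \<open>Lebesgue measure is determined by its values on boxes, and relabelling only permutes the
  side lengths.\<close>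

lemma lborel_to_wo: "lborel = distr lborel borel (to_wo :: real^'n::finite \<Rightarrow> real^'n wo)"
proof (rule lborel_eqI)
  fix l u :: "real^'n wo"
  assume le: "\<And>b. b \<in> Basis \<Longrightarrow> l \<bullet> b \<le> u \<bullet> b"
  have "to_wo -` box l u = box (of_wo l) (of_wo u)"
    by (simp add: set_eq_iff mem_box_cart to_wo_def of_wo_def all_wo)
  then have "emeasure (distr lborel borel to_wo) (box l u) = emeasure lborel (box (of_wo l) (of_wo u))"
    by (subst emeasure_distr)
      (auto intro!: borel_measurable_continuous_onI linear_continuous_on bounded_linear_to_wo)
  also have "\<dots> = emeasure lborel (cbox (of_wo l) (of_wo u))"
    by (simp add: emeasure_lborel_box_eq emeasure_lborel_cbox_eq)
  also have "\<dots> = ennreal (measure lborel (cbox (of_wo l) (of_wo u)))"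
    using emeasure_lborel_cbox_finite[of "of_wo l" "of_wo u"] by (intro emeasure_eq_ennreal_measure) auto
  also have "\<dots> = ennreal (measure lborel (cbox l u))"
    by (metis content_to_wo to_wo_of_wo)
  also have "\<dots> = ennreal (\<Prod>b\<in>Basis. (u - l) \<bullet> b)"
    using le by (simp add: content_cbox)
  finally show "emeasure (distr lborel borel to_wo) (box l u) = ennreal (\<Prod>b\<in>Basis. (u - l) \<bullet> b)" .
qed simp

lemma measure_to_wo_image:
  assumes "compact T"
  shows "measure lebesgue (to_wo ` T) = measure lebesgue T"
proof -
  have cont: "continuous_on S to_wo" for S :: "(real^'n) set"
    by (intro linear_continuous_on bounded_linear_to_wo)
  then have cT: "compact (to_wo ` T)" by (intro compact_continuous_image assms)
  have "inj to_wo" by (metis injI of_wo_to_wo)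
  then have "to_wo -` to_wo ` T = T" by (rule inj_vimage_image_eq)
  then have "measure (distr lborel borel to_wo) (to_wo ` T) = measure lborel T"
    using cT by (subst measure_distr) (auto intro!: borel_measurable_continuous_onI cont borel_compact)
  then have "measure lborel (to_wo ` T) = measure lborel T"
    by (simp add: lborel_to_wo[symmetric])
  then show ?thesis using cT assms by (simp add: borel_compact)
qed

text \<open>Conjugation with \<open>Wo\<close> maps the permutations of one index type bijectively
  onto those of the other and preserves signs, so the Leibniz sums agree term by term.\<close>

lemma det_relabel:
  fixes A :: "real^'n^'n"
  shows "det (\<chi> i j. A $ unWo i $ unWo j) = det A"
proof -
  let ?m = "map_permutation (UNIV :: 'n set) Wo"
  have inj: "inj (Wo :: 'n \<Rightarrow> 'n wo)" using bij_Wo by (rule bij_is_inj)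
  have bij': "bij (unWo :: 'n wo \<Rightarrow> 'n)" by (metis bijI' wo.expand wo.sel)
  have m_apply: "?m p (Wo i) = Wo (p i)" for p i
    by (rule map_permutation_apply[OF inj UNIV_I])
  have bij: "bij_betw ?m {p. p permutes UNIV} {p. p permutes UNIV}"
  proof (rule bij_betw_byWitness[where f' = "map_permutation UNIV unWo"])
    show "\<forall>p\<in>{p. p permutes UNIV}. map_permutation UNIV unWo (?m p) = p"
      by (auto intro: map_permutation_compose_inv[OF bij_Wo])
    show "\<forall>p\<in>{p. p permutes (UNIV :: 'n wo set)}. ?m (map_permutation UNIV unWo p) = p"
      by (auto intro: map_permutation_compose_inv[OF bij'])
    show "?m ` {p. p permutes UNIV} \<subseteq> {p. p permutes UNIV}"
      by (auto intro: map_permutation_permutes[OF bij_Wo])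
    show "map_permutation UNIV unWo ` {p. p permutes (UNIV :: 'n wo set)} \<subseteq> {p. p permutes UNIV}"
      by (auto intro: map_permutation_permutes[OF bij'])
  qed
  have "det (\<chi> i j. A $ unWo i $ unWo j)
      = (\<Sum>p | p permutes UNIV. of_int (sign (?m p)) * (\<Prod>i\<in>UNIV. A $ unWo i $ unWo (?m p i)))"
    unfolding det_def by (subst sum.reindex_bij_betw[OF bij, symmetric]) simp
  also have "\<dots> = (\<Sum>p | p permutes UNIV. of_int (sign p) * (\<Prod>i\<in>UNIV. A $ i $ p i))"
  proof (intro sum.cong refl arg_cong2[where f = "(*)"])
    fix p :: "'n \<Rightarrow> 'n" assume "p \<in> {p. p permutes UNIV}"
    then show "(of_int (sign (?m p)) :: real) = of_int (sign p)"
      using inj by (simp add: sign_map_permutation)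
    show "(\<Prod>i\<in>UNIV. A $ unWo i $ unWo (?m p i)) = (\<Prod>i\<in>UNIV. A $ i $ p i)"
      by (subst prod.reindex_bij_betw[OF bij_Wo, symmetric]) (simp add: m_apply)
  qed
  finally show ?thesis by (simp add: det_def)
qed

text \<open>Conjugating \<open>G\<close> with the relabelling preserves the measure of the image,
  the integral and, since rows and columns are relabelled alike, the Jacobian determinant.\<close>

lemma measure_image_eq_integral_det:
  fixes G :: "real^'n \<Rightarrow> real^'n" and A :: "real^'n \<Rightarrow> real^'n^'n"
  assumes der: "\<And>x. x \<in> cbox a b \<Longrightarrow> (G has_derivative (\<lambda>h. A x *v h)) (at x within cbox a b)"
    and inj: "inj_on G (cbox a b)"
    and int: "(\<lambda>x. \<bar>det (A x)\<bar>) integrable_on cbox a b"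
  shows "measure lebesgue (G ` cbox a b) = integral (cbox a b) (\<lambda>x. \<bar>det (A x)\<bar>)"
proof -
  define S where "S = cbox (to_wo a) (to_wo b)"
  have S: "S = to_wo ` cbox a b" "of_wo ` S = cbox a b"
    by (simp_all add: S_def to_wo_image_cbox of_wo_image_cbox)
  define F where "F = to_wo \<circ> G \<circ> of_wo"
  define F' where "F' y = to_wo \<circ> (\<lambda>h. A (of_wo y) *v h) \<circ> of_wo" for y
  have derF: "(F has_derivative F' y) (at y within S)" if "y \<in> S" for y
    unfolding F_def F'_def
  proof (intro diff_chain_within)
    show "(of_wo has_derivative of_wo) (at y within S)"
      by (intro bounded_linear_imp_has_derivative bounded_linear_of_wo)
    show "(G has_derivative (\<lambda>h. A (of_wo y) *v h)) (at (of_wo y) within of_wo ` S)"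
      unfolding S(2) using that S(2) by (intro der) auto
    show "(to_wo has_derivative to_wo) (at (G (of_wo y)) within G ` of_wo ` S)"
      by (intro bounded_linear_imp_has_derivative bounded_linear_to_wo)
  qed
  have det: "det (matrix (F' y)) = det (A (of_wo y))" for y
  proof -
    have "of_wo (axis j 1) = axis (unWo j) 1" for j :: "'n wo"
      by (auto simp: of_wo_def axis_def vec_eq_iff)
    then have "matrix (F' y) = (\<chi> i j. A (of_wo y) $ unWo i $ unWo j)"
      by (simp add: matrix_def F'_def to_wo_def matrix_vector_mult_basis column_def)
    then show ?thesis by (simp add: det_relabel)
  qed
  have "((\<lambda>x. \<bar>det (A x)\<bar>) has_integral integral (cbox a b) (\<lambda>x. \<bar>det (A x)\<bar>)) (cbox a b)"
    using int by (rule integrable_integral)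
  then have "((\<lambda>y. \<bar>det (A (of_wo y))\<bar>) has_integral (1 / 1) *\<^sub>R integral (cbox a b) (\<lambda>x. \<bar>det (A x)\<bar>)) (to_wo ` cbox a b)"
  proof (rule has_integral_twiddle[rotated -1])
    show "continuous (at x) of_wo" for x
      by (simp add: bounded_linear_of_wo linear_continuous_at)
    show "\<exists>w z. of_wo ` cbox u v = cbox w z" for u v by (auto simp: of_wo_image_cbox)
    show "\<exists>w z. to_wo ` cbox u v = cbox w z" for u v by (auto simp: to_wo_image_cbox)
    show "measure lborel (of_wo ` cbox u v) = 1 * measure lborel (cbox u v)" for u v
      by (metis content_to_wo mult_1 of_wo_image_cbox to_wo_of_wo)
  qed auto
  then have int': "((\<lambda>y. \<bar>det (matrix (F' y))\<bar>) has_integral integral (cbox a b) (\<lambda>x. \<bar>det (A x)\<bar>)) S"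
    by (simp add: det S)
  have "inj_on F S"
  proof (rule inj_onI)
    fix x y assume xy: "x \<in> S" "y \<in> S" "F x = F y"
    then have "G (of_wo x) = G (of_wo y)" by (metis F_def comp_apply of_wo_to_wo)
    moreover have "of_wo x \<in> cbox a b" "of_wo y \<in> cbox a b" using xy S(2) by auto
    ultimately have "of_wo x = of_wo y" using inj by (auto dest: inj_onD)
    then show "x = y" by (metis to_wo_of_wo)
  qed
  then have "measure lebesgue (F ` S) = integral S (\<lambda>y. \<bar>det (matrix (F' y))\<bar>)"
    using int' derF by (intro measure_differentiable_image_eq) (auto simp: S_def)
  moreover have "F ` S = to_wo ` G ` cbox a b"
    unfolding F_def by (metis S(2) image_comp)
  moreover have "compact (G ` cbox a b)"
    using der by (intro compact_continuous_image) (auto intro!: has_derivative_continuous_on)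
  ultimately show ?thesis
    using int' by (simp add: measure_to_wo_image integral_unique)
qed

subsection \<open>Hessians and the maximum principle\<close>

lemma grad_eqI:
  assumes "(u has_derivative (\<lambda>h. p \<bullet> h)) (at x)"
  shows "grad u x = p"
proof -
  have "frechet_derivative u (at x) = (\<lambda>h. p \<bullet> h)"
    using frechet_derivative_at[OF assms] by simp
  then show ?thesis by (simp add: grad_def vec_eq_iff inner_axis)
qed

lemma has_derivative_grad:
  assumes "u differentiable (at x)"
  shows "(u has_derivative (\<lambda>h. grad u x \<bullet> h)) (at x)"
proof -
  let ?D = "frechet_derivative u (at x)"
  have D: "(u has_derivative ?D) (at x)"
    using assms by (simp add: frechet_derivative_works)
  then have lin: "linear ?D" by (rule has_derivative_linear)
  have "?D h = grad u x \<bullet> h" for h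
  proof -
    have "?D h = ?D (\<Sum>i\<in>UNIV. h $ i *\<^sub>R axis i 1)"
      using basis_expansion[of h] by (simp add: scalar_mult_eq_scaleR)
    also have "\<dots> = (\<Sum>i\<in>UNIV. h $ i * ?D (axis i 1))"
      using lin by (simp add: linear_sum linear_cmul)
    finally show ?thesis by (simp add: inner_vec_def grad_def mult.commute)
  qed
  with D show ?thesis by (metis (no_types) ext)
qed

lemma has_derivative_hess:
  assumes "grad u differentiable (at x)"
  shows "(grad u has_derivative (\<lambda>h. hess u x *v h)) (at x)"
  using assms by (simp add: jacobian_works hess_def)

lemma has_real_derivative_along_line:
  assumes "u differentiable (at (x + s *\<^sub>R d))"
  shows "((\<lambda>s. u (x + s *\<^sub>R d)) has_real_derivative (grad u (x + s *\<^sub>R d) \<bullet> d)) (at s)"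
proof -
  have "((\<lambda>s. x + s *\<^sub>R d) has_derivative (\<lambda>h. h *\<^sub>R d)) (at s)"
    by (auto intro!: derivative_eq_intros)
  from diff_chain_at[OF this has_derivative_grad[OF assms]]
  show ?thesis by (simp add: has_field_derivative_def o_def mult_commute_abs)
qed

lemma has_real_derivative_grad_along_line:
  assumes "grad u differentiable (at (x + s *\<^sub>R d))"
  shows "((\<lambda>s. grad u (x + s *\<^sub>R d) \<bullet> e) has_real_derivative (e \<bullet> (hess u (x + s *\<^sub>R d) *v d))) (at s)"
proof -
  have "((\<lambda>s. x + s *\<^sub>R d) has_derivative (\<lambda>h. h *\<^sub>R d)) (at s)"
    by (auto intro!: derivative_eq_intros)
  from diff_chain_at[OF this has_derivative_hess[OF assms]]
  have "((\<lambda>s. grad u (x + s *\<^sub>R d)) has_derivative (\<lambda>h. h *\<^sub>R (hess u (x + s *\<^sub>R d) *v d))) (at s)"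
    by (simp add: o_def matrix_vector_mult_scaleR)
  from has_derivative_inner_left[OF this, of e]
  show ?thesis by (simp add: has_field_derivative_def mult_commute_abs inner_commute)
qed

text \<open>\<open>v \<bullet> (hess u x *v w)\<close> is the limit of the second difference quotient, which is symmetric in
  \<open>v\<close> and \<open>w\<close>.\<close>

lemma second_difference_approx:
  fixes u :: "real^'n \<Rightarrow> real"
  assumes "open \<Omega>" "x \<in> \<Omega>" and diff: "\<And>y. y \<in> \<Omega> \<Longrightarrow> u differentiable (at y)"
    and grad: "grad u differentiable (at x)" and "e > 0"
  shows "\<exists>\<delta>>0. \<forall>t. 0 < t \<longrightarrow> t < \<delta> \<longrightarrow>
    \<bar>u (x + t *\<^sub>R v + t *\<^sub>R w) - u (x + t *\<^sub>R v) - u (x + t *\<^sub>R w) + u x - t\<^sup>2 * (v \<bullet> (hess u x *v w))\<bar>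
      \<le> 2 * e * t\<^sup>2 * (norm v + norm w)\<^sup>2"
proof -
  define N where "N = norm v + norm w"
  obtain r where r: "r > 0" "ball x r \<subseteq> \<Omega>"
    using assms(1,2) openE by blast
  obtain \<delta>0 where \<delta>0: "\<delta>0 > 0" "\<And>y. norm (y - x) < \<delta>0 \<Longrightarrow>
      norm (grad u y - grad u x - hess u x *v (y - x)) \<le> e * norm (y - x)"
    using has_derivative_hess[OF grad] \<open>e > 0\<close> unfolding has_derivative_at_alt by metis
  \<comment> \<open>For \<open>t < \<delta>\<close> the parallelogram spanned at \<open>x\<close> by
    \<open>t *\<^sub>R v\<close> and \<open>t *\<^sub>R w\<close> stays in \<Omega> and in the range
    of the derivative estimate. The summand 1 covers \<open>N = 0\<close>.\<close>
  define \<delta> where "\<delta> = min \<delta>0 r / (N + 1)"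
  have N: "N \<ge> 0" by (simp add: N_def)
  then have \<delta>: "\<delta> > 0" using r \<delta>0 by (simp add: \<delta>_def)
  show ?thesis
  proof (intro exI[of _ \<delta>] conjI allI impI)
    fix t :: real assume t: "0 < t" "t < \<delta>"
    have "t * (N + 1) < min \<delta>0 r" using t N by (simp add: \<delta>_def field_simps)
    then have tN: "t * N < \<delta>0" "t * N < r" using t by (auto simp: algebra_simps)
    have small: "norm ((\<theta> * t) *\<^sub>R v + (\<eta> * t) *\<^sub>R w) \<le> t * N" if "0 \<le> \<theta>" "\<theta> \<le> 1" "0 \<le> \<eta>" "\<eta> \<le> 1" for \<theta> \<eta>
    proof -
      have "norm ((\<theta> * t) *\<^sub>R v + (\<eta> * t) *\<^sub>R w) \<le> \<theta> * t * norm v + \<eta> * t * norm w"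
        using t that by (intro norm_triangle_le) simp
      also have "\<dots> \<le> 1 * t * norm v + 1 * t * norm w"
        using t that by (intro add_mono mult_right_mono) auto
      finally show ?thesis by (simp add: N_def algebra_simps)
    qed
    have in\<Omega>: "x + (\<theta> * t) *\<^sub>R v + (\<eta> * t) *\<^sub>R w \<in> \<Omega>" if "0 \<le> \<theta>" "\<theta> \<le> 1" "0 \<le> \<eta>" "\<eta> \<le> 1" for \<theta> \<eta>
    proof -
      have "x + (\<theta> * t) *\<^sub>R v + (\<eta> * t) *\<^sub>R w \<in> ball x r"
        using small[OF that] tN(2)
        by (metis add.assoc add_diff_cancel_left' dist_commute dist_norm le_less_trans mem_ball)
      then show ?thesis using r by blast
    qed
    \<comment> \<open>The second difference is \<open>\<psi> 1 - \<psi> 0\<close>. The mean value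
      theorem turns it into a difference of gradients at two points that differ by
      \<open>t *\<^sub>R w\<close>, and differentiability of \<open>grad u\<close> at
      \<open>x\<close> evaluates both gradients.\<close>
    define \<psi> where "\<psi> s = u (x + t *\<^sub>R w + s *\<^sub>R (t *\<^sub>R v)) - u (x + s *\<^sub>R (t *\<^sub>R v))" for s
    define \<psi>' where "\<psi>' s = grad u (x + t *\<^sub>R w + s *\<^sub>R (t *\<^sub>R v)) \<bullet> (t *\<^sub>R v) - grad u (x + s *\<^sub>R (t *\<^sub>R v)) \<bullet> (t *\<^sub>R v)" for s
    have "(\<psi> has_real_derivative \<psi>' s) (at s)" if "0 \<le> s" "s \<le> 1" for s
      unfolding \<psi>_def \<psi>'_def
    proof (intro DERIV_diff has_real_derivative_along_line diff)
      show "x + t *\<^sub>R w + s *\<^sub>R (t *\<^sub>R v) \<in> \<Omega>"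
        using in\<Omega>[of s 1] that by (simp add: ac_simps)
      show "x + s *\<^sub>R (t *\<^sub>R v) \<in> \<Omega>"
        using in\<Omega>[of s 0] that by simp
    qed
    then obtain \<theta> where \<theta>: "0 < \<theta>" "\<theta> < 1" "\<psi> 1 - \<psi> 0 = \<psi>' \<theta>"
      using MVT2[of 0 1 \<psi> \<psi>'] by auto
    define k1 where "k1 = (\<theta> * t) *\<^sub>R v + t *\<^sub>R w"
    define k2 where "k2 = (\<theta> * t) *\<^sub>R v"
    have k: "norm k1 \<le> t * N" "norm k2 \<le> t * N"
      using small[of \<theta> 1] small[of \<theta> 0] \<theta> by (auto simp: k1_def k2_def)
    define r1 where "r1 = grad u (x + k1) - grad u x - hess u x *v k1"
    define r2 where "r2 = grad u (x + k2) - grad u x - hess u x *v k2"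
    have r12: "norm r1 \<le> e * (t * N)" "norm r2 \<le> e * (t * N)"
      using \<delta>0(2)[of "x + k1"] \<delta>0(2)[of "x + k2"] k tN \<open>e > 0\<close> unfolding r1_def r2_def
      by (smt (verit) add_diff_cancel_left' mult_left_mono)+
    have "k1 - k2 = t *\<^sub>R w" by (simp add: k1_def k2_def)
    then have "hess u x *v k1 - hess u x *v k2 = t *\<^sub>R (hess u x *v w)"
      by (metis matrix_vector_mult_diff_distrib matrix_vector_mult_scaleR)
    then have g: "grad u (x + k1) - grad u (x + k2) = t *\<^sub>R (hess u x *v w) + (r1 - r2)"
      by (simp add: r1_def r2_def algebra_simps)
    have "\<psi>' \<theta> = t * (v \<bullet> (grad u (x + k1) - grad u (x + k2)))"
      by (simp add: \<psi>'_def k1_def k2_def inner_diff_right inner_commute algebra_simps)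
    also have "\<dots> = t\<^sup>2 * (v \<bullet> (hess u x *v w)) + t * (v \<bullet> (r1 - r2))"
      unfolding g by (simp add: inner_add_right power2_eq_square algebra_simps)
    finally have eq: "\<psi> 1 - \<psi> 0 - t\<^sup>2 * (v \<bullet> (hess u x *v w)) = t * (v \<bullet> (r1 - r2))"
      using \<theta> by simp
    have "\<bar>v \<bullet> (r1 - r2)\<bar> \<le> norm v * norm (r1 - r2)" by (rule Cauchy_Schwarz_ineq2)
    also have "\<dots> \<le> N * (2 * (e * (t * N)))"
      using r12 N norm_triangle_ineq4[of r1 r2] by (intro mult_mono) (auto simp: N_def)
    finally have "\<bar>t * (v \<bullet> (r1 - r2))\<bar> \<le> t * (N * (2 * (e * (t * N))))"
      using t by (simp add: abs_mult)
    then show "\<bar>u (x + t *\<^sub>R v + t *\<^sub>R w) - u (x + t *\<^sub>R v) - u (x + t *\<^sub>R w) + u x - t\<^sup>2 * (v \<bullet> (hess u x *v w))\<bar>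
      \<le> 2 * e * t\<^sup>2 * (norm v + norm w)\<^sup>2"
      unfolding eq[symmetric] N_def[symmetric]
      by (simp add: \<psi>_def ac_simps power2_eq_square)
  qed (fact \<delta>)
qed

lemma hess_symmetric:
  fixes u :: "real^'n \<Rightarrow> real"
  assumes "open \<Omega>" "x \<in> \<Omega>" and "\<And>y. y \<in> \<Omega> \<Longrightarrow> u differentiable (at y)"
    and "grad u differentiable (at x)"
  shows "transpose (hess u x) = hess u x"
proof -
  have sym: "v \<bullet> (hess u x *v w) = w \<bullet> (hess u x *v v)" for v w
  proof (rule ccontr)
    assume neq: "v \<bullet> (hess u x *v w) \<noteq> w \<bullet> (hess u x *v v)"
    define D where "D = \<bar>v \<bullet> (hess u x *v w) - w \<bullet> (hess u x *v v)\<bar>"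
    define N where "N = (norm v + norm w)\<^sup>2"
    \<comment> \<open>Both mixed forms approximate the same second difference, so they differ by at
      most \<open>4 * e * N\<close>; this choice makes that less than \<open>D\<close>.\<close>
    define e where "e = D / (4 * N + 1) / 2"
    have "D > 0" "N \<ge> 0" using neq by (auto simp: D_def N_def)
    then have "e > 0" by (simp add: e_def)
    obtain \<delta>1 where \<delta>1: "\<delta>1 > 0" "\<And>t. 0 < t \<Longrightarrow> t < \<delta>1 \<Longrightarrow>
      \<bar>u (x + t *\<^sub>R v + t *\<^sub>R w) - u (x + t *\<^sub>R v) - u (x + t *\<^sub>R w) + u x - t\<^sup>2 * (v \<bullet> (hess u x *v w))\<bar>
        \<le> 2 * e * t\<^sup>2 * N"
      using second_difference_approx[of \<Omega> x u e v w, OF assms \<open>e > 0\<close>] unfolding N_def by blast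
    obtain \<delta>2 where \<delta>2: "\<delta>2 > 0" "\<And>t. 0 < t \<Longrightarrow> t < \<delta>2 \<Longrightarrow>
      \<bar>u (x + t *\<^sub>R w + t *\<^sub>R v) - u (x + t *\<^sub>R w) - u (x + t *\<^sub>R v) + u x - t\<^sup>2 * (w \<bullet> (hess u x *v v))\<bar>
        \<le> 2 * e * t\<^sup>2 * N"
      using second_difference_approx[of \<Omega> x u e w v, OF assms \<open>e > 0\<close>] unfolding N_def
      by (metis add.commute)
    define t where "t = min \<delta>1 \<delta>2 / 2"
    have t: "0 < t" "t < \<delta>1" "t < \<delta>2" using \<delta>1(1) \<delta>2(1) by (auto simp: t_def)
    have "\<bar>t\<^sup>2 * (v \<bullet> (hess u x *v w)) - t\<^sup>2 * (w \<bullet> (hess u x *v v))\<bar> \<le> 2 * (2 * e * t\<^sup>2 * N)"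
      using \<delta>1(2)[OF t(1,2)] \<delta>2(2)[OF t(1,3)] by (simp add: ac_simps)
    also have "\<bar>t\<^sup>2 * (v \<bullet> (hess u x *v w)) - t\<^sup>2 * (w \<bullet> (hess u x *v v))\<bar> = t\<^sup>2 * D"
      by (simp add: D_def abs_mult flip: right_diff_distrib)
    finally have "t\<^sup>2 * D \<le> t\<^sup>2 * (4 * e * N)" by (simp add: mult_ac)
    then have "D \<le> 4 * e * N" using t by simp
    also have "\<dots> < D" using \<open>D > 0\<close> \<open>N \<ge> 0\<close> by (simp add: e_def field_simps add_pos_nonneg)
    finally show False by simp
  qed
  have "hess u x $ j $ i = hess u x $ i $ j" for i j
    using sym[of "axis j 1" "axis i 1"] by (simp add: matrix_vector_mult_basis column_def inner_axis' )
  then show ?thesis by (simp add: vec_eq_iff transpose_def)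
qed

lemma second_order_Taylor:
  fixes u :: "real^'n \<Rightarrow> real"
  assumes "convex \<Omega>" "x \<in> \<Omega>" "y \<in> \<Omega>"
    and diff: "\<And>y. y \<in> \<Omega> \<Longrightarrow> u differentiable (at y)"
    and grad: "\<And>y. y \<in> \<Omega> \<Longrightarrow> grad u differentiable (at y)"
  shows "\<exists>z\<in>\<Omega>. u y = u x + grad u x \<bullet> (y - x) + (y - x) \<bullet> (hess u z *v (y - x)) / 2"
proof -
  define d where "d = y - x"
  have seg: "x + t *\<^sub>R d \<in> \<Omega>" if "0 \<le> t" "t \<le> 1" for t
  proof -
    have "x + t *\<^sub>R d = (1 - t) *\<^sub>R x + t *\<^sub>R y" by (simp add: d_def algebra_simps)
    then show ?thesis using assms(1-3) that by (simp add: convexD_alt)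
  qed
  \<comment> \<open>The restriction of \<open>u\<close> to the segment with its first two
    derivatives, indexed as \<open>Maclaurin\<close> expects them.\<close>
  define F where "F m t = (if m = 0 then u (x + t *\<^sub>R d) else if m = 1 then grad u (x + t *\<^sub>R d) \<bullet> d
      else d \<bullet> (hess u (x + t *\<^sub>R d) *v d))" for m :: nat and t
  have "\<exists>t. 0 < t \<and> t < 1 \<and> (\<lambda>t. u (x + t *\<^sub>R d)) 1 = (\<Sum>m<2. (F m 0 / fact m) * 1 ^ m) + (F 2 t / fact 2) * 1 ^ 2"
  proof (rule Maclaurin)
    show "F 0 = (\<lambda>t. u (x + t *\<^sub>R d))" by (simp add: F_def fun_eq_iff)
    show "\<forall>m t. m < 2 \<and> 0 \<le> t \<and> t \<le> 1 \<longrightarrow> DERIV (F m) t :> F (Suc m) t"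
    proof (intro allI impI)
      fix m :: nat and t :: real assume "m < 2 \<and> 0 \<le> t \<and> t \<le> 1"
      then consider "m = 0" "0 \<le> t" "t \<le> 1" | "m = 1" "0 \<le> t" "t \<le> 1" by linarith
      then show "DERIV (F m) t :> F (Suc m) t"
      proof cases
        case 1
        then show ?thesis
          using has_real_derivative_along_line[OF diff[OF seg]] by (simp add: F_def[abs_def])
      next
        case 2
        then show ?thesis
          using has_real_derivative_grad_along_line[OF grad[OF seg]] by (simp add: F_def[abs_def])
      qed
    qed
  qed auto
  then obtain t where t: "0 < t" "t < 1" and eq: "u (x + d) = (\<Sum>m<2. F m 0 / fact m) + F 2 t / 2"
    by auto
  have "u (x + d) = u x + grad u x \<bullet> d + d \<bullet> (hess u (x + t *\<^sub>R d) *v d) / 2"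
    unfolding eq by (simp add: F_def numeral_2_eq_2)
  then show ?thesis using seg[of t] t by (auto simp: d_def)
qed

text \<open>At an interior maximum of \<open>w\<close> itself the Hessian would be only negative
  semidefinite, which is compatible with a zero trace. A small multiple of |x|^2 is therefore added:
  where the perturbed function is maximal, \<open>hess w\<close> is negative definite.\<close>

lemma maximum_principle:
  fixes w :: "real^'n \<Rightarrow> real"
  assumes "open \<Omega>" "bounded \<Omega>" and cont: "continuous_on (closure \<Omega>) w"
    and diff: "\<And>y. y \<in> \<Omega> \<Longrightarrow> w differentiable (at y)"
    and grad: "\<And>y. y \<in> \<Omega> \<Longrightarrow> grad w differentiable (at y)"
    and spd: "\<And>y. y \<in> \<Omega> \<Longrightarrow> spd (P y)"
    and trace: "\<And>y. y \<in> \<Omega> \<Longrightarrow> 0 \<le> trace (matrix_inv (P y) ** hess w y)"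
    and frontier: "\<And>y. y \<in> frontier \<Omega> \<Longrightarrow> w y \<le> c"
    and "z \<in> closure \<Omega>"
  shows "w z \<le> c"
proof (rule ccontr)
  assume "\<not> w z \<le> c"
  then have z: "c < w z" by simp
  obtain R where R: "R > 0" "\<And>x. x \<in> closure \<Omega> \<Longrightarrow> norm x \<le> R"
    using assms(2) bounded_closure bounded_pos by metis
  \<comment> \<open>On the closure the perturbation is then at most half of \<open>w z - c\<close>,
    too little to move the maximum to the frontier.\<close>
  define \<delta> where "\<delta> = (w z - c) / (2 * R\<^sup>2)"
  have \<delta>: "\<delta> > 0" "\<delta> * R\<^sup>2 < w z - c" using z R(1) by (auto simp: \<delta>_def field_simps)
  define m where "m x = w x + \<delta> * (x \<bullet> x)" for x
  have cpt: "compact (closure \<Omega>)" using assms(2) by (simp add: compact_closure)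
  have ne: "closure \<Omega> \<noteq> {}" using assms(9) by (metis empty_iff)
  have "continuous_on (closure \<Omega>) m"
    unfolding m_def by (intro continuous_intros cont)
  from continuous_attains_sup[OF cpt ne this] obtain x where x: "x \<in> closure \<Omega>" and max: "\<And>y. y \<in> closure \<Omega> \<Longrightarrow> m y \<le> m x"
    by metis
  have "x \<notin> frontier \<Omega>"
  proof
    assume "x \<in> frontier \<Omega>"
    have "m x \<le> c + \<delta> * R\<^sup>2"
      unfolding m_def using frontier[OF \<open>x \<in> frontier \<Omega>\<close>] \<delta>(1) R(2)[OF x]
      by (intro add_mono mult_left_mono) (auto simp: power2_norm_eq_inner[symmetric] intro: power_mono)
    also have "\<dots> < m z" using \<delta> by (simp add: m_def) (smt (verit) inner_ge_zero mult_nonneg_nonneg)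
    finally show False using max[OF assms(9)] by simp
  qed
  then have x\<Omega>: "x \<in> \<Omega>"
    using x assms(1) by (simp add: frontier_def interior_open)
  obtain r where r: "r > 0" "ball x r \<subseteq> \<Omega>" using assms(1) x\<Omega> openE by blast
  \<comment> \<open>Otherwise the derivative \<open>q\<close> of the perturbed function along the
    line through \<open>x\<close> with direction \<open>d\<close> would vanish at 0 with positive
    slope, and the function would exceed its maximum just to the right of 0.\<close>
  have hess_neg: "d \<bullet> (hess w x *v d) < 0" if "d \<noteq> 0" for d
  proof (rule ccontr)
    assume "\<not> d \<bullet> (hess w x *v d) < 0"
    define s0 where "s0 = r / norm d"
    have s0: "s0 > 0" using r that by (simp add: s0_def)
    have in\<Omega>: "x + s *\<^sub>R d \<in> \<Omega>" if "\<bar>s\<bar> < s0" for s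
    proof -
      have "x + s *\<^sub>R d \<in> ball x r"
        using that \<open>d \<noteq> 0\<close> by (simp add: dist_norm s0_def field_simps)
      then show ?thesis using r by blast
    qed
    define \<mu> where "\<mu> s = w (x + s *\<^sub>R d) + \<delta> * ((x + s *\<^sub>R d) \<bullet> (x + s *\<^sub>R d))" for s
    define q where "q s = grad w (x + s *\<^sub>R d) \<bullet> d + 2 * \<delta> * ((x + s *\<^sub>R d) \<bullet> d)" for s
    have \<mu>': "(\<mu> has_real_derivative q s) (at s)" if "\<bar>s\<bar> < s0" for s
      unfolding \<mu>_def q_def
      using has_real_derivative_along_line[OF diff[OF in\<Omega>[OF that]]]
      by (auto intro!: derivative_eq_intros simp: inner_add_left inner_add_right inner_commute algebra_simps)
    have q': "(q has_real_derivative (d \<bullet> (hess w (x + 0 *\<^sub>R d) *v d) + 2 * \<delta> * (d \<bullet> d))) (at 0)"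
      unfolding q_def
      using has_real_derivative_grad_along_line[OF grad[OF in\<Omega>[of 0]], of d] s0
      by (auto intro!: derivative_eq_intros simp: inner_add_left algebra_simps)
    have \<mu>max: "\<mu> s \<le> \<mu> 0" if "\<bar>s\<bar> < s0" for s
      using max[of "x + s *\<^sub>R d"] in\<Omega>[OF that] closure_subset by (auto simp: \<mu>_def m_def)
    have "q 0 = 0"
      using DERIV_local_max[OF \<mu>'[of 0] s0] \<mu>max s0 by simp
    moreover have "0 < d \<bullet> (hess w (x + 0 *\<^sub>R d) *v d) + 2 * \<delta> * (d \<bullet> d)"
      using \<open>\<not> d \<bullet> (hess w x *v d) < 0\<close> \<delta>(1) that by (simp add: add_nonneg_pos)
    ultimately obtain s1 where s1: "s1 > 0" "\<And>h. 0 < h \<Longrightarrow> h < s1 \<Longrightarrow> 0 < q h"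
      using DERIV_pos_inc_right[OF q'] by auto
    define h where "h = min s0 s1 / 2"
    have h: "0 < h" "h < s0" "h < s1" using s0 s1 by (auto simp: h_def)
    obtain \<theta> where \<theta>: "0 < \<theta>" "\<theta> < h" "\<mu> h - \<mu> 0 = (h - 0) * q \<theta>"
      using MVT2[of 0 h \<mu> q] \<mu>' h by auto
    have "0 < q \<theta>" using s1(2) \<theta> h by simp
    then have "\<mu> h - \<mu> 0 > 0" unfolding \<theta>(3) using h by simp
    then show False using \<mu>max[of h] h by simp
  qed
  have "transpose (hess w x) = hess w x"
    using hess_symmetric[OF assms(1) x\<Omega> diff grad[OF x\<Omega>]] .
  then have "trace (matrix_inv (P x) ** hess w x) < 0"
    using trace_matrix_inv_mult_nonpos spd[OF x\<Omega>] hess_neg by blast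
  then show False using trace[OF x\<Omega>] by simp
qed

subsection \<open>Functions pinched between quadratics\<close>

text \<open>If \<open>u\<close> is \<open>C\<^sup>2\<close> and \<open>\<Omega>\<close> is convex, this says \<open>m \<le> D\<^sup>2u \<le> M\<close> with \<open>p\<close> the gradient of \<open>u\<close>. Unlike the
  bounds on \<open>D\<^sup>2u\<close>, it passes to uniform limits.\<close>

definition quadratically_pinched ::
    "real \<Rightarrow> real \<Rightarrow> 'a::real_inner set \<Rightarrow> ('a \<Rightarrow> real) \<Rightarrow> ('a \<Rightarrow> 'a) \<Rightarrow> bool" where
  "quadratically_pinched m M \<Omega> u p \<longleftrightarrow>
     (\<forall>x\<in>\<Omega>. \<forall>y\<in>\<Omega>. m / 2 * (norm (y - x))\<^sup>2 \<le> u y - u x - p x \<bullet> (y - x) \<and>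
        u y - u x - p x \<bullet> (y - x) \<le> M / 2 * (norm (y - x))\<^sup>2)"

lemma quadratically_pinchedD:
  assumes "quadratically_pinched m M \<Omega> u p" "x \<in> \<Omega>" "y \<in> \<Omega>"
  shows "m / 2 * (norm (y - x))\<^sup>2 \<le> u y - u x - p x \<bullet> (y - x)"
    and "u y - u x - p x \<bullet> (y - x) \<le> M / 2 * (norm (y - x))\<^sup>2"
  using assms by (auto simp: quadratically_pinched_def)

lemma quadratically_pinched_mono:
  assumes "quadratically_pinched m M \<Omega> u p" "m' \<le> m"
  shows "quadratically_pinched m' M \<Omega> u p"
  unfolding quadratically_pinched_def
proof (intro ballI)
  fix x y assume xy: "x \<in> \<Omega>" "y \<in> \<Omega>"
  have "m' / 2 * (norm (y - x))\<^sup>2 \<le> m / 2 * (norm (y - x))\<^sup>2"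
    using assms(2) by (intro mult_right_mono) auto
  then show "m' / 2 * (norm (y - x))\<^sup>2 \<le> u y - u x - p x \<bullet> (y - x) \<and>
        u y - u x - p x \<bullet> (y - x) \<le> M / 2 * (norm (y - x))\<^sup>2"
    using quadratically_pinchedD[OF assms(1) xy] by linarith
qed

lemma quadratically_pinched_convex_combination:
  assumes "quadratically_pinched m M \<Omega> u p" "quadratically_pinched m M \<Omega> v q" "0 \<le> t" "t \<le> 1"
  shows "quadratically_pinched m M \<Omega> (\<lambda>x. (1 - t) * u x + t * v x) (\<lambda>x. (1 - t) *\<^sub>R p x + t *\<^sub>R q x)"
  unfolding quadratically_pinched_def
proof (intro ballI)
  fix x y assume xy: "x \<in> \<Omega>" "y \<in> \<Omega>"
  note u = quadratically_pinchedD[OF assms(1) xy] and v = quadratically_pinchedD[OF assms(2) xy]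
  have eq: "((1 - t) * u y + t * v y) - ((1 - t) * u x + t * v x) - ((1 - t) *\<^sub>R p x + t *\<^sub>R q x) \<bullet> (y - x)
      = (1 - t) * (u y - u x - p x \<bullet> (y - x)) + t * (v y - v x - q x \<bullet> (y - x))"
    by (simp add: inner_add_left algebra_simps)
  have "(1 - t) * (m / 2 * (norm (y - x))\<^sup>2) + t * (m / 2 * (norm (y - x))\<^sup>2)
      \<le> (1 - t) * (u y - u x - p x \<bullet> (y - x)) + t * (v y - v x - q x \<bullet> (y - x))"
    using u(1) v(1) assms(3,4) by (intro add_mono mult_left_mono) auto
  moreover have "(1 - t) * (u y - u x - p x \<bullet> (y - x)) + t * (v y - v x - q x \<bullet> (y - x))
      \<le> (1 - t) * (M / 2 * (norm (y - x))\<^sup>2) + t * (M / 2 * (norm (y - x))\<^sup>2)"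
    using u(2) v(2) assms(3,4) by (intro add_mono mult_left_mono) auto
  ultimately show "m / 2 * (norm (y - x))\<^sup>2 \<le> ((1 - t) * u y + t * v y) - ((1 - t) * u x + t * v x) - ((1 - t) *\<^sub>R p x + t *\<^sub>R q x) \<bullet> (y - x) \<and>
      ((1 - t) * u y + t * v y) - ((1 - t) * u x + t * v x) - ((1 - t) *\<^sub>R p x + t *\<^sub>R q x) \<bullet> (y - x) \<le> M / 2 * (norm (y - x))\<^sup>2"
    unfolding eq by (simp only: distrib_right[symmetric]) simp
qed

text \<open>The remainder is quadratic in \<open>y - x\<close> whatever the signs of
  \<open>m\<close> and \<open>M\<close>, so \<open>p\<close> can only be the gradient.\<close>

lemma quadratically_pinched_has_derivative:
  assumes "quadratically_pinched m M \<Omega> u p" "open \<Omega>" "x \<in> \<Omega>"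
  shows "(u has_derivative (\<lambda>h. p x \<bullet> h)) (at x)"
  unfolding has_derivative_at_alt
proof (intro conjI allI impI)
  show "bounded_linear (\<lambda>h. p x \<bullet> h)" by (rule bounded_linear_inner_right)
  fix e :: real assume "e > 0"
  obtain r where r: "r > 0" "ball x r \<subseteq> \<Omega>" using assms(2,3) openE by blast
  define C where "C = \<bar>m\<bar> / 2 + \<bar>M\<bar> / 2 + 1"
  have C: "C > 0" "m / 2 \<ge> - C" "M / 2 \<le> C" by (auto simp: C_def)
  show "\<exists>d>0. \<forall>y. norm (y - x) < d \<longrightarrow> norm (u y - u x - p x \<bullet> (y - x)) \<le> e * norm (y - x)"
  proof (intro exI[of _ "min r (e / C)"] conjI allI impI)
    show "0 < min r (e / C)" using r \<open>e > 0\<close> C by simp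
    fix y assume y: "norm (y - x) < min r (e / C)"
    then have "y \<in> \<Omega>" using r by (auto simp: dist_norm norm_minus_commute)
    note b = quadratically_pinchedD[OF assms(1,3) this]
    have "- C * (norm (y - x))\<^sup>2 \<le> m / 2 * (norm (y - x))\<^sup>2" "M / 2 * (norm (y - x))\<^sup>2 \<le> C * (norm (y - x))\<^sup>2"
      using C by (intro mult_right_mono; simp)+
    then have "norm (u y - u x - p x \<bullet> (y - x)) \<le> C * (norm (y - x))\<^sup>2"
      using b unfolding real_norm_def abs_le_iff by linarith
    also have "\<dots> = (C * norm (y - x)) * norm (y - x)" by (simp add: power2_eq_square)
    also have "\<dots> \<le> e * norm (y - x)"
      using y C by (intro mult_right_mono) (auto simp: field_simps)
    finally show "norm (u y - u x - p x \<bullet> (y - x)) \<le> e * norm (y - x)" .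
  qed
qed

text \<open>Adding the lower bounds with base points \<open>x\<close> and \<open>y\<close> cancels
  the values of \<open>u\<close>.\<close>

lemma quadratically_pinched_strongly_monotone:
  assumes "quadratically_pinched m M \<Omega> u p" "x \<in> \<Omega>" "y \<in> \<Omega>"
  shows "m * (norm (y - x))\<^sup>2 \<le> (p y - p x) \<bullet> (y - x)"
  using quadratically_pinchedD(1)[OF assms] quadratically_pinchedD(1)[OF assms(1,3,2)]
  by (simp add: inner_diff_left inner_diff_right norm_minus_commute)

lemma quadratically_pinched_inj_on:
  assumes "quadratically_pinched m M \<Omega> u p" "m > 0"
  shows "inj_on p \<Omega>"
proof (rule inj_onI)
  fix x y assume "x \<in> \<Omega>" "y \<in> \<Omega>" "p x = p y"
  then have "m * (norm (y - x))\<^sup>2 \<le> 0"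
    using quadratically_pinched_strongly_monotone[OF assms(1)] by fastforce
  then show "x = y" using assms(2) by (simp add: mult_le_0_iff)
qed

section \<open>Gradients of pinched functions under uniform convergence\<close>

lemma inner_sgn_self: "x \<bullet> sgn x = norm x" for x :: "'a::real_inner"
  by (cases "x = 0") (auto simp: sgn_div_norm dot_square_norm power2_eq_square)

text \<open>Move from \<open>x\<close> by \<open>s\<close> in the direction of
  \<open>p x - q x\<close>. There the support plane of \<open>u\<close> and the quadratic upper
  bound for \<open>v\<close> drive the functions apart by s |p x - q x| up to M s^2 / 2, while they
  are \<delta>-close. Choosing \<open>s\<close> small first and then \<delta> makes the bound
  small.\<close>

lemma gradient_interpolation:
  assumes u: "quadratically_pinched 0 M \<Omega> u p" and v: "quadratically_pinched 0 M \<Omega> v q"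
    and close: "\<And>y. y \<in> \<Omega> \<Longrightarrow> \<bar>u y - v y\<bar> \<le> \<delta>" and M: "M \<ge> 0"
    and x: "cball x r \<subseteq> \<Omega>" and s: "0 < s" "s \<le> r"
  shows "norm (p x - q x) \<le> 2 * \<delta> / s + M / 2 * s"
proof (cases "p x = q x")
  case True
  have "x \<in> \<Omega>" using x s by auto
  then have "0 \<le> \<delta>" using close[of x] by linarith
  then show ?thesis using True s M by simp
next
  case False
  define e where "e = sgn (p x - q x)"
  have ne: "norm e = 1" using False by (simp add: e_def norm_sgn)
  have pe: "(p x - q x) \<bullet> e = norm (p x - q x)"
    by (simp add: e_def inner_sgn_self)
  define y where "y = x + s *\<^sub>R e"
  have n: "norm (y - x) = s" using s ne by (simp add: y_def)
  then have y: "y \<in> \<Omega>" using x s by (auto simp: dist_norm norm_minus_commute)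
  have "x \<in> \<Omega>" using x s by auto
  have "u y \<ge> u x + p x \<bullet> (y - x)"
    using quadratically_pinchedD(1)[OF u \<open>x \<in> \<Omega>\<close> y] by simp
  moreover have "v y \<le> v x + q x \<bullet> (y - x) + M / 2 * s\<^sup>2"
    using quadratically_pinchedD(2)[OF v \<open>x \<in> \<Omega>\<close> y] n by simp
  ultimately have "(p x - q x) \<bullet> (y - x) \<le> 2 * \<delta> + M / 2 * s\<^sup>2"
    using close[OF y] close[OF \<open>x \<in> \<Omega>\<close>] by (simp add: inner_diff_left abs_le_iff)
  then have "s * norm (p x - q x) \<le> 2 * \<delta> + M / 2 * s\<^sup>2"
    using pe by (simp add: y_def)
  then show ?thesis using s by (simp add: field_simps power2_eq_square)
qed

text \<open>In the direction of \<open>p x\<close> the support plane makes \<open>u\<close> grow by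
  at least \<open>r * norm (p x)\<close> over the distance \<open>r\<close>, and the oscillation of
  \<open>u\<close> is at most \<open>2 * C\<close>.\<close>

lemma quadratically_pinched_bound_gradient:
  assumes u: "quadratically_pinched 0 M \<Omega> u p" and bd: "\<And>y. y \<in> \<Omega> \<Longrightarrow> \<bar>u y\<bar> \<le> C"
    and r: "r > 0" "cball x r \<subseteq> \<Omega>"
  shows "norm (p x) \<le> 2 * C / r"
proof (cases "p x = 0")
  case True
  have "x \<in> \<Omega>" using r by auto
  then have "0 \<le> C" using bd[of x] by linarith
  then show ?thesis using True r by simp
next
  case False
  define y where "y = x + r *\<^sub>R sgn (p x)"
  have "norm (y - x) = r" using r False by (simp add: y_def norm_sgn)
  then have y: "y \<in> \<Omega>" using r by (auto simp: dist_norm norm_minus_commute)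
  have "x \<in> \<Omega>" using r by auto
  have "p x \<bullet> sgn (p x) = norm (p x)"
    by (rule inner_sgn_self)
  then have "r * norm (p x) \<le> u y - u x"
    using quadratically_pinchedD(1)[OF u \<open>x \<in> \<Omega>\<close> y] by (simp add: y_def)
  also have "\<dots> \<le> 2 * C" using bd[OF y] bd[OF \<open>x \<in> \<Omega>\<close>] by (simp add: abs_le_iff)
  finally show ?thesis using r by (simp add: field_simps)
qed

text \<open>Interpolation makes the gradients Cauchy at each point; the pinching inequalities
  involve only values of \<open>u k\<close> and vectors \<open>p k x\<close>, so they pass to the
  limit.\<close>

lemma quadratically_pinched_uniform_limit:
  fixes u :: "nat \<Rightarrow> 'a::{real_inner,banach} \<Rightarrow> real"
  assumes "open \<Omega>" and M: "M \<ge> 0" and m: "m \<ge> 0" and u: "\<And>k. quadratically_pinched m M \<Omega> (u k) (p k)"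
    and lim: "uniform_limit \<Omega> u v sequentially"
  shows "\<exists>q. quadratically_pinched m M \<Omega> v q \<and> (\<forall>x\<in>\<Omega>. (\<lambda>k. p k x) \<longlonglongrightarrow> q x)"
proof -
  have u0: "quadratically_pinched 0 M \<Omega> (u k) (p k)" for k
    using u m quadratically_pinched_mono by blast
  have "Cauchy (\<lambda>k. p k x)" if "x \<in> \<Omega>" for x
  proof (rule CauchyI)
    fix e :: real assume "e > 0"
    obtain r where r: "r > 0" "cball x r \<subseteq> \<Omega>" using assms(1) \<open>x \<in> \<Omega>\<close> open_contains_cball by blast
    \<comment> \<open>\<open>s\<close> makes the curvature term at most \<open>e / 2\<close>, and
      \<open>\<delta>\<close> is chosen afterwards so that the other term is \<open>e / 4\<close>.
      The summand 1 covers \<open>M = 0\<close>.\<close>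
    define s where "s = min r (e / (M + 1))"
    have s: "0 < s" "s \<le> r" using r \<open>e > 0\<close> M by (auto simp: s_def)
    have "M / 2 * s \<le> M / 2 * (e / (M + 1))"
      using M by (intro mult_left_mono) (auto simp: s_def)
    also have "\<dots> \<le> e / 2" using M \<open>e > 0\<close> by (simp add: field_simps)
    finally have Ms: "M / 2 * s \<le> e / 2" .
    define \<delta> where "\<delta> = s * e / 16"
    have "\<delta> > 0" using s \<open>e > 0\<close> by (simp add: \<delta>_def)
    then obtain N where N: "\<And>k y. k \<ge> N \<Longrightarrow> y \<in> \<Omega> \<Longrightarrow> dist (u k y) (v y) < \<delta>"
      using lim unfolding uniform_limit_iff eventually_sequentially by metis
    show "\<exists>N. \<forall>i\<ge>N. \<forall>j\<ge>N. norm (p i x - p j x) < e"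
    proof (intro exI[of _ N] allI impI)
      fix i j assume ij: "N \<le> i" "N \<le> j"
      have "\<bar>u i y - u j y\<bar> \<le> 2 * \<delta>" if "y \<in> \<Omega>" for y
        using N[OF ij(1) that] N[OF ij(2) that] by (simp add: dist_real_def)
      then have "norm (p i x - p j x) \<le> 2 * (2 * \<delta>) / s + M / 2 * s"
        by (rule gradient_interpolation[OF u0 u0 _ M r(2) s])
      also have "2 * (2 * \<delta>) / s = e / 4" using s by (simp add: \<delta>_def)
      also have "e / 4 + M / 2 * s < e" using Ms \<open>e > 0\<close> by linarith
      finally show "norm (p i x - p j x) < e" .
    qed
  qed
  then have "\<forall>x\<in>\<Omega>. \<exists>y. (\<lambda>k. p k x) \<longlonglongrightarrow> y"
    by (auto simp: Cauchy_convergent_iff convergent_def)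
  then obtain q where q: "\<And>x. x \<in> \<Omega> \<Longrightarrow> (\<lambda>k. p k x) \<longlonglongrightarrow> q x"
    by metis
  have ulim: "(\<lambda>k. u k x) \<longlonglongrightarrow> v x" if "x \<in> \<Omega>" for x
    using tendsto_uniform_limitI[OF lim that] .
  have "quadratically_pinched m M \<Omega> v q"
    unfolding quadratically_pinched_def
  proof (intro ballI conjI)
    fix x y assume xy: "x \<in> \<Omega>" "y \<in> \<Omega>"
    have T: "(\<lambda>k. u k y - u k x - p k x \<bullet> (y - x)) \<longlonglongrightarrow> v y - v x - q x \<bullet> (y - x)"
      by (intro tendsto_intros ulim q xy)
    show "m / 2 * (norm (y - x))\<^sup>2 \<le> v y - v x - q x \<bullet> (y - x)"
      using quadratically_pinchedD(1)[OF u xy] by (intro LIMSEQ_le_const[OF T]) blast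
    show "v y - v x - q x \<bullet> (y - x) \<le> M / 2 * (norm (y - x))\<^sup>2"
      using quadratically_pinchedD(2)[OF u xy] by (intro LIMSEQ_le_const2[OF T]) blast
  qed
  with q show ?thesis by blast
qed

text \<open>Compactness supplies one radius that keeps the balls around all points of
  \<open>K\<close> inside \<Omega>, so the interpolation bound does not depend on the point.\<close>

lemma gradients_uniform_limit_on_compact:
  assumes "open \<Omega>" and M: "M \<ge> 0" and u: "\<And>k. quadratically_pinched 0 M \<Omega> (u k) (p k)"
    and v: "quadratically_pinched 0 M \<Omega> v q"
    and lim: "uniform_limit \<Omega> u v sequentially" and K: "compact K" "K \<subseteq> \<Omega>"
  shows "uniform_limit K p q sequentially"
  unfolding uniform_limit_iff
proof (intro allI impI)
  fix e :: real assume "e > 0"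
  obtain r0 where r0: "r0 > 0" "(\<Union>x\<in>K. ball x r0) \<subseteq> \<Omega>"
    using compact_subset_open_imp_ball_epsilon_subset[OF K(1) assms(1) K(2)] by blast
  define r where "r = r0 / 2"
  have r: "r > 0" using r0 by (simp add: r_def)
  have rK: "cball x r \<subseteq> \<Omega>" if "x \<in> K" for x
  proof -
    have "cball x r \<subseteq> ball x r0" using r0(1) by (auto simp: r_def)
    then show ?thesis using r0(2) that by blast
  qed
  define s where "s = min r (e / (M + 1))"
  have s: "0 < s" "s \<le> r" using r \<open>e > 0\<close> M by (auto simp: s_def)
  have "M / 2 * s \<le> M / 2 * (e / (M + 1))"
    using M by (intro mult_left_mono) (auto simp: s_def)
  also have "\<dots> \<le> e / 2" using M \<open>e > 0\<close> by (simp add: field_simps)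
  finally have Ms: "M / 2 * s \<le> e / 2" .
  define \<delta> where "\<delta> = s * e / 16"
  have "\<delta> > 0" using s \<open>e > 0\<close> by (simp add: \<delta>_def)
  then have "\<forall>\<^sub>F k in sequentially. \<forall>y\<in>\<Omega>. dist (u k y) (v y) < \<delta>"
    using lim unfolding uniform_limit_iff by blast
  then show "\<forall>\<^sub>F k in sequentially. \<forall>x\<in>K. dist (p k x) (q x) < e"
  proof eventually_elim
    case (elim k)
    show ?case
    proof
      fix x assume "x \<in> K"
      have "\<bar>u k y - v y\<bar> \<le> \<delta>" if "y \<in> \<Omega>" for y
        using elim that by (auto simp: dist_real_def intro: less_imp_le)
      then have "norm (p k x - q x) \<le> 2 * \<delta> / s + M / 2 * s"
        by (rule gradient_interpolation[OF u v _ M rK[OF \<open>x \<in> K\<close>] s])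
      also have "2 * \<delta> / s = e / 8" using s by (simp add: \<delta>_def)
      also have "e / 8 + M / 2 * s < e" using Ms \<open>e > 0\<close> by linarith
      finally show "dist (p k x) (q x) < e" by (simp add: dist_norm)
    qed
  qed
qed

text \<open>For a supporting slope \<open>p\<close> the function
  \<open>\<lambda>y. v y - p \<bullet> y\<close> is minimal at \<open>x\<close>, so its derivative
  vanishes there and \<open>p\<close> is the gradient.\<close>

lemma subdifferential_quadratically_pinched:
  fixes v :: "real^'n \<Rightarrow> real"
  assumes v: "quadratically_pinched 0 M \<Omega> v q" and "open \<Omega>" "x \<in> \<Omega>"
  shows "subdifferential \<Omega> v x = {q x}"
proof
  show "{q x} \<subseteq> subdifferential \<Omega> v x"
    using quadratically_pinchedD(1)[OF v assms(3)] by (fastforce simp: subdifferential_def)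
  show "subdifferential \<Omega> v x \<subseteq> {q x}"
  proof
    fix p assume "p \<in> subdifferential \<Omega> v x"
    then have p: "\<And>y. y \<in> \<Omega> \<Longrightarrow> v y \<ge> v x + p \<bullet> (y - x)" by (simp add: subdifferential_def)
    have "((\<lambda>y. v y - p \<bullet> y) has_derivative (\<lambda>h. q x \<bullet> h - p \<bullet> h)) (at x)"
      by (rule has_derivative_diff[OF quadratically_pinched_has_derivative[OF v assms(2,3)]
            bounded_linear_imp_has_derivative[OF bounded_linear_inner_right]])
    moreover have "\<forall>y\<in>\<Omega>. v x - p \<bullet> x \<le> v y - p \<bullet> y"
      using p by (auto simp: inner_diff_right algebra_simps)
    ultimately have "(\<lambda>h. q x \<bullet> h - p \<bullet> h) = (\<lambda>h. 0)"
      using differential_zero_maxmin[OF assms(3,2)] by blast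
    then have "(q x - p) \<bullet> (q x - p) = 0"
      by (metis inner_diff_left)
    then show "p \<in> {q x}" by simp
  qed
qed

text \<open>A finite net reduces uniform convergence to finitely many pointwise limits; the common
  constant, which the limit inherits, controls the variation between a point and the net.\<close>

lemma uniform_limit_equi_Lipschitz:
  fixes u :: "nat \<Rightarrow> 'a::metric_space \<Rightarrow> 'b::metric_space"
  assumes "compact K" and L: "\<And>k. L-lipschitz_on K (u k)"
    and lim: "\<And>x. x \<in> K \<Longrightarrow> (\<lambda>k. u k x) \<longlonglongrightarrow> v x"
  shows "uniform_limit K u v sequentially"
  unfolding uniform_limit_iff
proof (intro allI impI)
  fix e :: real assume "e > 0"
  have L0: "L \<ge> 0" using L by (rule lipschitz_on_nonneg)
  have Lv: "dist (v x) (v y) \<le> L * dist x y" if "x \<in> K" "y \<in> K" for x y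
    by (rule LIMSEQ_le_const2[OF tendsto_dist[OF lim[OF that(1)] lim[OF that(2)]]])
      (use lipschitz_onD[OF L that] in blast)
  define d where "d = e / (4 * (L + 1))"
  have d: "d > 0" "L * d \<le> e / 4" using L0 \<open>e > 0\<close> by (auto simp: d_def field_simps)
  obtain T where T: "T \<subseteq> K" "finite T" "K \<subseteq> (\<Union>t\<in>T. ball t d)"
    using compactE_image[OF assms(1), of K "\<lambda>t. ball t d"] d(1) by (metis centre_in_ball open_ball UN_I subsetI)
  have "\<forall>\<^sub>F k in sequentially. \<forall>t\<in>T. dist (u k t) (v t) < e / 4"
    using T(1,2) \<open>e > 0\<close> by (intro eventually_ball_finite ballI tendstoD[OF lim]) auto
  then show "\<forall>\<^sub>F k in sequentially. \<forall>x\<in>K. dist (u k x) (v x) < e"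
  proof eventually_elim
    case (elim k)
    show ?case
    proof
      fix x assume "x \<in> K"
      then obtain t where t: "t \<in> T" "dist t x < d" using T(3) by auto
      then have "t \<in> K" using T by blast
      have "L * dist t x \<le> L * d" using t L0 by (intro mult_left_mono) auto
      moreover have "dist (u k x) (u k t) \<le> L * dist t x"
        using lipschitz_onD[OF L[of k] \<open>x \<in> K\<close> \<open>t \<in> K\<close>] by (simp add: dist_commute)
      moreover have "dist (v t) (v x) \<le> L * dist t x" by (rule Lv) fact+
      moreover have "dist (u k t) (v t) < e / 4" using elim t by blast
      ultimately show "dist (u k x) (v x) < e"
        using dist_triangle[of "u k x" "v x" "u k t"] dist_triangle[of "u k t" "v x" "v t"] \<open>e > 0\<close> d(2) by linarith
    qed
  qed
qed

section \<open>From Hessian bounds to uniform convergence of the iterates\<close>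

lemma hess_bounds_imp_quadratically_pinched:
  fixes u :: "real^'n \<Rightarrow> real"
  assumes "convex \<Omega>"
    and "\<And>y. y \<in> \<Omega> \<Longrightarrow> u differentiable (at y)" "\<And>y. y \<in> \<Omega> \<Longrightarrow> grad u differentiable (at y)"
    and lo: "\<And>y h. y \<in> \<Omega> \<Longrightarrow> m * (h \<bullet> h) \<le> h \<bullet> (hess u y *v h)"
    and hi: "\<And>y h. y \<in> \<Omega> \<Longrightarrow> h \<bullet> (hess u y *v h) \<le> M * (h \<bullet> h)"
  shows "quadratically_pinched m M \<Omega> u (grad u)"
  unfolding quadratically_pinched_def
proof (intro ballI)
  fix x y assume "x \<in> \<Omega>" "y \<in> \<Omega>"
  then obtain z where z: "z \<in> \<Omega>" "u y = u x + grad u x \<bullet> (y - x) + (y - x) \<bullet> (hess u z *v (y - x)) / 2"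
    using second_order_Taylor[OF assms(1) _ _ assms(2,3)] by blast
  show "m / 2 * (norm (y - x))\<^sup>2 \<le> u y - u x - grad u x \<bullet> (y - x) \<and>
      u y - u x - grad u x \<bullet> (y - x) \<le> M / 2 * (norm (y - x))\<^sup>2"
    using lo[OF z(1), of "y - x"] hi[OF z(1), of "y - x"] unfolding z(2) power2_norm_eq_inner by simp
qed

lemma grad_Lipschitz:
  fixes u :: "real^'n \<Rightarrow> real"
  assumes "convex \<Omega>" "\<And>y. y \<in> \<Omega> \<Longrightarrow> grad u differentiable (at y)"
    and "\<And>y h. y \<in> \<Omega> \<Longrightarrow> norm (hess u y *v h) \<le> M * norm h" and "x \<in> \<Omega>" "y \<in> \<Omega>"
  shows "norm (grad u x - grad u y) \<le> M * norm (x - y)"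
proof (rule differentiable_bound[OF assms(1) _ _ assms(4,5)])
  show "(grad u has_derivative (\<lambda>h. hess u z *v h)) (at z within \<Omega>)" if "z \<in> \<Omega>" for z
    using has_derivative_hess[OF assms(2)[OF that]] by (rule has_derivative_at_withinI)
  show "onorm (\<lambda>h. hess u z *v h) \<le> M" if "z \<in> \<Omega>" for z
    using assms(3)[OF that] by (rule onorm_le)
qed

text \<open>From \<open>x\<close> follow a direction in which the linear part does not increase, up
  to the boundary. On the way \<open>u\<close> gains at most the quadratic term over a distance of
  at most \<open>2 * R\<close>, so \<open>u x\<close> cannot lie far below the boundary
  values.\<close>

lemma lower_bound_by_boundary_values:
  fixes u :: "real^'n \<Rightarrow> real"
  assumes "open \<Omega>" "bounded \<Omega>" and R: "\<And>x. x \<in> \<Omega> \<Longrightarrow> norm x \<le> R" and M: "M \<ge> 0"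
    and u: "quadratically_pinched 0 M \<Omega> u p" and cont: "continuous_on (closure \<Omega>) u"
    and bdry: "\<And>y. y \<in> frontier \<Omega> \<Longrightarrow> c \<le> u y" and x: "x \<in> \<Omega>"
  shows "c - M / 2 * (2 * R)\<^sup>2 \<le> u x"
proof -
  obtain l :: "real^'n" where l: "l \<noteq> 0" "p x \<bullet> l \<le> 0"
  proof (cases "p x = 0")
    case True
    obtain i :: 'n where True by blast
    show ?thesis by (rule that[of "axis i 1"]) (auto simp: True axis_eq_0_iff)
  next
    case False
    then show ?thesis by (intro that[of "- p x"]) auto
  qed
  have "x \<in> interior \<Omega>" using x assms(1) by (simp add: interior_open)
  then obtain d where d: "d > 0" "x + d *\<^sub>R l \<in> frontier \<Omega>" "\<And>e. 0 \<le> e \<Longrightarrow> e < d \<Longrightarrow> x + e *\<^sub>R l \<in> interior \<Omega>"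
    using ray_to_frontier[OF assms(2) _ l(1)] by metis
  have seg: "x + s *\<^sub>R l \<in> \<Omega>" if "0 < s" "s < d" for s
    using d(3)[of s] that interior_subset by auto
  have le: "u (x + s *\<^sub>R l) \<le> u x + M / 2 * (2 * R)\<^sup>2" if s: "s \<in> {0<..<d}" for s
  proof -
    have y: "x + s *\<^sub>R l \<in> \<Omega>" using s seg by auto
    have "norm (x + s *\<^sub>R l - x) \<le> 2 * R"
      using norm_triangle_ineq4[of "x + s *\<^sub>R l" x] R[OF x] R[OF y] by linarith
    then have "M / 2 * (norm (x + s *\<^sub>R l - x))\<^sup>2 \<le> M / 2 * (2 * R)\<^sup>2"
      using M by (intro mult_left_mono power_mono) auto
    moreover have "p x \<bullet> (x + s *\<^sub>R l - x) \<le> 0"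
      using s l(2) by (simp add: mult_nonneg_nonpos)
    ultimately show ?thesis
      using quadratically_pinchedD(2)[OF u x y] by linarith
  qed
  have C: "continuous_on (closure {0<..<d}) (\<lambda>s. u (x + s *\<^sub>R l))"
  proof (rule continuous_on_compose2[OF cont])
    show "(\<lambda>s. x + s *\<^sub>R l) ` closure {0<..<d} \<subseteq> closure \<Omega>"
    proof (rule image_closure_subset)
      show "continuous_on (closure {0<..<d}) (\<lambda>s. x + s *\<^sub>R l)" by (intro continuous_intros)
      show "(\<lambda>s. x + s *\<^sub>R l) ` {0<..<d} \<subseteq> closure \<Omega>" using seg by (auto intro: subsetD[OF closure_subset])
    qed simp
  qed (intro continuous_intros)
  have "d \<in> closure {0<..<d}" using d(1) by simp
  from continuous_le_on_closure[OF C this le]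
  have "u (x + d *\<^sub>R l) \<le> u x + M / 2 * (2 * R)\<^sup>2" .
  then show ?thesis using bdry[OF d(2)] by linarith
qed

text \<open>Gradient bounds from balls around each point degenerate at the boundary. Instead the
  gradient is bounded at the single point \<open>x0\<close>, and the Lipschitz bound for
  \<open>p\<close> spreads this over \<Omega>, where distances are at most
  \<open>2 * R\<close>.\<close>

lemma Lipschitz_on_closure_of_bounded:
  fixes u :: "real^'n \<Rightarrow> real"
  assumes "open \<Omega>" and R: "\<And>x. x \<in> \<Omega> \<Longrightarrow> norm x \<le> R" and M: "M \<ge> 0"
    and u: "quadratically_pinched 0 M \<Omega> u p" and cont: "continuous_on (closure \<Omega>) u"
    and lip: "\<And>x y. x \<in> \<Omega> \<Longrightarrow> y \<in> \<Omega> \<Longrightarrow> norm (p x - p y) \<le> M * norm (x - y)"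
    and bd: "\<And>y. y \<in> \<Omega> \<Longrightarrow> \<bar>u y\<bar> \<le> C" and r: "r > 0" "cball x0 r \<subseteq> \<Omega>"
  shows "(2 * C / r + M * (2 * R))-lipschitz_on (closure \<Omega>) u"
proof (rule lipschitz_on_closure[OF _ cont])
  let ?L = "2 * C / r + M * (2 * R)"
  have "x0 \<in> \<Omega>" using r by auto
  have R0: "R \<ge> 0" using R[OF \<open>x0 \<in> \<Omega>\<close>] norm_ge_zero[of x0] by linarith
  have C0: "C \<ge> 0" using bd[OF \<open>x0 \<in> \<Omega>\<close>] by linarith
  have p0: "norm (p x0) \<le> 2 * C / r"
    by (rule quadratically_pinched_bound_gradient[OF u bd r])
  have pL: "norm (p x) \<le> ?L" if "x \<in> \<Omega>" for x
  proof -
    have "norm (x - x0) \<le> 2 * R"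
      using norm_triangle_ineq4[of x x0] R[OF that] R[OF \<open>x0 \<in> \<Omega>\<close>] by linarith
    then have "M * norm (x - x0) \<le> M * (2 * R)" using M by (rule mult_left_mono)
    then show ?thesis
      using lip[OF that \<open>x0 \<in> \<Omega>\<close>] p0 norm_triangle_sub[of "p x" "p x0"] by linarith
  qed
  have one: "u x - u y \<le> ?L * norm (x - y)" if "x \<in> \<Omega>" "y \<in> \<Omega>" for x y
  proof -
    have "u x - u y \<le> p x \<bullet> (x - y)"
      using quadratically_pinchedD(1)[OF u that] by (simp add: inner_diff_right)
    also have "\<dots> \<le> norm (p x) * norm (x - y)" by (rule norm_cauchy_schwarz)
    also have "\<dots> \<le> ?L * norm (x - y)" using pL[OF that(1)] by (rule mult_right_mono) simp
    finally show ?thesis .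
  qed
  show "?L-lipschitz_on \<Omega> u"
  proof (rule lipschitz_onI)
    show "0 \<le> ?L" using C0 M R0 r by simp
    show "dist (u x) (u y) \<le> ?L * dist x y" if "x \<in> \<Omega>" "y \<in> \<Omega>" for x y
      using one[OF that] one[OF that(2,1)]
      by (simp add: dist_real_def dist_norm norm_minus_commute abs_le_iff)
  qed
qed

text \<open>The decreasing sequence needs only a lower bound to converge pointwise, and the common
  boundary values supply it. The equi-Lipschitz bound then makes the convergence uniform up to the
  boundary.\<close>

lemma monotone_scheme_converges:
  fixes u :: "nat \<Rightarrow> real^'n \<Rightarrow> real"
  assumes "open \<Omega>" "bounded \<Omega>" "\<Omega> \<noteq> {}" and M: "M \<ge> 0" and m: "m \<ge> 0"
    and u: "\<And>k. quadratically_pinched m M \<Omega> (u k) (p k)"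
    and cont: "\<And>k. continuous_on (closure \<Omega>) (u k)"
    and lip: "\<And>k x y. x \<in> \<Omega> \<Longrightarrow> y \<in> \<Omega> \<Longrightarrow> norm (p k x - p k y) \<le> M * norm (x - y)"
    and bdry: "\<And>k y. y \<in> frontier \<Omega> \<Longrightarrow> u k y = \<phi> y"
    and mono: "\<And>k x. x \<in> closure \<Omega> \<Longrightarrow> u (Suc k) x \<le> u k x"
  obtains v q where "uniform_limit (closure \<Omega>) u v sequentially" "continuous_on (closure \<Omega>) v"
    "quadratically_pinched m M \<Omega> v q"
    "\<And>x. x \<in> \<Omega> \<Longrightarrow> (\<lambda>k. p k x) \<longlonglongrightarrow> q x"
proof -
  have u0: "quadratically_pinched 0 M \<Omega> (u k) (p k)" for k
    using u m quadratically_pinched_mono by blast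
  have cpt: "compact (closure \<Omega>)" using assms(2) by (simp add: compact_closure)
  obtain R where R: "\<And>x. x \<in> \<Omega> \<Longrightarrow> norm x \<le> R"
    using assms(2) bounded_iff by metis
  have "bounded (u 0 ` closure \<Omega>)"
    using cpt cont compact_continuous_image compact_imp_bounded by blast
  then obtain C0 where C0: "\<And>x. x \<in> closure \<Omega> \<Longrightarrow> \<bar>u 0 x\<bar> \<le> C0"
    by (auto simp: bounded_iff)
  have upper: "u k x \<le> C0" if "x \<in> closure \<Omega>" for k x
  proof (induction k)
    case 0
    then show ?case using C0[OF that] by linarith
  next
    case (Suc k)
    then show ?case using mono[OF that, of k] by linarith
  qed
  \<comment> \<open>All iterates share the boundary values of \<open>u 0\<close>, so one constant
    serves for every \<open>k\<close>.\<close>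
  have lower_bdry: "- C0 \<le> u k y" if "y \<in> frontier \<Omega>" for k y
  proof -
    have "y \<in> closure \<Omega>" using that by (simp add: frontier_def)
    then show ?thesis using C0[of y] bdry[OF that] by (metis abs_le_iff minus_le_iff)
  qed
  define C where "C = C0 + M / 2 * (2 * R)\<^sup>2"
  have MR: "0 \<le> M / 2 * (2 * R)\<^sup>2" using M by simp
  have bd: "\<bar>u k x\<bar> \<le> C" if "x \<in> \<Omega>" for k x
  proof -
    have "- C0 - M / 2 * (2 * R)\<^sup>2 \<le> u k x"
      by (rule lower_bound_by_boundary_values[OF assms(1,2) R M u0 cont lower_bdry that])
    moreover have "u k x \<le> C0" using upper that closure_subset by blast
    ultimately show ?thesis unfolding C_def using MR by linarith
  qed
  obtain x0 r where r: "r > 0" "cball x0 r \<subseteq> \<Omega>"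
    using assms(1,3) open_contains_cball by blast
  define L where "L = 2 * C / r + M * (2 * R)"
  have L: "L-lipschitz_on (closure \<Omega>) (u k)" for k
    unfolding L_def by (rule Lipschitz_on_closure_of_bounded[OF assms(1) R M u0 cont lip bd r])
  have "\<exists>l. (\<lambda>k. u k x) \<longlonglongrightarrow> l" if x: "x \<in> closure \<Omega>" for x
  proof -
    have "decseq (\<lambda>k. u k x)" using mono[OF x] by (rule decseq_SucI)
    moreover have "- C \<le> u k x" for k
    proof (cases "x \<in> \<Omega>")
      case True
      then show ?thesis using bd[of x k] by linarith
    next
      case False
      then have "x \<in> frontier \<Omega>" using x assms(1) by (simp add: frontier_def interior_open)
      then show ?thesis using lower_bdry[of x k] MR by (simp add: C_def)
    qed
    ultimately show ?thesis by (metis decseq_convergent)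
  qed
  then obtain v where v: "\<And>x. x \<in> closure \<Omega> \<Longrightarrow> (\<lambda>k. u k x) \<longlonglongrightarrow> v x"
    by metis
  have unif: "uniform_limit (closure \<Omega>) u v sequentially"
    by (rule uniform_limit_equi_Lipschitz[OF cpt L v])
  then have "uniform_limit \<Omega> u v sequentially"
    by (rule uniform_limit_on_subset) (rule closure_subset)
  from quadratically_pinched_uniform_limit[OF assms(1) M m u this]
  obtain q where q: "quadratically_pinched m M \<Omega> v q" "\<forall>x\<in>\<Omega>. (\<lambda>k. p k x) \<longlonglongrightarrow> q x"
    by blast
  have "continuous_on (closure \<Omega>) v"
    using cont by (intro uniform_limit_theorem[OF _ unif]) auto
  from that[OF unif this q(1)] q(2) show thesis by blast
qed

text \<open>Inside \<Omega> the support plane at the intermediate point gives the inequality; points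
  of the closure are approximated from inside.\<close>

lemma quadratically_pinched_imp_convex_on_closure:
  fixes u :: "real^'n \<Rightarrow> real"
  assumes u: "quadratically_pinched 0 M \<Omega> u p" and "convex \<Omega>" and cont: "continuous_on (closure \<Omega>) u"
  shows "convex_on (closure \<Omega>) u"
proof (rule convex_onI)
  show "convex (closure \<Omega>)" using assms(2) by (rule convex_closure)
  have inside: "u ((1 - t) *\<^sub>R x + t *\<^sub>R y) \<le> (1 - t) * u x + t * u y"
    if t: "0 < t" "t < 1" and xy: "x \<in> \<Omega>" "y \<in> \<Omega>" for t x y
  proof -
    define z where "z = (1 - t) *\<^sub>R x + t *\<^sub>R y"
    have z: "z \<in> \<Omega>" using assms(2) t xy by (simp add: z_def convexD_alt)
    have "(1 - t) * (u z + p z \<bullet> (x - z)) + t * (u z + p z \<bullet> (y - z)) \<le> (1 - t) * u x + t * u y"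
      using quadratically_pinchedD(1)[OF u z xy(1)] quadratically_pinchedD(1)[OF u z xy(2)] t
      by (intro add_mono mult_left_mono) auto
    moreover have "(1 - t) * (u z + p z \<bullet> (x - z)) + t * (u z + p z \<bullet> (y - z))
        = u z + p z \<bullet> ((1 - t) *\<^sub>R x + t *\<^sub>R y - z)"
      by (simp add: inner_diff_right inner_add_right algebra_simps)
    ultimately show ?thesis by (simp add: z_def)
  qed
  fix t :: real and x y assume t: "0 < t" "t < 1" and xy: "x \<in> closure \<Omega>" "y \<in> closure \<Omega>"
  obtain X Y where X: "\<And>k. X k \<in> \<Omega>" "X \<longlonglongrightarrow> x" and Y: "\<And>k. Y k \<in> \<Omega>" "Y \<longlonglongrightarrow> y"
    using xy by (metis closure_sequential)
  define Z where "Z k = (1 - t) *\<^sub>R X k + t *\<^sub>R Y k" for k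
  have Z: "Z k \<in> \<Omega>" for k using X Y assms(2) t by (simp add: Z_def convexD_alt)
  have limZ: "Z \<longlonglongrightarrow> (1 - t) *\<^sub>R x + t *\<^sub>R y"
    unfolding Z_def by (intro tendsto_intros X Y)
  have lim: "(\<lambda>k. u (W k)) \<longlonglongrightarrow> u w" if "W \<longlonglongrightarrow> w" "\<And>k. W k \<in> \<Omega>" for W w
  proof -
    have "w \<in> closure \<Omega>" using that closure_sequential by blast
    then show ?thesis
      using continuous_on_tendsto_compose[OF cont that(1)] that(2) closure_subset by (metis (mono_tags) always_eventually subsetD)
  qed
  show "u ((1 - t) *\<^sub>R x + t *\<^sub>R y) \<le> (1 - t) * u x + t * u y"
  proof (rule LIMSEQ_le)
    show "(\<lambda>k. u (Z k)) \<longlonglongrightarrow> u ((1 - t) *\<^sub>R x + t *\<^sub>R y)" by (rule lim[OF limZ Z])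
    show "(\<lambda>k. (1 - t) * u (X k) + t * u (Y k)) \<longlonglongrightarrow> (1 - t) * u x + t * u y"
      by (intro tendsto_intros lim X Y)
    show "\<exists>N. \<forall>k\<ge>N. u (Z k) \<le> (1 - t) * u (X k) + t * u (Y k)"
      using inside[OF t X(1) Y(1)] by (auto simp: Z_def)
  qed
qed

text \<open>A Lipschitz gradient is uniformly continuous, which is what extends it to the
  closure.\<close>

lemma quadratically_pinched_imp_C1_1:
  fixes v :: "real^'n \<Rightarrow> real"
  assumes "open \<Omega>" and v: "quadratically_pinched m M \<Omega> v q" and cont: "continuous_on (closure \<Omega>) v"
    and lip: "\<And>x y. x \<in> \<Omega> \<Longrightarrow> y \<in> \<Omega> \<Longrightarrow> norm (q x - q y) \<le> M * norm (x - y)"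
  shows "C1_holder_closure 1 \<Omega> v"
proof -
  have der: "(v has_derivative (\<lambda>h. q x \<bullet> h)) (at x)" if "x \<in> \<Omega>" for x
    by (rule quadratically_pinched_has_derivative[OF v assms(1) that])
  have grad: "grad v x = q x" if "x \<in> \<Omega>" for x
    by (rule grad_eqI[OF der[OF that]])
  have L: "\<bar>M\<bar>-lipschitz_on \<Omega> q"
    using lip by (intro lipschitz_onI) (auto simp: dist_norm intro: order_trans[OF _ mult_right_mono[OF abs_ge_self]])
  then obtain Q where "continuous_on (closure \<Omega>) Q" "\<And>x. x \<in> \<Omega> \<Longrightarrow> Q x = q x"
    using uniformly_continuous_on_extension_on_closure[OF lipschitz_on_uniformly_continuous[OF L]]
      uniformly_continuous_imp_continuous by metis
  then have "extends_to_closure \<Omega> (grad v)"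
    unfolding extends_to_closure_def using grad by metis
  moreover have "holder_on 1 \<Omega> (grad v)"
    unfolding holder_on_def using lip grad by (intro exI[of _ M]) simp
  ultimately show ?thesis
    unfolding C1_holder_closure_def C1_closure_def using cont der by (auto simp: differentiable_def)
qed

subsection \<open>Images under gradients\<close>

text \<open>Minimize \<open>w z - q x \<bullet> z\<close> over the closed ball. Since
  \<open>v\<close> grows quadratically above its tangent plane at \<open>x\<close>, values on the
  sphere exceed the value at the center by at least m r^2 / 2 - 2 \<delta> > 0. Hence a minimizer
  lies in the open ball, and there \<open>P z = q x\<close>.\<close>

lemma gradient_image_covers:
  fixes v :: "real^'n \<Rightarrow> real"
  assumes "open \<Omega>" and v: "quadratically_pinched m M \<Omega> v q" and w: "quadratically_pinched 0 M \<Omega> w P"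
    and close: "\<And>y. y \<in> \<Omega> \<Longrightarrow> \<bar>w y - v y\<bar> \<le> \<delta>" and r: "r > 0" "cball x r \<subseteq> \<Omega>" "4 * \<delta> < m * r\<^sup>2"
  shows "q x \<in> P ` ball x r"
proof -
  have x: "x \<in> \<Omega>" using r by auto
  define h where "h z = w z - q x \<bullet> z" for z
  have der: "(h has_derivative (\<lambda>k. P z \<bullet> k - q x \<bullet> k)) (at z)" if "z \<in> \<Omega>" for z
    unfolding h_def
    by (rule has_derivative_diff[OF quadratically_pinched_has_derivative[OF w assms(1) that]
          bounded_linear_imp_has_derivative[OF bounded_linear_inner_right]])
  have "continuous_on (cball x r) h"
  proof (rule has_derivative_continuous_on)
    fix z assume "z \<in> cball x r"
    then have "z \<in> \<Omega>" using r(2) by blast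
    then show "(h has_derivative (\<lambda>k. P z \<bullet> k - q x \<bullet> k)) (at z within cball x r)"
      by (rule has_derivative_at_withinI[OF der])
  qed
  moreover have "cball x r \<noteq> {}" using r by auto
  ultimately obtain z where z: "z \<in> cball x r" "\<forall>y\<in>cball x r. h z \<le> h y"
    using continuous_attains_inf[OF compact_cball] by metis
  have z\<Omega>: "z \<in> \<Omega>" using z r by blast
  have "norm (z - x) \<noteq> r"
  proof
    assume n: "norm (z - x) = r"
    have "m / 2 * r\<^sup>2 \<le> v z - v x - q x \<bullet> (z - x)"
      using quadratically_pinchedD(1)[OF v x z\<Omega>] n by simp
    moreover have "h z \<le> h x" using z r by auto
    moreover have "q x \<bullet> (z - x) = q x \<bullet> z - q x \<bullet> x" by (rule inner_diff_right)
    ultimately show False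
      using close[OF x] close[OF z\<Omega>] r(3) unfolding h_def abs_le_iff by linarith
  qed
  then have zb: "z \<in> ball x r"
    using z(1) by (simp add: dist_norm norm_minus_commute)
  have "(\<lambda>k. P z \<bullet> k - q x \<bullet> k) = (\<lambda>k. 0)"
  proof (rule differential_zero_maxmin[OF zb open_ball der[OF z\<Omega>]])
    show "(\<forall>y\<in>ball x r. h y \<le> h z) \<or> (\<forall>y\<in>ball x r. h z \<le> h y)"
      using z(2) by auto
  qed
  then have "(P z - q x) \<bullet> (P z - q x) = 0" by (metis inner_diff_left)
  then have "q x = P z" by simp
  with zb show ?thesis by blast
qed

text \<open>From above: by outer regularity the image under \<open>q\<close> has an open
  neighbourhood of nearly the same measure, and uniformly close gradients stay in it. From below: by
  inner regularity a compact part of the image of the open box has nearly full measure, and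
  \<open>gradient_image_covers\<close> shows that it is eventually covered.\<close>

lemma measure_gradient_image_tendsto:
  fixes v :: "real^'n \<Rightarrow> real"
  assumes "open \<Omega>" and m: "m > 0" and M: "M \<ge> 0"
    and v: "quadratically_pinched m M \<Omega> v q" and w: "\<And>k. quadratically_pinched 0 M \<Omega> (w k) (P k)"
    and lim: "uniform_limit \<Omega> w v sequentially"
    and P: "\<And>k. continuous_on \<Omega> (P k)"
    and lip: "\<And>x y. x \<in> \<Omega> \<Longrightarrow> y \<in> \<Omega> \<Longrightarrow> norm (q x - q y) \<le> M * norm (x - y)"
    and K: "cbox a b \<subseteq> \<Omega>"
  shows "(\<lambda>k. measure lebesgue (P k ` cbox a b)) \<longlonglongrightarrow> measure lebesgue (q ` cbox a b)"
proof -
  let ?K = "cbox a b"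
  have v0: "quadratically_pinched 0 M \<Omega> v q"
    using v m by (intro quadratically_pinched_mono[OF v]) simp
  have inj: "inj_on q \<Omega>" by (rule quadratically_pinched_inj_on[OF v m])
  have Lq: "M-lipschitz_on \<Omega> q"
    using lip M by (intro lipschitz_onI) (auto simp: dist_norm)
  have contq: "continuous_on \<Omega> q" by (rule lipschitz_on_continuous_on[OF Lq])
  have cq: "compact (q ` ?K)"
    by (rule compact_continuous_image[OF continuous_on_subset[OF contq K] compact_cbox])
  have cP: "compact (P k ` ?K)" for k
    by (rule compact_continuous_image[OF continuous_on_subset[OF P K] compact_cbox])
  have meas: "q ` ?K \<in> lmeasurable" "P k ` ?K \<in> lmeasurable" for k
    using cq cP by (auto intro: lmeasurable_compact)
  have unif: "uniform_limit ?K P q sequentially"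
    by (rule gradients_uniform_limit_on_compact[OF assms(1) M w v0 lim compact_cbox K])
  have upper: "\<forall>\<^sub>F k in sequentially. measure lebesgue (P k ` ?K) \<le> measure lebesgue (q ` ?K) + e" if "e > 0" for e
  proof -
    obtain T where T: "open T" "q ` ?K \<subseteq> T" "T - q ` ?K \<in> lmeasurable" "emeasure lebesgue (T - q ` ?K) < ennreal e"
      using sets_lebesgue_outer_open[OF fmeasurableD[OF meas(1)] \<open>e > 0\<close>] by metis
    have e: "measure lebesgue (T - q ` ?K) < e"
      using T(3,4) by (simp add: emeasure_eq_measure2 ennreal_less_iff)
    have Teq: "T = q ` ?K \<union> (T - q ` ?K)" using T(2) by blast
    have TL: "T \<in> lmeasurable" by (subst Teq, rule fmeasurable.Un[OF meas(1) T(3)])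
    have mT: "measure lebesgue T \<le> measure lebesgue (q ` ?K) + measure lebesgue (T - q ` ?K)"
      by (subst Teq, rule measure_Un_le) (use meas T(3) in auto)
    obtain \<rho> where \<rho>: "\<rho> > 0" "(\<Union>y\<in>q ` ?K. ball y \<rho>) \<subseteq> T"
      using compact_subset_open_imp_ball_epsilon_subset[OF cq T(1,2)] by blast
    have "\<forall>\<^sub>F k in sequentially. \<forall>x\<in>?K. dist (P k x) (q x) < \<rho>"
      using unif \<rho>(1) unfolding uniform_limit_iff by blast
    then show ?thesis
    proof eventually_elim
      case (elim k)
      have "P k ` ?K \<subseteq> T"
      proof
        fix y assume "y \<in> P k ` ?K"
        then obtain x where "x \<in> ?K" "y = P k x" by blast
        then have "y \<in> ball (q x) \<rho>" using elim by (simp add: dist_commute)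
        then show "y \<in> T" using \<rho>(2) \<open>x \<in> ?K\<close> by blast
      qed
      then have "measure lebesgue (P k ` ?K) \<le> measure lebesgue T"
        using meas TL by (intro measure_mono_fmeasurable) auto
      then show ?case using mT e by linarith
    qed
  qed
  have lower: "\<forall>\<^sub>F k in sequentially. measure lebesgue (q ` ?K) - e \<le> measure lebesgue (P k ` ?K)" if "e > 0" for e
  proof -
    have boxK: "box a b \<subseteq> ?K" by (rule box_subset_cbox)
    \<comment> \<open>A Lipschitz map sends the negligible boundary of the box to a negligible set,
      so the image of the open box has full measure.\<close>
    have neg: "negligible (q ` (?K - box a b))"
    proof (rule negligible_locally_Lipschitz_image[OF _ negligible_frontier_interval])
      fix x assume x: "x \<in> ?K - box a b"
      show "\<exists>T B. open T \<and> x \<in> T \<and> (\<forall>y\<in>(?K - box a b) \<inter> T. norm (q y - q x) \<le> B * norm (y - x))"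
        using lip K x by (intro exI[of _ UNIV] exI[of _ M]) auto
    qed simp
    have eqbox: "q ` box a b = q ` ?K - q ` (?K - box a b)"
      using inj K boxK by (auto simp: inj_on_def)
    have boxL: "q ` box a b \<in> lmeasurable"
      unfolding eqbox using meas(1) neg negligible_imp_measurable by (intro fmeasurable.Diff) auto
    have mbox: "measure lebesgue (q ` box a b) = measure lebesgue (q ` ?K)"
    proof -
      have "q ` ?K = q ` box a b \<union> q ` (?K - box a b)" using boxK by auto
      then show ?thesis
        using measure_Un_null_set[of "q ` box a b" lebesgue "q ` (?K - box a b)"] boxL neg
        by (simp add: negligible_iff_null_sets fmeasurableD)
    qed
    obtain T where T: "closed T" "T \<subseteq> q ` box a b" "q ` box a b - T \<in> lmeasurable" "emeasure lebesgue (q ` box a b - T) < ennreal e"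
      using sets_lebesgue_inner_closed[OF fmeasurableD[OF boxL] \<open>e > 0\<close>] by metis
    have e: "measure lebesgue (q ` box a b - T) < e"
      using T(3,4) by (simp add: emeasure_eq_measure2 ennreal_less_iff)
    have TK: "T \<subseteq> q ` ?K" using T(2) boxK by blast
    have cT: "compact T" using cq TK T(1) by (metis closed_Int_compact inf.absorb1)
    then have TL: "T \<in> lmeasurable" by (rule lmeasurable_compact)
    have "measure lebesgue (T \<union> (q ` box a b - T)) \<le> measure lebesgue T + measure lebesgue (q ` box a b - T)"
      by (rule measure_Un_le) (use TL T(3) in auto)
    moreover have "T \<union> (q ` box a b - T) = q ` box a b" using T(2) by blast
    ultimately have mT: "measure lebesgue (q ` ?K) - e \<le> measure lebesgue T"
      using e mbox by simp
    \<comment> \<open>By injectivity of \<open>q\<close> this compact preimage of \<open>T\<close>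
      lies in the open box, so it keeps a positive distance from the boundary; one radius then
      serves for all covering balls.\<close>
    define C where "C = ?K \<inter> q -` T"
    have "closed C"
      unfolding C_def by (rule continuous_closed_preimage[OF continuous_on_subset[OF contq K] closed_cbox T(1)])
    then have cC: "compact C"
      by (metis C_def closed_Int_compact compact_cbox inf.commute inf_left_idem)
    have Cbox: "C \<subseteq> box a b"
    proof
      fix x assume "x \<in> C"
      then obtain y where "y \<in> box a b" "q x = q y" "x \<in> ?K" using T(2) by (auto simp: C_def)
      then show "x \<in> box a b" using inj K boxK by (metis inj_onD subsetD)
    qed
    obtain r0 where r0: "r0 > 0" "(\<Union>x\<in>C. ball x r0) \<subseteq> box a b"
      using compact_subset_open_imp_ball_epsilon_subset[OF cC open_box Cbox] by blast
    define r where "r = r0 / 2"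
    have r: "r > 0" "cball x r \<subseteq> ?K" if "x \<in> C" for x
    proof -
      show "r > 0" using r0 by (simp add: r_def)
      have "cball x r \<subseteq> ball x r0" using r0(1) by (auto simp: r_def)
      then show "cball x r \<subseteq> ?K" using r0(2) that boxK by blast
    qed
    have r_pos: "r > 0" using r0 by (simp add: r_def)
    \<comment> \<open>Any positive value below \<open>m * r\<^sup>2 / 4\<close> would do.\<close>
    define \<delta> where "\<delta> = m * r\<^sup>2 / 8"
    have "\<delta> > 0" using m r_pos by (simp add: \<delta>_def)
    then have "\<forall>\<^sub>F k in sequentially. \<forall>y\<in>\<Omega>. dist (w k y) (v y) < \<delta>"
      using lim unfolding uniform_limit_iff by blast
    then show ?thesis
    proof eventually_elim
      case (elim k)
      have "T \<subseteq> P k ` ?K"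
      proof
        fix y assume "y \<in> T"
        then obtain x where x: "x \<in> ?K" "y = q x" using TK by blast
        then have "x \<in> C" using \<open>y \<in> T\<close> by (simp add: C_def)
        have "q x \<in> P k ` ball x r"
        proof (rule gradient_image_covers[OF assms(1) v w _ r_pos])
          show "\<bar>w k y - v y\<bar> \<le> \<delta>" if "y \<in> \<Omega>" for y
            using elim that by (auto simp: dist_real_def intro: less_imp_le)
          show "cball x r \<subseteq> \<Omega>" using r(2)[OF \<open>x \<in> C\<close>] K by blast
          show "4 * \<delta> < m * r\<^sup>2" using m r_pos by (simp add: \<delta>_def)
        qed
        then show "y \<in> P k ` ?K" using x r(2)[OF \<open>x \<in> C\<close>] ball_subset_cball by blast
      qed
      then have "measure lebesgue T \<le> measure lebesgue (P k ` ?K)"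
        using meas TL by (intro measure_mono_fmeasurable) auto
      then show ?case using mT by linarith
    qed
  qed
  show ?thesis
  proof (rule tendstoI)
    fix e :: real assume "e > 0"
    then have "e / 2 > 0" by simp
    from upper[OF this] lower[OF this]
    show "\<forall>\<^sub>F k in sequentially. dist (measure lebesgue (P k ` ?K)) (measure lebesgue (q ` ?K)) < e"
      by eventually_elim (use \<open>e > 0\<close> in \<open>simp add: dist_real_def abs_less_iff\<close>)
  qed
qed

section \<open>Determining the image measure by closed boxes\<close>

lemma sigma_sets_cboxes_in_open:
  fixes \<Omega> :: "'a::euclidean_space set"
  assumes "open \<Omega>"
  shows "sets (restrict_space borel \<Omega>) = sigma_sets \<Omega> {X. X \<subseteq> \<Omega> \<and> (\<exists>a b. X = cbox a b)}"
    (is "_ = sigma_sets \<Omega> ?E")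
proof
  interpret S: sigma_algebra \<Omega> "sigma_sets \<Omega> ?E"
    by (rule sigma_algebra_sigma_sets) auto
  \<comment> \<open>Borel sets of the whole space are traced on \<Omega> along their generation from
    open sets; an open subset of \<Omega> is a countable union of closed boxes.\<close>
  have "X \<inter> \<Omega> \<in> sigma_sets \<Omega> ?E" if "X \<in> sigma_sets UNIV {S. open S}" for X
    using that
  proof induction
    case (Basic X)
    then have "open (X \<inter> \<Omega>)" using assms by auto
    then obtain \<D> where D: "countable \<D>" "\<D> \<subseteq> Pow (X \<inter> \<Omega>)" "\<And>Y. Y \<in> \<D> \<Longrightarrow> \<exists>a b. Y = cbox a b" "\<Union>\<D> = X \<inter> \<Omega>"
      by (rule open_countable_Union_open_cbox) blast
    have "\<Union>\<D> \<in> sigma_sets \<Omega> ?E"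
      using D by (intro S.countable_Union) (auto intro!: sigma_sets.Basic)
    then show ?case by (simp add: D)
  next
    case (Compl X)
    have "(UNIV - X) \<inter> \<Omega> = \<Omega> - X \<inter> \<Omega>" by blast
    then show ?case using Compl by (simp add: sigma_sets.Compl)
  next
    case (Union A)
    have "(\<Union>i. A i) \<inter> \<Omega> = (\<Union>i. A i \<inter> \<Omega>)" by blast
    then show ?case using Union.IH by (simp only: sigma_sets.Union)
  qed (simp add: sigma_sets.Empty)
  then show "sets (restrict_space borel \<Omega>) \<subseteq> sigma_sets \<Omega> ?E"
    by (auto simp: sets_restrict_space borel_def Int_commute)
  show "sigma_sets \<Omega> ?E \<subseteq> sets (restrict_space borel \<Omega>)"
  proof -
    have "?E \<subseteq> sets (restrict_space borel \<Omega>)"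
      using assms by (auto simp: sets_restrict_space_iff)
    then show ?thesis
      using sets.sigma_sets_subset[of ?E "restrict_space borel \<Omega>"] by (simp add: space_restrict_space)
  qed
qed

text \<open>By invariance of domain \<open>q\<close> is a homeomorphism onto an open set. Taking the
  Lebesgue measure of images is thus the push-forward of Lebesgue measure under the inverse
  \<open>g\<close>, in particular a measure, and it is compared with the density \<open>f\<close> on
  the intersection-stable generator of closed boxes inside \<Omega>.\<close>

lemma image_measure_eq_if_eq_on_cboxes:
  fixes q :: "real^'n \<Rightarrow> real^'n"
  assumes "open \<Omega>" "continuous_on \<Omega> q" "inj_on q \<Omega>"
    and f: "continuous_on \<Omega> f" "\<And>x. x \<in> \<Omega> \<Longrightarrow> 0 \<le> f x"
    and boxes: "\<And>a b. cbox a b \<subseteq> \<Omega> \<Longrightarrow> measure lebesgue (q ` cbox a b) = integral (cbox a b) f"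
    and E: "E \<in> sets borel" "E \<subseteq> \<Omega>"
  shows "q ` E \<in> sets lebesgue" "emeasure lebesgue (q ` E) = (\<integral>\<^sup>+x\<in>E. ennreal (f x) \<partial>lborel)"
proof -
  obtain g where g: "homeomorphism \<Omega> (q ` \<Omega>) q g"
    using invariance_of_domain_homeomorphism[OF assms(1,2) _ assms(3)] by auto
  have contg: "continuous_on (q ` \<Omega>) g" and gq: "\<And>x. x \<in> \<Omega> \<Longrightarrow> g (q x) = x"
    using g by (auto simp: homeomorphism_def)
  have openq: "open (q ` \<Omega>)" by (rule invariance_of_domain[OF assms(2,1,3)])
  have pre: "g -` A \<inter> q ` \<Omega> = q ` A" if "A \<subseteq> \<Omega>" for A
    using that gq by (auto simp: subset_iff)
  have gm: "g \<in> restrict_space borel (q ` \<Omega>) \<rightarrow>\<^sub>M restrict_space borel \<Omega>"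
    using gq by (intro measurable_restrict_space2 borel_measurable_continuous_on_restrict contg)
      (auto simp: space_restrict_space)
  have borel: "q ` A \<in> sets borel" if "A \<in> sets borel" "A \<subseteq> \<Omega>" for A
  proof -
    have "g -` A \<inter> space (restrict_space borel (q ` \<Omega>)) \<in> sets (restrict_space borel (q ` \<Omega>))"
      using that assms(1) by (intro measurable_sets[OF gm]) (auto simp: sets_restrict_space_iff)
    then show ?thesis
      using openq pre[OF that(2)] by (simp add: space_restrict_space sets_restrict_space_iff)
  qed
  define N where "N = distr (restrict_space lborel (q ` \<Omega>)) (restrict_space borel \<Omega>) g"
  define D where "D = density (restrict_space lborel \<Omega>) (\<lambda>x. ennreal (f x))"
  have sets_eq: "sets (restrict_space lborel A) = sets (restrict_space borel A)" for A :: "(real^'n) set"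
    by (simp add: sets_restrict_space)
  have emN: "emeasure N A = emeasure lborel (q ` A)" if "A \<in> sets borel" "A \<subseteq> \<Omega>" for A
  proof -
    have gm': "g \<in> restrict_space lborel (q ` \<Omega>) \<rightarrow>\<^sub>M restrict_space borel \<Omega>"
      using gm by (simp cong: measurable_cong_sets add: sets_eq)
    have "emeasure N A = emeasure (restrict_space lborel (q ` \<Omega>)) (g -` A \<inter> q ` \<Omega>)"
      unfolding N_def using that assms(1)
      by (subst emeasure_distr[OF gm']) (auto simp: sets_restrict_space_iff space_restrict_space)
    also have "\<dots> = emeasure lborel (q ` A)"
      using openq pre[OF that(2)] that(2) by (subst emeasure_restrict_space) auto
    finally show ?thesis .
  qed
  have emD: "emeasure D A = (\<integral>\<^sup>+x\<in>A. ennreal (f x) \<partial>lborel)" if "A \<in> sets borel" "A \<subseteq> \<Omega>" for A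
  proof -
    have fm: "(\<lambda>x. ennreal (f x)) \<in> borel_measurable (restrict_space lborel \<Omega>)"
      using borel_measurable_continuous_on_restrict[OF f(1)]
      by (simp cong: measurable_cong_sets add: sets_eq)
    have "emeasure D A = (\<integral>\<^sup>+x. ennreal (f x) * indicator A x \<partial>restrict_space lborel \<Omega>)"
      unfolding D_def using that assms(1)
      by (intro emeasure_density fm) (auto simp: sets_restrict_space_iff)
    also have "\<dots> = (\<integral>\<^sup>+x. ennreal (f x) * indicator A x * indicator \<Omega> x \<partial>lborel)"
      using assms(1) by (intro nn_integral_restrict_space) auto
    also have "\<dots> = (\<integral>\<^sup>+x\<in>A. ennreal (f x) \<partial>lborel)"
      using that(2) by (intro nn_integral_cong) (auto split: split_indicator)
    finally show ?thesis .
  qed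
  have box_D: "emeasure D (cbox a b) = ennreal (integral (cbox a b) f)" if "cbox a b \<subseteq> \<Omega>" for a b
  proof -
    have "(f has_integral integral (cbox a b) f) (cbox a b)"
      using f(1) that by (intro integrable_integral integrable_continuous) (rule continuous_on_subset)
    then have "(\<integral>\<^sup>+x. ennreal (f x) * indicator (cbox a b) x \<partial>lborel) = ennreal (integral (cbox a b) f)"
      using f(2) that by (intro nn_integral_has_integral_lebesgue') auto
    then show ?thesis using emD[of "cbox a b"] that by simp
  qed
  have "D = N"
  proof -
    \<comment> \<open>Countably many boxes of finite measure exhaust \<Omega>; uniqueness of
      measures needs such a cover by generators.\<close>
    obtain \<D> where \<D>: "countable \<D>" "\<D> \<subseteq> Pow \<Omega>" "\<And>Y. Y \<in> \<D> \<Longrightarrow> \<exists>a b. Y = cbox a b" "\<Union>\<D> = \<Omega>"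
      using open_countable_Union_open_cbox[OF assms(1)] by metis
    show ?thesis
    proof (rule measure_eqI_generator_eq_countable)
      let ?E = "{X. X \<subseteq> \<Omega> \<and> (\<exists>a b. X = cbox a b)}"
      show "Int_stable ?E"
      proof (rule Int_stableI)
        fix X Y assume "X \<in> ?E" "Y \<in> ?E"
        then show "X \<inter> Y \<in> ?E" by (auto simp: Int_interval) blast
      qed
      show "?E \<subseteq> Pow \<Omega>" by auto
      show "sets D = sigma_sets \<Omega> ?E" "sets N = sigma_sets \<Omega> ?E"
        using sigma_sets_cboxes_in_open[OF assms(1)] by (auto simp: D_def N_def sets_eq)
      show "\<D> \<subseteq> ?E" "\<Union>\<D> = \<Omega>" "countable \<D>" using \<D> by auto
      show "emeasure D X = emeasure N X" if X: "X \<in> ?E" for X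
      proof -
        obtain a b where ab: "X = cbox a b" "cbox a b \<subseteq> \<Omega>" using X by auto
        have c: "compact (q ` cbox a b)"
          by (rule compact_continuous_image[OF continuous_on_subset[OF assms(2) ab(2)] compact_cbox])
        have "emeasure N X = emeasure lborel (q ` cbox a b)" using emN ab by simp
        also have "\<dots> = emeasure lebesgue (q ` cbox a b)" using c by (simp add: borel_compact)
        also have "\<dots> = ennreal (measure lebesgue (q ` cbox a b))"
          using lmeasurable_compact[OF c] by (rule emeasure_eq_measure2)
        finally show ?thesis using boxes[OF ab(2)] box_D[OF ab(2)] ab by simp
      qed
      show "emeasure D X \<noteq> \<infinity>" if X: "X \<in> \<D>" for X
      proof -
        obtain a b where ab: "X = cbox a b" "cbox a b \<subseteq> \<Omega>" using \<D>(2) \<D>(3)[OF X] X by blast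
        then show ?thesis using box_D by simp
      qed
    qed
  qed
  then have "emeasure lborel (q ` E) = (\<integral>\<^sup>+x\<in>E. ennreal (f x) \<partial>lborel)"
    using emN[OF E] emD[OF E] by simp
  moreover have "emeasure lebesgue (q ` E) = emeasure lborel (q ` E)"
    using borel[OF E] by simp
  ultimately show "emeasure lebesgue (q ` E) = (\<integral>\<^sup>+x\<in>E. ennreal (f x) \<partial>lborel)" by simp
  show "q ` E \<in> sets lebesgue" using borel[OF E] by simp
qed

subsection \<open>Passage to the limit in the determinants\<close>

text \<open>Used with s^n = f / g, where g is the determinant of an iterate: it bounds f - g by a
  multiple of the AM--GM defect n g (s - 1).\<close>

lemma power_minus_one_le:
  fixes s :: real
  assumes "s \<ge> 1"
  shows "s ^ n - 1 \<le> n * s ^ n * (s - 1)"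
proof (induction n)
  case (Suc n)
  have "s * (s ^ n - 1) \<le> s * (n * s ^ n * (s - 1))"
    using Suc assms by (intro mult_left_mono) auto
  moreover have "1 * (s - 1) \<le> s ^ Suc n * (s - 1)"
    using assms by (intro mult_right_mono one_le_power) auto
  ultimately show ?case by (simp add: algebra_simps)
qed simp

lemma continuous_on_det:
  fixes A :: "'a::topological_space \<Rightarrow> real^'n^'n"
  assumes "continuous_on S A"
  shows "continuous_on S (\<lambda>x. det (A x))"
  unfolding det_def by (intro continuous_intros assms)

lemma spd_imp_det_pos:
  assumes "spd P"
  shows "det P > 0"
  using spd_pair_invariants[OF assms, of P] assms unfolding spd_def by metis

lemma trace_scaleR_matrix_inv_mult:
  fixes P Q :: "real^'n^'n"
  shows "trace ((c *\<^sub>R matrix_inv P) ** Q) = c * trace (matrix_inv P ** Q)"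
  by (simp add: trace_def sum_distrib_left flip: scalar_matrix_assoc)

text \<open>The linear term in \<open>t\<close> of \<open>det ((1 - t) *\<^sub>R A k x + t *\<^sub>R A (Suc k) x)\<close> is the AM--GM defect.
  Its integral tends to \<open>0\<close> because the Monge--Ampere measures of all convex combinations of \<open>U k\<close> and
  \<open>U (Suc k)\<close> have the same limit.\<close>

lemma measure_limit_gradient_image:
  fixes U :: "nat \<Rightarrow> real^'n \<Rightarrow> real" and A :: "nat \<Rightarrow> real^'n \<Rightarrow> real^'n^'n"
  assumes "open \<Omega>" and \<epsilon>: "\<epsilon> > 0" and M: "M \<ge> 0"
    and U: "\<And>k. quadratically_pinched \<epsilon> M \<Omega> (U k) (p k)"
    and der: "\<And>k x. x \<in> \<Omega> \<Longrightarrow> (p k has_derivative (\<lambda>h. A k x *v h)) (at x)"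
    and contA: "\<And>k. continuous_on \<Omega> (A k)"
    and sym: "\<And>k x. x \<in> \<Omega> \<Longrightarrow> transpose (A k x) = A k x"
    and lo: "\<And>k x h. x \<in> \<Omega> \<Longrightarrow> \<epsilon> * (h \<bullet> h) \<le> h \<bullet> (A k x *v h)"
    and hi: "\<And>k x h. x \<in> \<Omega> \<Longrightarrow> h \<bullet> (A k x *v h) \<le> M * (h \<bullet> h)"
    and det: "\<And>k x. x \<in> \<Omega> \<Longrightarrow> \<epsilon> ^ CARD('n) \<le> det (A k x)" "\<And>k x. x \<in> \<Omega> \<Longrightarrow> det (A k x) \<le> f x"
    and F: "\<And>x. x \<in> \<Omega> \<Longrightarrow> f x \<le> F" and contf: "continuous_on \<Omega> f"
    and tr: "\<And>k x. x \<in> \<Omega> \<Longrightarrow> trace (matrix_inv (A k x) ** A (Suc k) x)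
        = CARD('n) * (f x / det (A k x)) powr (1 / CARD('n))"
    and lim: "uniform_limit \<Omega> U v sequentially"
    and v: "quadratically_pinched \<epsilon> M \<Omega> v q"
    and lip: "\<And>x y. x \<in> \<Omega> \<Longrightarrow> y \<in> \<Omega> \<Longrightarrow> norm (q x - q y) \<le> M * norm (x - y)"
    and K: "cbox a b \<subseteq> \<Omega>"
  shows "measure lebesgue (q ` cbox a b) = integral (cbox a b) f"
proof -
  let ?K = "cbox a b" and ?n = "real CARD('n)"
  define g where "g k x = det (A k x)" for k x
  \<comment> \<open>The derivative of \<open>det (B t k x)\<close> at \<open>t = 0\<close>, with the
    trace replaced by its prescribed value.\<close>
  define h where "h k x = g k x * (?n * (f x / g k x) powr (1 / ?n) - ?n)" for k x
  define B where "B t k x = (1 - t) *\<^sub>R A k x + t *\<^sub>R A (Suc k) x" for t k x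
  define Q where "Q t k x = (1 - t) *\<^sub>R p k x + t *\<^sub>R p (Suc k) x" for t k x
  define W where "W t k x = (1 - t) * U k x + t * U (Suc k) x" for t k x
  define c where "c = measure lborel ?K"
  have gpos: "g k x > 0" if "x \<in> \<Omega>" for k x
    using det(1)[OF that, of k] \<epsilon> unfolding g_def by (meson less_le_trans zero_less_power)
  have cont_g: "continuous_on ?K (g k)" for k
    unfolding g_def by (rule continuous_on_det[OF continuous_on_subset[OF contA K]])
  have cont_f: "continuous_on ?K f" by (rule continuous_on_subset[OF contf K])
  have fpos: "f x > 0" if "x \<in> \<Omega>" for x
    using gpos[OF that, of 0] det(2)[OF that, of 0] by (simp add: g_def)
  have cont_h: "continuous_on ?K (h k)" for k
  proof -
    have "\<forall>x\<in>?K. g k x \<noteq> 0" "\<forall>x\<in>?K. f x / g k x \<noteq> 0"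
      using gpos fpos K by (auto simp: less_imp_neq[symmetric] dest!: subsetD[OF K])
    then show ?thesis
      unfolding h_def by (intro continuous_intros cont_f cont_g)
  qed
  have cont_B: "continuous_on ?K (B t k)" for t k
    unfolding B_def by (intro continuous_intros continuous_on_subset[OF contA K])
  have int: "g k integrable_on ?K" "f integrable_on ?K" "h k integrable_on ?K" "(\<lambda>x. det (B t k x)) integrable_on ?K" for k t
    by (intro integrable_continuous cont_g cont_f cont_h continuous_on_det[OF cont_B])+
  have pinW: "quadratically_pinched \<epsilon> M \<Omega> (W t k) (Q t k)" if "0 \<le> t" "t \<le> 1" for t k
    unfolding W_def Q_def by (rule quadratically_pinched_convex_combination[OF U U that])
  have meas: "measure lebesgue (Q t k ` ?K) = integral ?K (\<lambda>x. det (B t k x))" if t: "0 \<le> t" "t \<le> 1" for t k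
  proof -
    have detB: "det (B t k x) > 0" if x: "x \<in> \<Omega>" for x
    proof (rule spd_imp_det_pos, rule quadratic_form_bound_imp_spd[OF _ \<epsilon>])
      show "transpose (B t k x) = B t k x"
        using sym[OF x, of k] sym[OF x, of "Suc k"] by (simp add: B_def transpose_def vec_eq_iff)
      fix y
      have "(1 - t) * (\<epsilon> * (y \<bullet> y)) + t * (\<epsilon> * (y \<bullet> y)) \<le> (1 - t) * (y \<bullet> (A k x *v y)) + t * (y \<bullet> (A (Suc k) x *v y))"
        using t lo[OF x] by (intro add_mono mult_left_mono) auto
      then show "\<epsilon> * (y \<bullet> y) \<le> y \<bullet> (B t k x *v y)"
        by (simp add: B_def matrix_vector_mult_add_rdistrib inner_add_right scaleR_matrix_vector_assoc[symmetric] algebra_simps)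
    qed
    have "measure lebesgue (Q t k ` ?K) = integral ?K (\<lambda>x. \<bar>det (B t k x)\<bar>)"
    proof (rule measure_image_eq_integral_det)
      show "inj_on (Q t k) ?K"
        by (rule inj_on_subset[OF quadratically_pinched_inj_on[OF pinW[OF t] \<epsilon>] K])
      show "(\<lambda>x. \<bar>det (B t k x)\<bar>) integrable_on ?K"
        by (intro integrable_continuous continuous_intros continuous_on_det[OF cont_B])
      fix x assume "x \<in> ?K"
      then have x: "x \<in> \<Omega>" using K by blast
      have "(Q t k has_derivative (\<lambda>h. (1 - t) *\<^sub>R (A k x *v h) + t *\<^sub>R (A (Suc k) x *v h))) (at x)"
        unfolding Q_def by (intro derivative_intros der[OF x])
      then have "(Q t k has_derivative (\<lambda>h. B t k x *v h)) (at x)"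
        by (simp add: B_def matrix_vector_mult_add_rdistrib scaleR_matrix_vector_assoc)
      then show "(Q t k has_derivative (\<lambda>h. B t k x *v h)) (at x within ?K)"
        by (rule has_derivative_at_withinI)
    qed
    also have "\<dots> = integral ?K (\<lambda>x. det (B t k x))"
      using detB K by (intro integral_cong) (auto simp: abs_of_pos)
    finally show ?thesis .
  qed
  have conv: "(\<lambda>k. integral ?K (\<lambda>x. det (B t k x))) \<longlonglongrightarrow> measure lebesgue (q ` ?K)" if t: "0 \<le> t" "t \<le> 1" for t
  proof -
    have lim': "uniform_limit \<Omega> (\<lambda>k. U (Suc k)) v sequentially"
      using lim by (rule filterlim_compose[OF _ filterlim_Suc])
    have "uniform_limit \<Omega> (\<lambda>k x. (1 - t) * U k x + t * U (Suc k) x) (\<lambda>x. (1 - t) * v x + t * v x) sequentially"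
      by (intro uniform_limit_add bounded_linear.uniform_limit[OF bounded_linear_mult_right] lim lim')
    then have limW: "uniform_limit \<Omega> (W t) v sequentially"
      by (simp add: W_def[abs_def] algebra_simps)
    have contQ: "continuous_on \<Omega> (Q t k)" for k
    proof -
      have "continuous_on \<Omega> (p j)" for j
        by (rule has_derivative_continuous_on[OF has_derivative_at_withinI[OF der]])
      then show ?thesis unfolding Q_def by (intro continuous_intros)
    qed
    have pinW0: "quadratically_pinched 0 M \<Omega> (W t k) (Q t k)" for k
      by (rule quadratically_pinched_mono[OF pinW[OF t]]) (use \<epsilon> in simp)
    have "(\<lambda>k. measure lebesgue (Q t k ` ?K)) \<longlonglongrightarrow> measure lebesgue (q ` ?K)"
      by (rule measure_gradient_image_tendsto[OF assms(1) \<epsilon> M v pinW0 limW contQ lip K])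
    then show ?thesis by (simp add: meas[OF t])
  qed
  have conv_g: "(\<lambda>k. integral ?K (g k)) \<longlonglongrightarrow> measure lebesgue (q ` ?K)"
    using conv[of 0] by (simp add: B_def g_def[abs_def])
  obtain C where C: "C \<ge> 0" and expand: "\<And>(P :: real^'n^'n) Q t. transpose P = P \<Longrightarrow> transpose Q = Q \<Longrightarrow>
    (\<forall>x. \<epsilon> * (x \<bullet> x) \<le> x \<bullet> (P *v x)) \<Longrightarrow> (\<forall>x. 0 \<le> x \<bullet> (Q *v x)) \<Longrightarrow>
    (\<forall>x. x \<bullet> (Q *v x) \<le> M * (x \<bullet> x)) \<Longrightarrow> 0 \<le> t \<Longrightarrow> t \<le> 1 \<Longrightarrow>
    \<bar>det ((1 - t) *\<^sub>R P + t *\<^sub>R Q) - det P - t * (det P * (trace (matrix_inv P ** Q) - CARD('n)))\<bar>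
      \<le> C * det P * t\<^sup>2"
    using det_segment_expansion[OF \<epsilon> M, where 'n = 'n] by blast
  \<comment> \<open>Only the upper estimate of \<open>h\<close> is extracted, as \<open>h\<close> is
    nonnegative. Bounding \<open>g k x\<close> by \<open>F\<close> makes the error uniform in
    \<open>k\<close> and \<open>x\<close>.\<close>
  have h_le: "t * h k x \<le> det (B t k x) - g k x + C * F * t\<^sup>2" if x: "x \<in> \<Omega>" and t: "0 \<le> t" "t \<le> 1" for t k x
  proof -
    have "\<forall>y. 0 \<le> y \<bullet> (A (Suc k) x *v y)"
      using lo[OF x] \<epsilon> by (meson inner_ge_zero less_imp_le mult_nonneg_nonneg order_trans)
    then have "\<bar>det (B t k x) - g k x - t * h k x\<bar> \<le> C * g k x * t\<^sup>2"
      using expand[of "A k x" "A (Suc k) x" t] sym[OF x] lo[OF x] hi[OF x] t tr[OF x, of k]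
      by (simp add: B_def g_def h_def)
    moreover have "C * g k x * t\<^sup>2 \<le> C * F * t\<^sup>2"
      using C det(2)[OF x, of k] F[OF x] by (intro mult_right_mono mult_left_mono) (auto simp: g_def)
    ultimately show ?thesis by linarith
  qed
  define J where "J k = integral ?K (h k)" for k
  have J_le: "t * J k \<le> integral ?K (\<lambda>x. det (B t k x)) - integral ?K (g k) + C * F * t\<^sup>2 * c"
    if t: "0 \<le> t" "t \<le> 1" for t k
  proof -
    have "t * J k = integral ?K (\<lambda>x. t * h k x)" by (simp add: J_def)
    also have "\<dots> \<le> integral ?K (\<lambda>x. det (B t k x) - g k x + C * F * t\<^sup>2)"
      using h_le[OF _ t] K by (intro integral_le integrable_on_mult_right integrable_add integrable_diff int integrable_const) auto
    also have "\<dots> = integral ?K (\<lambda>x. det (B t k x)) - integral ?K (g k) + C * F * t\<^sup>2 * c"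
      using integral_unique[OF has_integral_add[OF has_integral_diff[OF integrable_integral[OF int(4)] integrable_integral[OF int(1)]]
            has_integral_const[of "C * F * t\<^sup>2"]]]
      by (simp add: c_def mult.commute)
    finally show ?thesis .
  qed
  have s1: "1 \<le> (f x / g k x) powr (1 / ?n)" if "x \<in> \<Omega>" for k x
    using gpos[OF that, of k] det(2)[OF that, of k] by (intro ge_one_powr_ge_zero) (auto simp: g_def)
  have h0: "0 \<le> h k x" if "x \<in> \<Omega>" for k x
    unfolding h_def using gpos[OF that, of k] s1[OF that, of k] by simp
  have J0: "0 \<le> J k" for k
    unfolding J_def using h0 K by (intro integral_nonneg int) auto
  have c0: "0 \<le> c" by (simp add: c_def)
  have J_lim: "J \<longlonglongrightarrow> 0"
  proof (rule tendstoI)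
    fix e :: real assume "e > 0"
    define D where "D = \<bar>C * F * c\<bar> + 1"
    \<comment> \<open>\<open>t\<close> is fixed before \<open>k\<close>: the second-order error is
      then at most \<open>t * e / 2\<close>. For large \<open>k\<close> the difference of the
      integrals is also below \<open>t * e / 2\<close>, and division by \<open>t\<close> gives
      \<open>J k < e\<close>.\<close>
    define t where "t = min 1 (e / (2 * D))"
    have D: "D > 0" "C * F * c \<le> D" by (auto simp: D_def)
    have t: "0 < t" "t \<le> 1" using \<open>e > 0\<close> D by (auto simp: t_def)
    have "D * t \<le> e / 2" using D \<open>e > 0\<close> by (simp add: t_def min_def field_simps)
    moreover have "C * F * c * t \<le> D * t" using D t by (intro mult_right_mono) auto
    ultimately have small: "C * F * c * t \<le> e / 2" by linarith
    have "(\<lambda>k. integral ?K (\<lambda>x. det (B t k x)) - integral ?K (g k)) \<longlonglongrightarrow> 0"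
      using tendsto_diff[OF conv conv_g] t by simp
    then have "\<forall>\<^sub>F k in sequentially. dist (integral ?K (\<lambda>x. det (B t k x)) - integral ?K (g k)) 0 < t * e / 2"
      using t \<open>e > 0\<close> by (intro tendstoD) auto
    then show "\<forall>\<^sub>F k in sequentially. dist (J k) 0 < e"
    proof eventually_elim
      case (elim k)
      have "C * F * t\<^sup>2 * c = t * (C * F * c * t)" by (simp add: power2_eq_square)
      also have "\<dots> \<le> t * (e / 2)" using small t by (intro mult_left_mono) auto
      finally have "C * F * t\<^sup>2 * c \<le> t * e / 2" by simp
      moreover have "\<bar>integral ?K (\<lambda>x. det (B t k x)) - integral ?K (g k)\<bar> < t * e / 2"
        using elim by (simp only: dist_real_def diff_0_right)
      ultimately have "t * J k < t * e"
        using J_le[OF less_imp_le[OF t(1)] t(2), of k] by linarith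
      then have "J k < e" using t by simp
      then show ?case using J0[of k] by (simp add: dist_real_def)
    qed
  qed
  \<comment> \<open>With s the n-th root of f / g: f - g = g (s^n - 1) \<le> n g s^n (s - 1) = (f /
    g) h, and f / g is at most F / \<epsilon>^n.\<close>
  define R where "R = F / \<epsilon> ^ CARD('n)"
  have fg: "f x - g k x \<le> R * h k x" if x: "x \<in> \<Omega>" for k x
  proof -
    define s where "s = (f x / g k x) powr (1 / ?n)"
    have "f x / g k x > 0" using fpos[OF x] gpos[OF x] by simp
    moreover from this have "s > 0" unfolding s_def by (metis less_irrefl powr_gt_zero)
    ultimately have sn: "s ^ CARD('n) = f x / g k x"
      by (subst powr_realpow[symmetric]) (use gpos[OF x] fpos[OF x] in \<open>simp_all add: s_def powr_powr abs_of_pos\<close>)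
    have heq: "h k x = g k x * (?n * s - ?n)" by (simp add: h_def s_def)
    have "s ^ CARD('n) - 1 \<le> ?n * s ^ CARD('n) * (s - 1)"
      using power_minus_one_le s1[OF x] unfolding s_def by blast
    then have "g k x * (s ^ CARD('n) - 1) \<le> g k x * (?n * s ^ CARD('n) * (s - 1))"
      using gpos[OF x, of k] by (intro mult_left_mono) auto
    also have "\<dots> = (f x / g k x) * h k x"
      unfolding heq sn[symmetric] by (simp add: algebra_simps)
    also have "\<dots> \<le> R * h k x"
      unfolding R_def using F[OF x] det(1)[OF x, of k] \<epsilon> fpos[OF x] h0[OF x]
      by (intro mult_right_mono frac_le) (auto simp: g_def)
    finally show ?thesis
      unfolding sn using gpos[OF x, of k] by (simp add: right_diff_distrib)
  qed
  have "(\<lambda>k. integral ?K f - integral ?K (g k)) \<longlonglongrightarrow> 0"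
  proof (rule tendsto_sandwich[where f = "\<lambda>_. 0" and h = "\<lambda>k. R * J k"])
    show "\<forall>\<^sub>F k in sequentially. 0 \<le> integral ?K f - integral ?K (g k)"
    proof (intro always_eventually allI)
      fix k
      have "integral ?K (g k) \<le> integral ?K f"
        using det(2) K by (intro integral_le int) (auto simp: g_def)
      then show "0 \<le> integral ?K f - integral ?K (g k)" by simp
    qed
    show "\<forall>\<^sub>F k in sequentially. integral ?K f - integral ?K (g k) \<le> R * J k"
    proof (intro always_eventually allI)
      fix k
      have "integral ?K f - integral ?K (g k) = integral ?K (\<lambda>x. f x - g k x)"
        by (simp add: integral_diff int)
      also have "\<dots> \<le> integral ?K (\<lambda>x. R * h k x)"
        using fg K by (intro integral_le integrable_diff integrable_on_mult_right int) auto
      finally show "integral ?K f - integral ?K (g k) \<le> R * J k" by (simp add: J_def)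
    qed
    show "(\<lambda>k. R * J k) \<longlonglongrightarrow> 0" using tendsto_mult_right_zero[OF J_lim] by simp
  qed simp
  then have "(\<lambda>k. integral ?K (g k)) \<longlonglongrightarrow> integral ?K f"
    using tendsto_diff[OF tendsto_const, of _ 0 sequentially "integral ?K f"] by fastforce
  with conv_g show ?thesis by (rule LIMSEQ_unique)
qed

section \<open>Hessians of differences, continuity of Hoelder functions, and the proof of the
  theorem\<close>

lemma matrix_diff_ldistrib: "A ** (B - C) = A ** B - A ** C" for B C :: "real^'n^'m"
  by (vector matrix_matrix_mult_def sum_subtractf[symmetric] right_diff_distrib)

lemma hess_eqI:
  assumes "(grad u has_derivative (\<lambda>h. H *v h)) (at x)"
  shows "hess u x = H"
  using frechet_derivative_at[OF assms] unfolding hess_def jacobian_def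
  by (metis matrix_of_matrix_vector_mul)

lemma grad_hess_diff:
  fixes u w :: "real^'n \<Rightarrow> real"
  assumes "open \<Omega>" and u: "\<And>y. y \<in> \<Omega> \<Longrightarrow> u differentiable (at y)" "\<And>y. y \<in> \<Omega> \<Longrightarrow> grad u differentiable (at y)"
    and w: "\<And>y. y \<in> \<Omega> \<Longrightarrow> w differentiable (at y)" "\<And>y. y \<in> \<Omega> \<Longrightarrow> grad w differentiable (at y)"
    and x: "x \<in> \<Omega>"
  shows "grad (\<lambda>y. u y - w y) differentiable (at x)" "hess (\<lambda>y. u y - w y) x = hess u x - hess w x"
proof -
  have grad: "grad (\<lambda>y. u y - w y) y = grad u y - grad w y" if "y \<in> \<Omega>" for y
  proof (rule grad_eqI)
    show "((\<lambda>y. u y - w y) has_derivative (\<lambda>h. (grad u y - grad w y) \<bullet> h)) (at y)"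
      using has_derivative_diff[OF has_derivative_grad[OF u(1)[OF that]] has_derivative_grad[OF w(1)[OF that]]]
      by (simp add: inner_diff_left)
  qed
  have "((\<lambda>y. grad u y - grad w y) has_derivative (\<lambda>h. (hess u x - hess w x) *v h)) (at x)"
    using has_derivative_diff[OF has_derivative_hess[OF u(2)[OF x]] has_derivative_hess[OF w(2)[OF x]]]
    by (simp add: matrix_vector_mult_diff_rdistrib)
  then have der: "(grad (\<lambda>y. u y - w y) has_derivative (\<lambda>h. (hess u x - hess w x) *v h)) (at x)"
    by (rule has_derivative_transform_within_open[OF _ assms(1) x]) (simp add: grad)
  then show "grad (\<lambda>y. u y - w y) differentiable (at x)" by (rule differentiableI)
  show "hess (\<lambda>y. u y - w y) x = hess u x - hess w x" by (rule hess_eqI[OF der])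
qed

lemma holder_on_imp_continuous_on:
  assumes "holder_on \<alpha> S f" "\<alpha> > 0"
  shows "continuous_on S f"
  unfolding continuous_on_iff
proof (intro ballI allI impI)
  obtain C where C: "\<And>x y. x \<in> S \<Longrightarrow> y \<in> S \<Longrightarrow> norm (f x - f y) \<le> C * norm (x - y) powr \<alpha>"
    using assms(1) by (auto simp: holder_on_def)
  fix x and e :: real assume x: "x \<in> S" and "e > 0"
  \<comment> \<open>Chosen so that \<open>(\<bar>C\<bar> + 1) * d powr \<alpha> = e\<close>.\<close>
  define d where "d = (e / (\<bar>C\<bar> + 1)) powr (1 / \<alpha>)"
  have d: "d > 0" "d powr \<alpha> = e / (\<bar>C\<bar> + 1)"
    using \<open>e > 0\<close> assms(2) by (auto simp: d_def powr_powr)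
  show "\<exists>d>0. \<forall>y\<in>S. dist y x < d \<longrightarrow> dist (f y) (f x) < e"
  proof (intro exI[of _ d] conjI ballI impI)
    fix y assume y: "y \<in> S" "dist y x < d"
    have "norm (f y - f x) \<le> C * norm (y - x) powr \<alpha>" by (rule C[OF y(1) x])
    also have "\<dots> \<le> \<bar>C\<bar> * norm (y - x) powr \<alpha>" by (intro mult_right_mono) auto
    also have "\<dots> \<le> \<bar>C\<bar> * d powr \<alpha>"
      using y(2) assms(2) by (intro mult_left_mono powr_mono2) (auto simp: dist_norm)
    also have "\<dots> < (\<bar>C\<bar> + 1) * d powr \<alpha>" using d(1) by (simp add: distrib_right)
    also have "\<dots> = e" using d(2) by (simp add: field_simps)
    finally show "dist (f y) (f x) < e" by (simp add: dist_norm)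
  qed (fact d)
qed

theorem theorem4p1:
  fixes \<Omega> :: "(real^'n) set"
    and \<alpha> \<epsilon> :: real
    and \<phi> f :: "real^'n \<Rightarrow> real"
    and B :: "nat \<Rightarrow> real^'n \<Rightarrow> real^'n^'n"
    and u :: "nat \<Rightarrow> real^'n \<Rightarrow> real"
  assumes "0 < \<alpha>" "\<alpha> < 1"
    and "open \<Omega>" "connected \<Omega>" "\<Omega> \<noteq> {}" "bounded \<Omega>"
    and "strictly_convex \<Omega>" "C2_holder_domain \<alpha> \<Omega>"
    and "C2_holder_closure \<alpha> \<Omega> \<phi>"
    and "holder_on \<alpha> (closure \<Omega>) f"
    and "\<forall>x\<in>closure \<Omega>. f x > 0"
    and "\<forall>x\<in>closure \<Omega>. B 0 x \<in> unimodular_spd"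
    and "\<forall>i j. holder_on \<alpha> (closure \<Omega>) (\<lambda>x. B 0 x $ i $ j)"
    and "\<forall>k\<ge>1. \<forall>x\<in>closure \<Omega>.
           B k x = det (D2 \<Omega> (u (k - 1)) x) powr (1 / real CARD('n)) *\<^sub>R
                   matrix_inv (D2 \<Omega> (u (k - 1)) x)"
    and "\<forall>k. C2_holder_closure \<alpha> \<Omega> (u k)"
    and "\<forall>k. strongly_convex \<Omega> (u k)"
    and "\<forall>k. \<forall>x\<in>\<Omega>. trace (B k x ** D2 \<Omega> (u k) x) =
                       real CARD('n) * f x powr (1 / real CARD('n))"
    and "\<forall>k. \<forall>x\<in>frontier \<Omega>. u k x = \<phi> x"
    and "\<epsilon> > 0"
    and "\<forall>k. \<forall>x\<in>closure \<Omega>. Min (eigenvals (D2 \<Omega> (u k) x)) \<ge> \<epsilon>"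
  shows "\<exists>v. uniform_limit (closure \<Omega>) u v sequentially \<and>
             convex_on (closure \<Omega>) v \<and>
             C1_holder_closure 1 \<Omega> v \<and>
             aleksandrov_solution \<Omega> f v \<and>
             (\<forall>x\<in>frontier \<Omega>. v x = \<phi> x)"
proof -
  let ?n = "real CARD('n)"
  have "convex \<Omega>" using assms(7) by (simp add: strictly_convex_def)
  have clo: "x \<in> closure \<Omega>" if "x \<in> \<Omega>" for x using that closure_subset by blast
  have C2: "C2_closure \<Omega> (u k)" for k using assms(15) by (simp add: C2_holder_closure_def)
  have diff: "u k differentiable (at x)" "grad (u k) differentiable (at x)" if "x \<in> \<Omega>" for k x
    using C2[of k] that by (auto simp: C2_closure_def C1_closure_def)
  have cont: "continuous_on (closure \<Omega>) (u k)" for k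
    using C2[of k] by (auto simp: C2_closure_def C1_closure_def)
  have cont_hess: "continuous_on \<Omega> (hess (u k))" for k
  proof -
    obtain G where "continuous_on (closure \<Omega>) G" "\<forall>x\<in>\<Omega>. G x = hess (u k) x"
      using C2[of k] by (auto simp: C2_closure_def extends_to_closure_def)
    then show ?thesis
      by (metis closure_subset continuous_on_cong continuous_on_subset)
  qed
  have D2: "D2 \<Omega> (u k) x = hess (u k) x" if "x \<in> \<Omega>" for k x
    using that by (simp add: D2_def)
  have sym: "transpose (hess (u k) x) = hess (u k) x" if "x \<in> \<Omega>" for k x
    by (rule hess_symmetric[OF assms(3) that diff(1) diff(2)[OF that]])
  have lo: "\<epsilon> * (h \<bullet> h) \<le> h \<bullet> (hess (u k) x *v h)" if "x \<in> \<Omega>" for k x h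
    using assms(20) clo[OF that] D2[OF that] by (intro Min_eigenvals_le_quadratic_form sym[OF that]) metis
  have spd: "spd (hess (u k) x)" if "x \<in> \<Omega>" for k x
    by (rule quadratic_form_bound_imp_spd[OF sym[OF that] assms(19) lo[OF that]])
  have detpos: "det (hess (u k) x) > 0" if "x \<in> \<Omega>" for k x
    by (rule spd_imp_det_pos[OF spd[OF that]])
  have fpos: "f x > 0" if "x \<in> \<Omega>" for x using assms(11) clo[OF that] by blast
  have eqn: "trace ((det (hess (u k) x) powr (1 / ?n) *\<^sub>R matrix_inv (hess (u k) x)) ** hess (u (Suc k)) x)
      = ?n * f x powr (1 / ?n)" if "x \<in> \<Omega>" for k x
  proof -
    have "B (Suc k) x = det (hess (u k) x) powr (1 / ?n) *\<^sub>R matrix_inv (hess (u k) x)"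
      using assms(14)[rule_format, of "Suc k" x] clo[OF that] D2[OF that] by simp
    then show ?thesis using assms(17)[rule_format, of x "Suc k"] that D2[OF that] by simp
  qed
  have det_le: "det (hess (u (Suc k)) x) \<le> f x" if "x \<in> \<Omega>" for k x
  proof (rule ccontr)
    assume "\<not> det (hess (u (Suc k)) x) \<le> f x"
    then have "f x powr (1 / ?n) < det (hess (u (Suc k)) x) powr (1 / ?n)"
      using fpos[OF that] by (intro powr_less_mono2) auto
    moreover have "?n * det (hess (u (Suc k)) x) powr (1 / ?n) \<le> ?n * f x powr (1 / ?n)"
      using det_le_trace_powr[OF spd spd, OF that that] eqn[OF that] by metis
    ultimately show False by simp
  qed
  \<comment> \<open>Dividing the equation by the power of the determinant isolates the trace of
    inverse(P) Q, the form in which it enters both the maximum principle and the limit of the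
    determinants.\<close>
  have tr: "trace (matrix_inv (hess (u k) x) ** hess (u (Suc k)) x) = ?n * (f x / det (hess (u k) x)) powr (1 / ?n)"
    if "x \<in> \<Omega>" for k x
    using eqn[OF that, of k] detpos[OF that, of k] fpos[OF that]
    by (simp add: trace_scaleR_matrix_inv_mult powr_divide field_simps)
  have contf: "continuous_on (closure \<Omega>) f"
    by (rule holder_on_imp_continuous_on[OF assms(10,1)])
  have "bounded (f ` closure \<Omega>)"
    using assms(6) by (intro compact_imp_bounded compact_continuous_image contf) (simp add: compact_closure)
  then obtain F where F: "\<And>x. x \<in> closure \<Omega> \<Longrightarrow> f x \<le> F"
    by (auto simp: bounded_iff intro: order_trans[OF abs_ge_self])
  define M where "M = F / \<epsilon> ^ (CARD('n) - 1)"
  have det_F: "det (hess (u (Suc k)) x) \<le> F" if "x \<in> \<Omega>" for k x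
    using det_le[OF that, of k] F[OF clo[OF that]] by linarith
  obtain x0 where "x0 \<in> \<Omega>" using assms(5) by blast
  then have M: "M \<ge> 0" using F[OF clo] fpos assms(19) unfolding M_def by (metis divide_nonneg_pos less_imp_le order_trans zero_less_power)
  note bounds = spd_det_bound_imp_upper_bound[OF sym assms(19) lo det_F, folded M_def]
  \<comment> \<open>The shift by one makes \<open>det_le\<close>, which rests on coefficients built
    from the preceding Hessian, available for every index.\<close>
  define U where "U k = u (Suc k)" for k
  have pinched: "quadratically_pinched \<epsilon> M \<Omega> (U k) (grad (U k))" for k
    unfolding U_def
    by (rule hess_bounds_imp_quadratically_pinched[OF \<open>convex \<Omega>\<close> diff lo bounds(1)])
  have lip: "norm (grad (U k) x - grad (U k) y) \<le> M * norm (x - y)" if "x \<in> \<Omega>" "y \<in> \<Omega>" for k x y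
    unfolding U_def by (rule grad_Lipschitz[OF \<open>convex \<Omega>\<close> diff(2) bounds(2) that])
  have mono: "U (Suc k) x \<le> U k x" if "x \<in> closure \<Omega>" for k x
  proof -
    have "U (Suc k) x - U k x \<le> 0"
      unfolding U_def
    proof (rule maximum_principle[OF assms(3,6), where P = "hess (u (Suc k))"])
      show "continuous_on (closure \<Omega>) (\<lambda>x. u (Suc (Suc k)) x - u (Suc k) x)"
        by (intro continuous_intros cont)
      show "(\<lambda>x. u (Suc (Suc k)) x - u (Suc k) x) differentiable (at y)" if "y \<in> \<Omega>" for y
        by (intro differentiable_diff diff that)
      show "grad (\<lambda>x. u (Suc (Suc k)) x - u (Suc k) x) differentiable (at y)" if "y \<in> \<Omega>" for y
        by (rule grad_hess_diff(1)[OF assms(3) diff diff that])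
      show "spd (hess (u (Suc k)) y)" if "y \<in> \<Omega>" for y by (rule spd[OF that])
      \<comment> \<open>With P the Hessian of \<open>u (Suc k)\<close> the trace equals n (s - 1),
        where s is the n-th root of f / det P, and s \<ge> 1 because det P \<le> f.\<close>
      show "0 \<le> trace (matrix_inv (hess (u (Suc k)) y) ** hess (\<lambda>x. u (Suc (Suc k)) x - u (Suc k) x) y)"
        if "y \<in> \<Omega>" for y
      proof -
        let ?P = "hess (u (Suc k)) y"
        have "invertible ?P" using detpos[OF that, of "Suc k"] by (simp add: invertible_det_nz)
        then have "matrix_inv ?P ** ?P = mat 1"
          by (metis invertible_def matrix_inv_eqI)
        then have "trace (matrix_inv ?P ** (hess (u (Suc (Suc k))) y - ?P))
            = ?n * (f y / det ?P) powr (1 / ?n) - ?n"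
          by (simp add: matrix_diff_ldistrib trace_sub tr[OF that] trace_I)
        moreover have "1 \<le> (f y / det ?P) powr (1 / ?n)"
          using det_le[OF that, of k] detpos[OF that, of "Suc k"] by (intro ge_one_powr_ge_zero) auto
        ultimately show ?thesis
          by (simp add: grad_hess_diff(2)[OF assms(3) diff diff that])
      qed
      show "u (Suc (Suc k)) y - u (Suc k) y \<le> 0" if "y \<in> frontier \<Omega>" for y
        using assms(18) that by simp
    qed (fact that)
    then show ?thesis by simp
  qed
  have contU: "continuous_on (closure \<Omega>) (U k)" for k unfolding U_def by (rule cont)
  have bdryU: "U k y = \<phi> y" if "y \<in> frontier \<Omega>" for k y using assms(18) that by (simp add: U_def)
  obtain v q where v: "uniform_limit (closure \<Omega>) U v sequentially" "continuous_on (closure \<Omega>) v"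
    "quadratically_pinched \<epsilon> M \<Omega> v q" "\<And>x. x \<in> \<Omega> \<Longrightarrow> (\<lambda>k. grad (U k) x) \<longlonglongrightarrow> q x"
  proof (rule monotone_scheme_converges[where u = U and p = "\<lambda>k. grad (U k)" and \<phi> = \<phi>,
        OF assms(3,6,5) M less_imp_le[OF assms(19)] pinched contU lip bdryU mono])
    fix v q
    assume "uniform_limit (closure \<Omega>) U v sequentially" "continuous_on (closure \<Omega>) v"
      "quadratically_pinched \<epsilon> M \<Omega> v q" "\<And>x. x \<in> \<Omega> \<Longrightarrow> (\<lambda>k. grad (U k) x) \<longlonglongrightarrow> q x"
    then show thesis by (rule that)
  qed
  have v0: "quadratically_pinched 0 M \<Omega> v q"
    by (rule quadratically_pinched_mono[OF v(3)]) (use assms(19) in simp)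
  \<comment> \<open>Pointwise convergence of the gradients suffices: a Lipschitz inequality with a
    fixed constant is closed under limits.\<close>
  have lipq: "norm (q x - q y) \<le> M * norm (x - y)" if "x \<in> \<Omega>" "y \<in> \<Omega>" for x y
    by (rule LIMSEQ_le_const2[OF tendsto_norm[OF tendsto_diff[OF v(4)[OF that(1)] v(4)[OF that(2)]]]])
      (use lip[OF that] in blast)
  have "uniform_limit (closure \<Omega>) u v sequentially"
    using v(1) unfolding U_def by (rule filterlim_sequentially_Suc[THEN iffD1])
  moreover have "convex_on (closure \<Omega>) v"
    by (rule quadratically_pinched_imp_convex_on_closure[OF v0 \<open>convex \<Omega>\<close> v(2)])
  moreover have "C1_holder_closure 1 \<Omega> v"
    by (rule quadratically_pinched_imp_C1_1[OF assms(3) v(3,2) lipq])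
  moreover have "v x = \<phi> x" if "x \<in> frontier \<Omega>" for x
  proof -
    have "x \<in> closure \<Omega>" using that by (simp add: frontier_def)
    then have "(\<lambda>k. U k x) \<longlonglongrightarrow> v x" by (rule tendsto_uniform_limitI[OF v(1)])
    then show ?thesis using bdryU[OF that] by (simp add: LIMSEQ_const_iff)
  qed
  moreover have "aleksandrov_solution \<Omega> f v"
    unfolding aleksandrov_solution_def monge_ampere_def
  proof (intro ballI impI)
    fix E :: "(real^'n) set" assume E: "E \<in> sets borel" "E \<subseteq> \<Omega>"
    have boxes: "measure lebesgue (q ` cbox a b) = integral (cbox a b) f" if "cbox a b \<subseteq> \<Omega>" for a b
    proof (rule measure_limit_gradient_image[where U = U and p = "\<lambda>k. grad (U k)"
            and A = "\<lambda>k. hess (U k)" and F = F,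
          OF assms(3,19) M pinched _ _ _ _ _ _ _ _ _ _ _ v(3) lipq that])
      show "(grad (U k) has_derivative (\<lambda>h. hess (U k) x *v h)) (at x)" if "x \<in> \<Omega>" for k x
        unfolding U_def by (rule has_derivative_hess[OF diff(2)[OF that]])
      show "continuous_on \<Omega> (hess (U k))" for k unfolding U_def by (rule cont_hess)
      show "transpose (hess (U k) x) = hess (U k) x" if "x \<in> \<Omega>" for k x
        unfolding U_def by (rule sym[OF that])
      show "\<epsilon> * (h \<bullet> h) \<le> h \<bullet> (hess (U k) x *v h)" if "x \<in> \<Omega>" for k x h
        unfolding U_def by (rule lo[OF that])
      show "h \<bullet> (hess (U k) x *v h) \<le> M * (h \<bullet> h)" if "x \<in> \<Omega>" for k x h
        unfolding U_def by (rule bounds(1)[OF that that that])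
      show "\<epsilon> ^ CARD('n) \<le> det (hess (U k) x)" if "x \<in> \<Omega>" for k x
        unfolding U_def by (rule bounds(3)[OF that that that])
      show "det (hess (U k) x) \<le> f x" if "x \<in> \<Omega>" for k x
        unfolding U_def by (rule det_le[OF that])
      show "f x \<le> F" if "x \<in> \<Omega>" for x by (rule F[OF clo[OF that]])
      show "continuous_on \<Omega> f" by (rule continuous_on_subset[OF contf closure_subset])
      show "trace (matrix_inv (hess (U k) x) ** hess (U (Suc k)) x) = ?n * (f x / det (hess (U k) x)) powr (1 / ?n)"
        if "x \<in> \<Omega>" for k x
        unfolding U_def by (rule tr[OF that])
      show "uniform_limit \<Omega> U v sequentially"
        by (rule uniform_limit_on_subset[OF v(1) closure_subset])
    qed
    \<comment> \<open>Each subdifferential is a single gradient, so the Monge-Ampere measure of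
      \<open>E\<close> is the Lebesgue measure of its image under \<open>q\<close>.\<close>
    have "(\<Union>x\<in>E. subdifferential \<Omega> v x) = q ` E"
      using subdifferential_quadratically_pinched[OF v0 assms(3)] E(2) by auto
    moreover have "continuous_on \<Omega> q"
      using lipq M by (intro lipschitz_on_continuous_on[of M] lipschitz_onI) (auto simp: dist_norm)
    ultimately show "(\<Union>x\<in>E. subdifferential \<Omega> v x) \<in> sets lebesgue \<and>
        emeasure lebesgue (\<Union>x\<in>E. subdifferential \<Omega> v x) = (\<integral>\<^sup>+x\<in>E. ennreal (f x) \<partial>lborel)"
      using image_measure_eq_if_eq_on_cboxes[OF assms(3) _ quadratically_pinched_inj_on[OF v(3) assms(19)]
          continuous_on_subset[OF contf closure_subset] less_imp_le[OF fpos] boxes E]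
      by simp
  qed
  ultimately show ?thesis by blast
qed

end
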